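(* The following critically finite endomorphisms of $\mathbb{P}^2$ are Lattès examples: $$f_1:[x:y:z]\mapsto[(-x+y+z)^2:(x-y+z)^2:(x+y-z)^2],$$ $$f_2:[x:y:z]\mapsto[(x-y+z)^2:(-x+y+z)^2:(x+y-z)^2],$$ $$f_3:[x:y:z]\mapsto[(x+y-z)^2:(-x+y+z)^2:(x-y+z)^2].$$ They are semi-conjugate, respectively, to the dilations $$D_1=\sqrt2\begin{pmatrix}e^{i\pi/4}&0\\0&e^{i\pi/4}\end{pmatrix},\quad D_2=\sqrt2\begin{pmatrix}\frac1{\sqrt2}&\frac1{\sqrt2}\\\frac1{\sqrt2}&\frac{-1}{\sqrt2}\end{pmatrix},\quad D_3=\sqrt2\begin{pmatrix}\frac1{\sqrt2}&\frac1{\sqrt2}\\\frac{i}{\sqrt2}&\frac{-i}{\sqrt2}\end{pmatrix}$$ by the Galois covering $A_i\times A_i\to\mathbb{P}^2$ of group $\left\langle G(4,2,2),\frac{1+i}{2}\binom{1}{1}\right\rangle$; that is, there is a Galois covering $\sigma:A_i\times A_i\to\mathbb{P}^2$ with this group such that $\sigma\circ D_j=f_j\circ\sigma$ for $j=1,2,3$.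
   Context: $A_i=\mathbb{C}/(\mathbb{Z}+i\mathbb{Z})$, and each matrix $D_j$ is regarded as the endomorphism it induces on $A_i\times A_i=\mathbb{C}^2/(\mathbb{Z}+i\mathbb{Z})^2$. $G(m,p,2)$ is the group generated by the matrices $\begin{pmatrix}0&1\\1&0\end{pmatrix}$, $\begin{pmatrix}0&e^{2i\pi/m}\\ e^{-2i\pi/m}&0\end{pmatrix}$, $\begin{pmatrix}e^{2ip\pi/m}&0\\0&1\end{pmatrix}$. The group $\langle G(4,2,2),\frac{1+i}{2}\binom11\rangle$ is the group of automorphisms of $A_i\times A_i$ generated by $G(4,2,2)$ and the translation by the vector $\frac{1+i}{2}\binom11$. A Galois covering of group $G$ is a (possibly ramified) finite holomorphic map which is the quotient map by a finite group $G$ of automorphisms of the source. A Lattès example of $\mathbb{P}^k$ is a holomorphic endomorphism $f$ of $\mathbb{P}^k$ of degree $d\ge2$ such that there exist a complex torus $A^k$ of dimension $k$, a holomorphic endomorphism $D$ of $A^k$ and a Galois covering $\sigma:A^k\to\mathbb{P}^k$ with $\sigma\circ D=f\circ\sigma$. A holomorphic endomorphism $f$ of $\mathbb{P}^k$ is critically finite if $\bigcup_{n\ge1}f^n(\mathcal{C}_f)$ is algebraic, where $\mathcal{C}_f$ is the critical set of $f$. *)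

theory Defs
  imports "HOL-Analysis.Analysis" "HOL-Algebra.Bij" "HOL-Algebra.Generated_Groups"
begin

section \<open>Complex manifolds and holomorphic maps\<close>

text \<open>
  A manifold of dimension \<open>CARD('d)\<close> is given by its set of points and an atlas of charts
  \<open>(U, \<phi>)\<close>, where \<open>\<phi>\<close> is injective on \<open>U\<close> and has open image in \<open>complex ^ 'd\<close>. The topology is
  the one determined by the charts.
\<close>

record ('a, 'd) complex_manifold =
  points :: "'a set"
  charts :: "('a set \<times> ('a \<Rightarrow> complex ^ 'd)) set"

definition holomorphic_vec_on :: "(complex ^ 'a \<Rightarrow> complex ^ 'b) \<Rightarrow> (complex ^ 'a) set \<Rightarrow> bool" where
  "holomorphic_vec_on F W \<longleftrightarrow> (\<forall>z\<in>W. \<exists>J :: complex ^ 'a ^ 'b. (F has_derivative (*v) J) (at z))"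

text \<open>
  For every pair of charts, the coordinate expression has open domain and is holomorphic there.
  Openness of all these domains is continuity of \<open>f\<close>.
\<close>

definition holomorphic_map ::
  "('a, 'c::finite) complex_manifold \<Rightarrow> ('b, 'd::finite) complex_manifold \<Rightarrow> ('a \<Rightarrow> 'b) \<Rightarrow> bool" where
  "holomorphic_map M N f \<longleftrightarrow>
     f ` points M \<subseteq> points N \<and>
     (\<forall>(U, \<phi>) \<in> charts M. \<forall>(V, \<psi>) \<in> charts N.
        open (\<phi> ` (U \<inter> f -` V)) \<and>
        holomorphic_vec_on (\<psi> \<circ> f \<circ> inv_into U \<phi>) (\<phi> ` (U \<inter> f -` V)))"

text \<open>
  The points where the Jacobian determinant of a holomorphic self-map vanishes; this does not
  depend on the charts used to compute the Jacobian matrix.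
\<close>

definition critical_set :: "('a, 'd::finite) complex_manifold \<Rightarrow> ('a \<Rightarrow> 'a) \<Rightarrow> 'a set" where
  "critical_set M f =
     {x \<in> points M. \<exists>(U, \<phi>) \<in> charts M. \<exists>(V, \<psi>) \<in> charts M. x \<in> U \<and> f x \<in> V \<and>
        (\<exists>J :: complex ^ 'd ^ 'd.
           ((\<psi> \<circ> f \<circ> inv_into U \<phi>) has_derivative (*v) J) (at (\<phi> x)) \<and> det J = 0)}"

text \<open>
  Elements of \<open>BijGroup\<close> are extensional, so equal automorphisms are equal as functions. Inverses
  are holomorphic because they belong to \<open>G\<close> too. The last two conjuncts say that \<open>\<sigma>\<close> is the
  quotient map by \<open>G\<close>; its fibres are finite since they are orbits of the finite group \<open>G\<close>.
\<close>

definition galois_covering ::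
  "('a, 'd::finite) complex_manifold \<Rightarrow> ('b, 'd::finite) complex_manifold \<Rightarrow> ('a \<Rightarrow> 'a) set \<Rightarrow> ('a \<Rightarrow> 'b) \<Rightarrow> bool" where
  "galois_covering M N G \<sigma> \<longleftrightarrow>
     finite G \<and> subgroup G (BijGroup (points M)) \<and> (\<forall>g\<in>G. holomorphic_map M M g) \<and>
     holomorphic_map M N \<sigma> \<and>
     \<sigma> ` points M = points N \<and>
     (\<forall>x\<in>points M. \<forall>y\<in>points M. \<sigma> x = \<sigma> y \<longleftrightarrow> (\<exists>g\<in>G. y = g x))"


section \<open>Complex tori\<close>

definition is_lattice :: "(complex ^ 'k) set \<Rightarrow> bool" where
  "is_lattice \<Lambda> \<longleftrightarrow>
     (\<exists>B. independent B \<and> span B = UNIV \<and>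
          \<Lambda> = range (\<lambda>c :: complex ^ 'k \<Rightarrow> int. \<Sum>b\<in>B. of_int (c b) *\<^sub>R b))"

definition torus_proj :: "(complex ^ 'k) set \<Rightarrow> complex ^ 'k \<Rightarrow> (complex ^ 'k) set" where
  "torus_proj \<Lambda> z = (\<lambda>l. z + l) ` \<Lambda>"

definition torus :: "(complex ^ 'k) set \<Rightarrow> ((complex ^ 'k) set, 'k) complex_manifold" where
  "torus \<Lambda> =
     \<lparr>points = range (torus_proj \<Lambda>),
      charts = {(torus_proj \<Lambda> ` V, inv_into V (torus_proj \<Lambda>)) | V.
                  open V \<and> inj_on (torus_proj \<Lambda>) V}\<rparr>"

text \<open>
  The map \<open>[z] \<mapsto> [h z]\<close>, for \<open>h\<close> compatible with congruence modulo \<open>\<Lambda>\<close> (all members of the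
  union are then the same coset).
\<close>

definition torus_induced ::
  "(complex ^ 'k) set \<Rightarrow> (complex ^ 'k \<Rightarrow> complex ^ 'k) \<Rightarrow> (complex ^ 'k) set \<Rightarrow> (complex ^ 'k) set" where
  "torus_induced \<Lambda> h = (\<lambda>X \<in> points (torus \<Lambda>). \<Union>z\<in>X. torus_proj \<Lambda> (h z))"


section \<open>Projective space\<close>

definition proj_rel :: "complex ^ 'n \<Rightarrow> complex ^ 'n \<Rightarrow> bool" where
  "proj_rel z w \<longleftrightarrow> z \<noteq> 0 \<and> w \<noteq> 0 \<and> (\<exists>c. c \<noteq> 0 \<and> w = c *s z)"

text \<open>The homogeneous coordinates are indexed by \<open>'n\<close>, so the dimension is \<open>CARD('n) - 1\<close>.\<close>

quotient_type 'n proj = "complex ^ 'n::finite" / partial: proj_rel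
  morphisms rep_proj proj_pt
proof (rule part_equivpI)
  show "\<exists>z :: complex ^ 'n. proj_rel z z"
    by (rule exI[of _ "\<chi> i. 1"]) (auto simp: proj_rel_def vec_eq_iff intro!: exI[of _ 1])
  show "symp (proj_rel :: complex ^ 'n \<Rightarrow> _)"
  proof (rule sympI)
    fix z w :: "complex ^ 'n" assume "proj_rel z w"
    then obtain c where "z \<noteq> 0" "w \<noteq> 0" "c \<noteq> 0" "w = c *s z"
      by (auto simp: proj_rel_def)
    then show "proj_rel w z"
      by (auto simp: proj_rel_def vec_eq_iff intro!: exI[of _ "inverse c"])
  qed
  show "transp (proj_rel :: complex ^ 'n \<Rightarrow> _)"
  proof (rule transpI)
    fix x y z :: "complex ^ 'n" assume "proj_rel x y" "proj_rel y z"
    then obtain c d where "x \<noteq> 0" "z \<noteq> 0" "c \<noteq> 0" "d \<noteq> 0" "y = c *s x" "z = d *s y"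
      by (auto simp: proj_rel_def)
    then show "proj_rel x z"
      by (auto simp: proj_rel_def vec_eq_iff intro!: exI[of _ "d * c"])
  qed
qed

lift_definition coord_nonzero :: "'n::finite \<Rightarrow> 'n proj \<Rightarrow> bool" is "\<lambda>i z. z $ i \<noteq> 0"
  by (auto simp: proj_rel_def)

text \<open>
  The affine chart \<open>[z] \<mapsto> (z\<^sub>j / z\<^sub>i)\<^sub>j\<^sub>\<noteq>\<^sub>i\<close>; the bijection \<open>e\<close> from \<open>'k\<close> onto \<open>UNIV - {i}\<close> numbers
  the remaining coordinates.
\<close>

lift_definition affine_chart :: "'n::finite \<Rightarrow> ('k::finite \<Rightarrow> 'n) \<Rightarrow> 'n proj \<Rightarrow> complex ^ 'k"
  is "\<lambda>i e z. \<chi> j. z $ e j / z $ i"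
  unfolding proj_rel_def by (elim conjE exE) simp

text \<open>Meaningful when \<open>CARD('n) = CARD('k) + 1\<close>; otherwise there are no charts.\<close>

definition projective_space :: "('n::finite proj, 'k::finite) complex_manifold" where
  "projective_space =
     \<lparr>points = UNIV,
      charts = {({p. coord_nonzero i p}, affine_chart i e) | i e. bij_betw e UNIV (UNIV - {i})}\<rparr>"

definition homogeneous_poly :: "nat \<Rightarrow> (complex ^ 'n \<Rightarrow> complex) \<Rightarrow> bool" where
  "homogeneous_poly d P \<longleftrightarrow>
     (\<exists>c :: ('n \<Rightarrow> nat) \<Rightarrow> complex.
        P = (\<lambda>z. \<Sum>m | (\<Sum>i\<in>UNIV. m i) = d. c m * (\<Prod>i\<in>UNIV. z $ i ^ m i)))"

definition algebraic_set :: "'n::finite proj set \<Rightarrow> bool" where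
  "algebraic_set S \<longleftrightarrow>
     (\<exists>\<P>. finite \<P> \<and> (\<forall>P\<in>\<P>. \<exists>d. homogeneous_poly d P) \<and>
          S = {proj_pt z | z. z \<noteq> 0 \<and> (\<forall>P\<in>\<P>. P z = 0)})"

definition has_degree :: "('n::finite proj \<Rightarrow> 'n proj) \<Rightarrow> nat \<Rightarrow> bool" where
  "has_degree f d \<longleftrightarrow>
     (\<exists>F :: complex ^ 'n \<Rightarrow> complex ^ 'n.
        (\<forall>i. homogeneous_poly d (\<lambda>z. F z $ i)) \<and>
        (\<forall>z. z \<noteq> 0 \<longrightarrow> F z \<noteq> 0 \<and> f (proj_pt z) = proj_pt (F z)))"


section \<open>Critically finite maps and Lattes examples of the projective space of dimension \<open>CARD('k)\<close>\<close>

definition critically_finite :: "'k::finite itself \<Rightarrow> ('n::finite proj \<Rightarrow> 'n proj) \<Rightarrow> bool" where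
  "critically_finite _ f \<longleftrightarrow>
     (let P = (projective_space :: ('n proj, 'k) complex_manifold) in
        CARD('n) = CARD('k) + 1 \<and>
        holomorphic_map P P f \<and>
        algebraic_set (\<Union>n\<in>{1..}. (f ^^ n) ` critical_set P f))"

definition lattes_example :: "'k::finite itself \<Rightarrow> ('n::finite proj \<Rightarrow> 'n proj) \<Rightarrow> bool" where
  "lattes_example _ f \<longleftrightarrow>
     (let P = (projective_space :: ('n proj, 'k) complex_manifold) in
        CARD('n) = CARD('k) + 1 \<and>
        holomorphic_map P P f \<and>
        (\<exists>d\<ge>2. has_degree f d) \<and>
        (\<exists>\<Lambda> D G \<sigma>.
           is_lattice \<Lambda> \<and>
           holomorphic_map (torus \<Lambda>) (torus \<Lambda>) D \<and>
           galois_covering (torus \<Lambda>) P G \<sigma> \<and>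
           (\<forall>x\<in>points (torus \<Lambda>). \<sigma> (D x) = f (\<sigma> x))))"


section \<open>The torus, the covering group and the maps\<close>

definition gaussian_lattice :: "(complex ^ 2) set" where
  "gaussian_lattice = {z. \<forall>j. \<exists>a b :: int. z $ j = of_int a + of_int b * \<i>}"

definition GL :: "(complex ^ 'n ^ 'n) monoid" where
  "GL = \<lparr>carrier = {M. invertible M}, mult = (**), one = mat 1\<rparr>"

definition Gmp2 :: "nat \<Rightarrow> nat \<Rightarrow> (complex ^ 2 ^ 2) set" where
  "Gmp2 m p = generate GL
     {vector [vector [0, 1], vector [1, 0]],
      vector [vector [0, exp (2 * \<i> * of_real pi / of_nat m)],
              vector [exp (- 2 * \<i> * of_real pi / of_nat m), 0]],
      vector [vector [exp (2 * \<i> * of_nat p * of_real pi / of_nat m), 0], vector [0, 1]]}"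

definition covering_group :: "((complex ^ 2) set \<Rightarrow> (complex ^ 2) set) set" where
  "covering_group = generate (BijGroup (points (torus gaussian_lattice)))
     ((\<lambda>M. torus_induced gaussian_lattice ((*v) M)) ` Gmp2 4 2 \<union>
      {torus_induced gaussian_lattice (\<lambda>z. z + ((1 + \<i>) / 2) *s vector [1, 1])})"

definition D1 :: "complex ^ 2 ^ 2" where
  "D1 = sqrt 2 *\<^sub>R vector [vector [exp (\<i> * of_real pi / 4), 0], vector [0, exp (\<i> * of_real pi / 4)]]"

definition D2 :: "complex ^ 2 ^ 2" where
  "D2 = sqrt 2 *\<^sub>R vector [vector [1 / of_real (sqrt 2), 1 / of_real (sqrt 2)],
                        vector [1 / of_real (sqrt 2), - 1 / of_real (sqrt 2)]]"

definition D3 :: "complex ^ 2 ^ 2" where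
  "D3 = sqrt 2 *\<^sub>R vector [vector [1 / of_real (sqrt 2), 1 / of_real (sqrt 2)],
                        vector [\<i> / of_real (sqrt 2), - \<i> / of_real (sqrt 2)]]"

lemma linear_forms_zero:
  fixes v :: "complex ^ 3"
  assumes "- v$1 + v$2 + v$3 = 0" "v$1 - v$2 + v$3 = 0" "v$1 + v$2 - v$3 = 0"
  shows "v = 0"
proof -
  have "2 * v$3 = 0" "2 * v$2 = 0" "2 * v$1 = 0"
    using arg_cong2[OF assms(1,2), of "(+)"] arg_cong2[OF assms(1,3), of "(+)"]
      arg_cong2[OF assms(2,3), of "(+)"]
    by simp_all
  then have "v$1 = 0 \<and> v$2 = 0 \<and> v$3 = 0" by simp
  then show ?thesis by (simp add: vec_eq_iff forall_3)
qed

lemma vector3_eq_0_iff: "(vector [a, b, c] :: complex ^ 3) = 0 \<longleftrightarrow> a = 0 \<and> b = 0 \<and> c = 0"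
  by (simp add: vec_eq_iff forall_3)

lemma smult_vector3: "k *s (vector [a, b, c] :: complex ^ 3) = vector [k * a, k * b, k * c]"
  by (simp add: vec_eq_iff forall_3)

lemma linear_forms_smult:
  fixes v :: "complex ^ 3"
  shows "(- (c *s v)$1 + (c *s v)$2 + (c *s v)$3)\<^sup>2 = c\<^sup>2 * (- v$1 + v$2 + v$3)\<^sup>2"
    "((c *s v)$1 - (c *s v)$2 + (c *s v)$3)\<^sup>2 = c\<^sup>2 * (v$1 - v$2 + v$3)\<^sup>2"
    "((c *s v)$1 + (c *s v)$2 - (c *s v)$3)\<^sup>2 = c\<^sup>2 * (v$1 + v$2 - v$3)\<^sup>2"
  by (simp_all add: right_diff_distrib distrib_left flip: power_mult_distrib)

lemma proj_relI:
  assumes "proj_rel v w" "\<And>z. z \<noteq> 0 \<Longrightarrow> F z \<noteq> 0" "\<And>c z. F (c *s z) = c\<^sup>2 *s F z"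
  shows "proj_rel (F v) (F w)"
proof -
  from assms(1) obtain c where "v \<noteq> 0" "w \<noteq> 0" "c \<noteq> 0" "w = c *s v"
    unfolding proj_rel_def by blast
  moreover have "F w = c\<^sup>2 *s F v"
    using \<open>w = c *s v\<close> assms(3) by simp
  moreover have "c\<^sup>2 \<noteq> 0"
    using \<open>c \<noteq> 0\<close> by simp
  ultimately show ?thesis
    unfolding proj_rel_def using assms(2) by blast
qed

lift_definition f1 :: "3 proj \<Rightarrow> 3 proj" is
  "\<lambda>v. vector [(- v$1 + v$2 + v$3)\<^sup>2, (v$1 - v$2 + v$3)\<^sup>2, (v$1 + v$2 - v$3)\<^sup>2]"
  by (erule proj_relI)
     (use linear_forms_zero in \<open>auto simp only: vector3_eq_0_iff linear_forms_smult smult_vector3 power_eq_0_iff\<close>)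

lift_definition f2 :: "3 proj \<Rightarrow> 3 proj" is
  "\<lambda>v. vector [(v$1 - v$2 + v$3)\<^sup>2, (- v$1 + v$2 + v$3)\<^sup>2, (v$1 + v$2 - v$3)\<^sup>2]"
  by (erule proj_relI)
     (use linear_forms_zero in \<open>auto simp only: vector3_eq_0_iff linear_forms_smult smult_vector3 power_eq_0_iff\<close>)

lift_definition f3 :: "3 proj \<Rightarrow> 3 proj" is
  "\<lambda>v. vector [(v$1 + v$2 - v$3)\<^sup>2, (- v$1 + v$2 + v$3)\<^sup>2, (v$1 - v$2 + v$3)\<^sup>2]"
  by (erule proj_relI)
     (use linear_forms_zero in \<open>auto simp only: vector3_eq_0_iff linear_forms_smult smult_vector3 power_eq_0_iff\<close>)

end

theory Submission
  imports Defs "HOL-Complex_Analysis.Conformal_Mappings"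
begin

text \<open>
  Let \<open>\<omega> = (1 + \<i>) / 2\<close>. The Weierstrass function of the lattice of Gaussian integers, suitably scaled, is an
  even elliptic function \<open>u\<close> of order two with \<open>u (\<i> z) = - u z\<close> and \<open>u (z + \<omega>) = - 1 / u z\<close>. The
  changes of signs of the two coordinates of the torus are therefore divided out by \<open>(z, w) \<mapsto> (u z, u w)\<close>,
  with values in a product of two projective lines. What remains of the covering group is generated
  by the exchange of \<open>u\<close> and \<open>v\<close> and by the two maps \<open>(u, v) \<mapsto> (- u, - v)\<close> and
  \<open>(u, v) \<mapsto> (- 1 / u, - 1 / v)\<close>. Unordered pairs \<open>{u, v}\<close> are binary quadratic forms up to scalars, hence
  points of a projective plane with the coordinates \<open>1 + u v\<close>, \<open>1 - u v\<close>, \<open>u + v\<close>, on which the two other maps act by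
  changes of signs. So the quotient is a projective plane with the squares of these as coordinates.
  Since \<open>(1 + u v)\<^sup>2 - (u + v)\<^sup>2 = (1 - u\<^sup>2) (1 - v\<^sup>2)\<close>, the covering can be written as
  \<open>[(1 + u v)\<^sup>2 : (1 - u\<^sup>2) (1 - v\<^sup>2) : (1 - u v)\<^sup>2]\<close>
  (\<open>invariant_map\<close>, \<open>theta_map\<close>), and in these coordinates the dilations become the three given maps. This
  last point is the addition theorem for \<open>u\<close> (\<open>theta_map_sum_diff\<close>, \<open>theta_map_times_1_i\<close>).

  The function \<open>u\<close> is built as a quotient \<open>u1 / u0\<close> of entire functions from the sigma function \<open>s\<close> of the lattice,
  an odd entire function with simple zeros exactly at the lattice points, which comes from an infinite product
  (\<open>gaussian_sigma_exists\<close>). By Liouville's theorem,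
  \<open>s (z + w) * s (z - w) = u0 z * u1 w - u1 z * u0 w\<close> (\<open>sigma_addition\<close>). The zeros of the left-hand side
  show that \<open>u z = u w\<close> only if \<open>z\<close> is congruent to \<open>\<plusminus> w\<close>. The squares of this identity and of its translates by half
  periods are the addition theorem.

  For critical finiteness, each of the maps takes the squares of three independent linear forms, in some
  order. Its Jacobian vanishes exactly on the three lines where a form vanishes
  (\<open>critical_set_squared_forms\<close>). These are mapped onto the coordinate lines, the coordinate lines onto the lines where
  two coordinates agree, and the latter lines onto themselves (\<open>postcritical_set\<close>).
\<close>

section \<open>Infinite products and entire functions\<close>
lemma entire_compose:
  assumes "f holomorphic_on UNIV" "g holomorphic_on UNIV"
  shows "(\<lambda>z. f (g z)) holomorphic_on UNIV"
  using holomorphic_on_compose[OF assms(2) holomorphic_on_subset[OF assms(1)]] by (simp add: o_def)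

text \<open>
  The function is the product of the factors \<open>1 - q ^ n * x\<close> over all \<open>n\<close>. Splitting off its first
  factor gives the functional equation, from which the zeros and all quasi-periods are deduced below.
\<close>

lemma ex_infinite_q_product:
  fixes q :: complex
  assumes q: "norm q < 1"
  obtains f where "f holomorphic_on UNIV" "f 0 = 1" "\<And>x. f x = (1 - x) * f (q * x)"
proof -
  define P where "P = (\<lambda>N x. \<Prod>n<N. 1 - q ^ n * x)"
  have conv: "uniformly_convergent_on (cball 0 R) P" for R
  proof -
    have *: "uniformly_convergent_on (cball 0 R) (\<lambda>N x. \<Sum>n<N. norm (- (q ^ n * x)))"
    proof (rule Weierstrass_m_test'[where M = "\<lambda>n. norm q ^ n * R"])
      show "summable (\<lambda>n. norm q ^ n * R)"
        using q by (intro summable_mult2 summable_geometric) auto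
      show "norm (norm (- (q ^ n * x))) \<le> norm q ^ n * R" if "x \<in> cball 0 R" for n x
        using that by (auto simp: norm_mult norm_power intro!: mult_left_mono)
    qed
    have "uniformly_convergent_on (cball 0 R) (\<lambda>N x. \<Prod>n<N. 1 + (- (q ^ n * x)))"
      by (rule Infinite_Products.uniformly_convergent_on_prod) (use * in \<open>auto intro!: continuous_intros\<close>)
    then show ?thesis by (simp add: P_def)
  qed
  define f where "f = (\<lambda>x. lim (\<lambda>N. P N x))"
  have unif: "uniform_limit (cball 0 R) P f sequentially" for R
    using conv[of R] unfolding f_def by (simp add: uniformly_convergent_uniform_limit_iff)
  have lim: "(\<lambda>N. P N x) \<longlonglongrightarrow> f x" for x
    using tendsto_uniform_limitI[OF unif[of "norm x"]] by simp
  show ?thesis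
  proof
    show "f holomorphic_on UNIV"
    proof (rule holomorphic_uniform_sequence[where f = P])
      show "P N holomorphic_on UNIV" for N
        unfolding P_def by (intro holomorphic_intros)
      show "\<exists>d>0. cball x d \<subseteq> UNIV \<and> uniform_limit (cball x d) P f sequentially" for x
        using uniform_limit_on_subset[OF unif[of "norm x + 1"], of "cball x 1"]
        by (intro exI[of _ 1]) (auto simp: cball_subset_cball_iff dist_norm)
    qed auto
    have "P N 0 = 1" for N by (simp add: P_def)
    then show "f 0 = 1" using lim[of 0] by (simp add: LIMSEQ_const_iff)
    show "f x = (1 - x) * f (q * x)" for x
    proof (rule LIMSEQ_unique)
      show "(\<lambda>N. P (Suc N) x) \<longlonglongrightarrow> f x" using lim by (rule LIMSEQ_Suc)
      have "P (Suc N) x = (1 - x) * P N (q * x)" for N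
        unfolding P_def prod.lessThan_Suc_shift by (simp add: mult_ac)
      then show "(\<lambda>N. P (Suc N) x) \<longlonglongrightarrow> (1 - x) * f (q * x)"
        using tendsto_mult[OF tendsto_const lim] by simp
    qed
  qed
qed

text \<open>
  If no factor vanishes at \<open>x\<close>, then the functional equation carries a zero at \<open>x\<close> to zeros at all
  \<open>q ^ n * x\<close>. These points tend to \<open>0\<close>, where the value is \<open>1\<close>.
\<close>

lemma q_product_zero_iff:
  fixes q :: complex
  assumes q: "norm q < 1" and f: "f holomorphic_on UNIV" "f 0 = 1" "\<And>x. f x = (1 - x) * f (q * x)"
  shows "f x = 0 \<longleftrightarrow> (\<exists>n. q ^ n * x = 1)"
proof
  have zero: "f y = 0" if "q ^ n * y = 1" for n y
    using that
  proof (induction n arbitrary: y)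
    case (Suc n)
    then have "f (q * y) = 0" by (simp add: mult_ac)
    then show ?case using f(3)[of y] by simp
  qed (use f(3)[of 1] in simp)
  then show "f x = 0" if "\<exists>n. q ^ n * x = 1" using that by blast
  assume "f x = 0"
  show "\<exists>n. q ^ n * x = 1"
  proof (rule ccontr)
    assume ne: "\<not> ?thesis"
    have "f (q ^ n * x) = 0" for n
    proof (induction n)
      case (Suc n)
      then show ?case using f(3)[of "q ^ n * x"] ne by (auto simp: mult_ac)
    qed (use \<open>f x = 0\<close> in simp)
    moreover have "(\<lambda>n. f (q ^ n * x)) \<longlonglongrightarrow> f 0"
    proof (rule isCont_tendsto_compose[where g = f])
      show "isCont f 0"
        using f(1) by (metis UNIV_I continuous_on_eq_continuous_at holomorphic_on_imp_continuous_on open_UNIV)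
      show "(\<lambda>n. q ^ n * x) \<longlonglongrightarrow> 0"
        using tendsto_mult_right[OF LIMSEQ_power_zero[OF q], of x] by simp
    qed
    ultimately show False using f(2) by (simp add: LIMSEQ_const_iff)
  qed
qed

definition gaussian_ints :: "complex set" where
  "gaussian_ints = {of_int a + of_int b * \<i> | a b :: int. True}"

lemma gaussian_ints_iff: "z \<in> gaussian_ints \<longleftrightarrow> Re z \<in> \<int> \<and> Im z \<in> \<int>"
proof
  assume "Re z \<in> \<int> \<and> Im z \<in> \<int>"
  then obtain a b where "Re z = of_int a" "Im z = of_int b" by (auto elim!: Ints_cases)
  then have "z = of_int a + of_int b * \<i>" by (simp add: complex_eq_iff)
  then show "z \<in> gaussian_ints" by (auto simp: gaussian_ints_def)
qed (auto simp: gaussian_ints_def)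

lemma half_not_Ints: "(1 / 2 :: real) \<notin> \<int>"
proof
  assume "(1 / 2 :: real) \<in> \<int>"
  then obtain k :: int where "1 / 2 = (of_int k :: real)" by (auto elim: Ints_cases)
  then have "of_int (2 * k) = (1 :: real)" by simp
  then have "2 * k = 1" by linarith
  then show False by presburger
qed

lemma half_not_gaussian: "(1 + \<i>) / 2 \<notin> gaussian_ints"
  using half_not_Ints by (simp add: gaussian_ints_iff)

lemma gaussian_ints_induct [consumes 1, case_names zero one i minus add]:
  assumes "z \<in> gaussian_ints" "P 0" "P 1" "P \<i>" "\<And>z. P z \<Longrightarrow> P (- z)" "\<And>z w. P z \<Longrightarrow> P w \<Longrightarrow> P (z + w)"
  shows "P z"
proof -
  have nat: "P (of_nat n * c)" if "P c" for n c
    by (induction n) (use assms that in \<open>auto simp: distrib_right\<close>)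
  have int: "P (of_int n * c)" if "P c" for n c
  proof (cases "n \<ge> 0")
    case True then show ?thesis using nat[OF that, of "nat n"] by simp
  next
    case False then show ?thesis using assms(5)[OF nat[OF that, of "nat (-n)"]] by simp
  qed
  show ?thesis using assms(1,6) int[OF assms(3)] int[OF assms(4)] by (auto simp: gaussian_ints_def)
qed

text \<open>
  In the variable \<open>x = exp (2 \<pi> \<i> z)\<close> the translation by \<open>\<i>\<close> is the multiplication by \<open>exp (- 2 \<pi>)\<close>, so
  that the points where \<open>x\<close> is an integral power of \<open>exp (2 \<pi>)\<close> are the Gaussian integers.
\<close>

lemma exp_eq_1_gaussian:
  fixes z :: complex
  shows "(\<exists>k::int. exp (2 * of_real pi * \<i> * z + 2 * of_real pi * of_int k) = 1) \<longleftrightarrow> z \<in> gaussian_ints"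
proof -
  have "exp (2 * of_real pi * \<i> * z + 2 * of_real pi * of_int k) = 1 \<longleftrightarrow> Im z = of_int k \<and> Re z \<in> \<int>" for k
  proof -
    have "exp (2 * of_real pi * \<i> * z + 2 * of_real pi * of_int k) = 1 \<longleftrightarrow>
       2 * pi * (of_int k - Im z) = 0 \<and> (\<exists>n::int. 2 * pi * Re z = of_int (2 * n) * pi)"
      unfolding exp_eq_1 by (simp add: algebra_simps)
    also have "\<dots> \<longleftrightarrow> Im z = of_int k \<and> Re z \<in> \<int>"
      by (auto simp: Ints_def)
    finally show ?thesis .
  qed
  then show ?thesis unfolding gaussian_ints_iff by (auto simp: Ints_def)
qed

text \<open>
  All values are taken on the closed unit square, so Liouville's theorem applies.
\<close>

lemma doubly_periodic_const:
  assumes "H holomorphic_on UNIV" "\<And>z. H (z + 1) = H z" "\<And>z. H (z + \<i>) = H z"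
  obtains c where "\<And>z. H z = c"
proof -
  have per: "H (z + l) = H z" if "l \<in> gaussian_ints" for l z
    using that
  proof (induction l arbitrary: z rule: gaussian_ints_induct)
    case (minus l)
    from minus[of "z - l"] show ?case by simp
  next
    case (add l m)
    then show ?case by (metis add.assoc)
  qed (use assms in auto)
  have "range H \<subseteq> H ` cbox 0 (1 + \<i>)"
  proof clarify
    fix z
    define l where "l = of_int (floor (Re z)) + of_int (floor (Im z)) * \<i>"
    have "l \<in> gaussian_ints" by (auto simp: l_def gaussian_ints_def)
    moreover have "z - l \<in> cbox 0 (1 + \<i>)"
      by (simp add: l_def in_cbox_complex_iff) linarith
    ultimately show "H z \<in> H ` cbox 0 (1 + \<i>)"
      using per[of l "z - l"] by (metis diff_add_cancel imageI)
  qed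
  moreover have "bounded (H ` cbox 0 (1 + \<i>))"
    using assms(1) by (intro compact_imp_bounded compact_continuous_image)
      (auto intro: holomorphic_on_imp_continuous_on holomorphic_on_subset)
  ultimately have "bounded (range H)" by (metis bounded_subset)
  from Liouville_theorem[OF assms(1) this] obtain c where "\<forall>z. H z = c"
    unfolding constant_on_def by blast
  then show ?thesis using that by simp
qed

text \<open>
  At a simple zero of the denominator the quotient has a finite limit, the quotient of the
  derivatives, and the singularity is removable.
\<close>

lemma entire_quotient_simple_zeros:
  assumes F: "F holomorphic_on UNIV" and G: "G holomorphic_on UNIV"
    and simple: "\<And>z. G z = 0 \<Longrightarrow> deriv G z \<noteq> 0" and zero: "\<And>z. G z = 0 \<Longrightarrow> F z = 0"
  obtains H where "H holomorphic_on UNIV" "\<And>z. F z = H z * G z"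
proof -
  define H where "H = (\<lambda>z. if G z = 0 then deriv F z / deriv G z else F z / G z)"
  have ne: "\<exists>r>0. \<forall>w\<in>ball z r - {z}. G w \<noteq> 0" for z
  proof (cases "G z = 0")
    case True
    have "\<exists>w. G w \<noteq> 0"
    proof (rule ccontr)
      assume "\<not> ?thesis" then have "G = (\<lambda>_. 0)" by auto
      then show False using simple[OF True] by simp
    qed
    then obtain w where "G w \<noteq> 0" by blast
    from isolated_zeros[OF G open_UNIV connected_UNIV _ True _ this] show ?thesis
      by (metis UNIV_I)
  next
    case False
    have "isCont G z"
      using G by (metis UNIV_I continuous_on_eq_continuous_at holomorphic_on_imp_continuous_on open_UNIV)
    from continuous_at_avoid[OF this False] show ?thesis
      by (auto simp: dist_commute)
  qed
  have "\<exists>r>0. H holomorphic_on ball z r" for z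
  proof -
    obtain r where r: "r > 0" "\<And>w. w \<in> ball z r - {z} \<Longrightarrow> G w \<noteq> 0" using ne by blast
    have *: "H holomorphic_on ball z r - {z}"
    proof (rule holomorphic_transform)
      show "(\<lambda>w. F w / G w) holomorphic_on ball z r - {z}"
        using r by (intro holomorphic_on_divide holomorphic_on_subset[OF F] holomorphic_on_subset[OF G]) auto
    qed (use r in \<open>auto simp: H_def\<close>)
    have lim: "(\<lambda>w. F w / G w) \<midarrow>z\<rightarrow> H z"
    proof (cases "G z = 0")
      case True
      show ?thesis
        by (rule lhopital_complex_simple[of F "deriv F z" z G "deriv G z"])
           (use True F G simple zero in \<open>auto simp: H_def intro: holomorphic_derivI\<close>)
    next
      case False
      have "isCont F z" "isCont G z"
        using F G by (metis UNIV_I continuous_on_eq_continuous_at holomorphic_on_imp_continuous_on open_UNIV)+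
      then have "isCont (\<lambda>w. F w / G w) z" using False by (intro continuous_intros) auto
      then show ?thesis using False by (simp add: isCont_def H_def)
    qed
    have "H \<midarrow>z\<rightarrow> H z"
      by (rule Lim_transform_within_open[OF lim, of "ball z r"]) (use r in \<open>auto simp: H_def\<close>)
    then have "(H \<longlongrightarrow> H z) (at z within ball z r)"
      by (rule tendsto_within_subset) simp
    then have "H holomorphic_on ball z r"
      using no_isolated_singularity'[where K = "{z}" and f = H and S = "ball z r"] * by simp
    then show ?thesis using r by blast
  qed
  then have "H field_differentiable at z" for z
    by (meson centre_in_ball holomorphic_on_imp_differentiable_at open_ball)
  then have "H holomorphic_on UNIV"
    by (simp add: holomorphic_on_def)
  moreover have "F z = H z * G z" for z by (auto simp: H_def zero)
  ultimately show ?thesis using that by blast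
qed

text \<open>
  The uniqueness principle behind all identities between theta functions below: two quasi-periodic
  functions with the same multipliers have a doubly periodic quotient, which is constant as soon as
  it is entire.
\<close>

lemma same_multipliers_const:
  assumes H: "H holomorphic_on UNIV" and G: "G holomorphic_on UNIV" "G z0 \<noteq> 0"
    and F: "\<And>z. F z = H z * G z"
    and "\<And>z. F (z + 1) = e1 z * F z" "\<And>z. G (z + 1) = e1 z * G z" "\<And>z. e1 z \<noteq> 0"
    and "\<And>z. F (z + \<i>) = e2 z * F z" "\<And>z. G (z + \<i>) = e2 z * G z" "\<And>z. e2 z \<noteq> 0"
  obtains c where "\<And>z. F z = c * G z"
proof -
  have H1: "H (z + l) = H z" if F1: "\<And>z. F (z + l) = e z * F z" and G1: "\<And>z. G (z + l) = e z * G z"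
    and e: "\<And>z. e z \<noteq> 0" for l e z
  proof (rule analytic_continuation_open[where f = "\<lambda>z. H (z + l)" and g = H])
    show "open {z. G z \<noteq> 0}"
      using G(1) by (intro open_Collect_neq holomorphic_on_imp_continuous_on) auto
    show "(\<lambda>z. H (z + l)) holomorphic_on UNIV"
      by (intro entire_compose[OF H] holomorphic_intros)
    show "H (z + l) = H z" if "z \<in> {z. G z \<noteq> 0}" for z
      using F1[of z] G1[of z] e[of z] F[of z] F[of "z + l"] that by simp
  qed (use G H in auto)
  have "\<And>z. H (z + 1) = H z" "\<And>z. H (z + \<i>) = H z"
    using H1[of 1 e1] H1[of \<i> e2] assms(5-) by auto
  then obtain c where "\<And>z. H z = c"
    using doubly_periodic_const[OF H] by blast
  then show ?thesis using that[of c] F by simp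
qed

section \<open>The sigma function of the Gaussian integers\<close>
text \<open>
  The Weierstrass sigma function of the lattice of Gaussian integers, up to a constant factor. The
  last condition fixes this factor in such a way that the elliptic function \<open>u1 / u0\<close> below satisfies
  \<open>u (z + \<omega>) = - 1 / u z\<close> exactly.
\<close>

locale gaussian_sigma =
  fixes s :: "complex \<Rightarrow> complex"
  assumes holo: "s holomorphic_on UNIV"
    and zero_iff: "s z = 0 \<longleftrightarrow> z \<in> gaussian_ints"
    and simple: "s z = 0 \<Longrightarrow> deriv s z \<noteq> 0"
    and minus: "s (- z) = - s z"
    and shift_1: "s (z + 1) = - exp (of_real pi * (z + 1 / 2)) * s z"
    and shift_i: "s (z + \<i>) = - exp (of_real pi * (1 / 2 - \<i> * z)) * s z"
    and norm_half: "(s ((1 + \<i>) / 2))\<^sup>2 = \<i> * exp (of_real pi / 2)"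

text \<open>
  Two generators of the lattice suffice to relate \<open>s (z + l)\<close> to \<open>s z\<close>; this moves the simple zero
  at the origin to every lattice point.
\<close>

lemma multiplier_exists:
  fixes s :: "complex \<Rightarrow> complex"
  assumes "s holomorphic_on UNIV"
    and "\<And>z. s (z + 1) = - exp (of_real pi * (z + 1 / 2)) * s z"
    and "\<And>z. s (z + \<i>) = - exp (of_real pi * (1 / 2 - \<i> * z)) * s z"
    and l: "l \<in> gaussian_ints"
  shows "\<exists>e. e holomorphic_on UNIV \<and> (\<forall>z. e z \<noteq> 0 \<and> s (z + l) = e z * s z)"
  using l
proof (induction rule: gaussian_ints_induct)
  case zero
  show ?case by (rule exI[of _ "\<lambda>_. 1"]) auto
next
  case one
  show ?case by (rule exI[of _ "\<lambda>z::complex. - exp (of_real pi * (z + 1 / 2))"]) (use assms in \<open>auto intro!: holomorphic_intros\<close>)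
next
  case i
  show ?case by (rule exI[of _ "\<lambda>z::complex. - exp (of_real pi * (1 / 2 - \<i> * z))"]) (use assms in \<open>auto intro!: holomorphic_intros\<close>)
next
  case (minus l)
  then obtain e where e: "e holomorphic_on UNIV" "\<And>z. e z \<noteq> 0" "\<And>z. s (z + l) = e z * s z" by blast
  have "(\<lambda>z. e (z - l)) holomorphic_on UNIV"
    by (intro entire_compose[OF e(1)] holomorphic_intros)
  moreover have "s (z + - l) = inverse (e (z - l)) * s z" for z
    using e(2,3)[of "z - l"] by (simp add: field_simps)
  ultimately show ?case using e(2)
    by (intro exI[of _ "\<lambda>z. inverse (e (z - l))"]) (auto intro!: holomorphic_intros)
next
  case (add l m)
  then obtain e d where e: "e holomorphic_on UNIV" "\<And>z. e z \<noteq> 0" "\<And>z. s (z + l) = e z * s z"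
    and d: "d holomorphic_on UNIV" "\<And>z. d z \<noteq> 0" "\<And>z. s (z + m) = d z * s z" by blast
  have "(\<lambda>z. d (z + l)) holomorphic_on UNIV"
    by (intro entire_compose[OF d(1)] holomorphic_intros)
  moreover have "s (z + (l + m)) = d (z + l) * e z * s z" for z
    using e(3)[of z] d(3)[of "z + l"] by (simp add: add.assoc mult.assoc)
  ultimately show ?case using e d
    by (intro exI[of _ "\<lambda>z. d (z + l) * e z"]) (auto intro!: holomorphic_intros)
qed

text \<open>
  Up to the Gaussian factor \<open>E\<close> this is a Jacobi theta function, in its product form in the variable
  \<open>X z = exp (2 \<pi> \<i> z)\<close>. The quadratic exponent \<open>\<pi> z\<^sup>2 / 2\<close> makes the multipliers for the periods
  \<open>1\<close> and \<open>\<i>\<close> correspond to each other under \<open>z \<mapsto> \<i> z\<close>, an automorphism of the lattice.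
\<close>

lemma gaussian_sigma_exists: "\<exists>s. gaussian_sigma s"
proof -
  define q :: complex where "q = exp (- 2 * of_real pi)"
  have q: "norm q < 1" "q \<noteq> 0" by (auto simp: q_def norm_exp)
  obtain f where f: "f holomorphic_on UNIV" "f 0 = 1" "\<And>x. f x = (1 - x) * f (q * x)"
    using ex_infinite_q_product[OF q(1)] by blast
  note f_zero = q_product_zero_iff[OF q(1) f]
  define X where "X = (\<lambda>z::complex. exp (2 * of_real pi * \<i> * z))"
  define E where "E = (\<lambda>z::complex. exp (of_real pi * z\<^sup>2 / 2 - of_real pi * \<i> * z))"
  define s where "s = (\<lambda>z. E z * f (X z) * f (q / X z))"
  have X0: "X z \<noteq> 0" for z by (simp add: X_def)
  have hX: "X holomorphic_on UNIV" unfolding X_def by (intro holomorphic_intros)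
  note hf = entire_compose[OF f(1)]
  have hE: "E holomorphic_on UNIV" unfolding E_def by (intro holomorphic_intros) auto
  have holo: "s holomorphic_on UNIV"
    unfolding s_def using X0 by (intro holomorphic_intros hf hX hE) auto
  have X1: "X (z + 1) = X z" for z
    by (simp add: X_def distrib_left exp_add)
  have E1: "E (z + 1) = - exp (of_real pi * (z + 1 / 2)) * E z" for z
  proof -
    have *: "of_real pi * (z + 1)\<^sup>2 / 2 - of_real pi * \<i> * (z + 1) = of_real pi * (z + 1 / 2) + (of_real pi * z\<^sup>2 / 2 - of_real pi * \<i> * z) - of_real pi * \<i>"
      by (simp add: power2_eq_square field_simps)
    show ?thesis unfolding E_def unfolding * unfolding exp_add exp_diff by simp
  qed
  have s1: "s (z + 1) = - exp (of_real pi * (z + 1 / 2)) * s z" for z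
    by (simp add: s_def X1 E1)
  \<comment> \<open>Translation by the period \<open>\<i>\<close>, and also \<open>z \<mapsto> - z\<close>, shift one factor from one product to the other.\<close>
  have fX: "X z * (f (q * X z) * f (1 / X z)) = - (f (X z) * f (q / X z))" for z
  proof -
    have a: "f (1 / X z) = (1 - 1 / X z) * f (q / X z)"
      using f(3)[of "1 / X z"] by simp
    have b: "f (X z) = (1 - X z) * f (q * X z)" by (rule f(3))
    show ?thesis unfolding a b using X0[of z] by (simp add: field_simps)
  qed
  have X_i: "X (z + \<i>) = q * X z" for z
    by (simp add: X_def q_def distrib_left exp_add[symmetric] algebra_simps)
  have E_i: "E (z + \<i>) * f (q * X z) * f (1 / X z) = - exp (of_real pi * (1 / 2 - \<i> * z)) * E z * f (X z) * f (q / X z)" for z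
  proof -
    have *: "of_real pi * (z + \<i>)\<^sup>2 / 2 - of_real pi * \<i> * (z + \<i>) = of_real pi * (1 / 2 - \<i> * z) + (of_real pi * z\<^sup>2 / 2 - of_real pi * \<i> * z) + 2 * of_real pi * \<i> * z"
      by (simp add: power2_eq_square field_simps)
    have "E (z + \<i>) = exp (of_real pi * (1 / 2 - \<i> * z)) * E z * X z"
      unfolding E_def X_def unfolding * unfolding exp_add by simp
    then show ?thesis by (simp add: mult.assoc fX)
  qed
  have s_i: "s (z + \<i>) = - exp (of_real pi * (1 / 2 - \<i> * z)) * s z" for z
    using E_i[of z] q(2) by (simp add: s_def X_i)
  have odd: "s (- z) = - s z" for z
  proof -
    have *: "of_real pi * (- z)\<^sup>2 / 2 - of_real pi * \<i> * (- z) = (of_real pi * z\<^sup>2 / 2 - of_real pi * \<i> * z) + 2 * of_real pi * \<i> * z"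
      by (simp add: power2_eq_square field_simps)
    have "E (- z) = E z * X z" unfolding E_def X_def unfolding * unfolding exp_add ..
    moreover have "X (- z) = 1 / X z" "q / (1 / X z) = q * X z" by (simp_all add: X_def exp_minus inverse_eq_divide)
    ultimately show ?thesis by (simp add: s_def mult.assoc fX mult.commute[of "f (1 / X z)"])
  qed
  have qpow: "q ^ n * X z = exp (2 * of_real pi * \<i> * z + 2 * of_real pi * of_int (- int n))" for n z
    unfolding q_def X_def exp_of_nat_mult[symmetric] exp_add[symmetric]
    by (rule arg_cong[where f = exp]) (simp add: algebra_simps)
  have qpow': "q ^ n * (q / X z) = 1 \<longleftrightarrow> exp (2 * of_real pi * \<i> * z + 2 * of_real pi * of_int (int n + 1)) = 1" for n z
  proof -
    have "q ^ n * (q / X z) = inverse (exp (2 * of_real pi * \<i> * z + 2 * of_real pi * of_int (int n + 1)))"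
      unfolding q_def X_def exp_of_nat_mult[symmetric] exp_diff[symmetric] exp_add[symmetric] exp_minus[symmetric]
      by (rule arg_cong[where f = exp]) (simp add: algebra_simps)
    then show ?thesis by simp
  qed
  have zero: "s z = 0 \<longleftrightarrow> z \<in> gaussian_ints" for z
  proof -
    have "s z = 0 \<longleftrightarrow> (\<exists>n. q ^ n * X z = 1) \<or> (\<exists>n. q ^ n * (q / X z) = 1)"
      by (simp add: s_def E_def f_zero)
    also have "\<dots> \<longleftrightarrow> (\<exists>k::int. exp (2 * of_real pi * \<i> * z + 2 * of_real pi * of_int k) = 1)" (is "?l \<longleftrightarrow> ?r")
    proof
      assume ?r
      then obtain k :: int where k: "exp (2 * of_real pi * \<i> * z + 2 * of_real pi * of_int k) = 1" by blast
      show ?l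
      proof (cases "k \<le> 0")
        case True
        with k have "q ^ nat (- k) * X z = 1" unfolding qpow by simp
        then show ?l by blast
      next
        case False
        with k have "q ^ nat (k - 1) * (q / X z) = 1" unfolding qpow' by simp
        then show ?l by blast
      qed
    qed (unfold qpow qpow', blast)
    also have "\<dots> \<longleftrightarrow> z \<in> gaussian_ints" by (rule exp_eq_1_gaussian)
    finally show ?thesis .
  qed
  \<comment> \<open>Split off from \<open>s\<close> its only factor that vanishes at the origin.\<close>
  have deriv0: "deriv s 0 \<noteq> 0"
  proof -
    define g where "g = (\<lambda>z. E z * f (q * X z) * f (q / X z))"
    have "s z = (1 - X z) * g z" for z
      unfolding s_def g_def f(3)[of "X z"] by (simp add: mult_ac)
    then have sg: "s = (\<lambda>z. (1 - X z) * g z)" by (rule ext)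
    have "g holomorphic_on UNIV" unfolding g_def using X0 by (intro holomorphic_intros hf hX hE) auto
    then have g': "(g has_field_derivative deriv g 0) (at 0)" by (auto intro: holomorphic_derivI)
    have X': "(X has_field_derivative 2 * of_real pi * \<i>) (at 0)"
      unfolding X_def by (auto intro!: derivative_eq_intros)
    have "deriv s 0 = - (2 * of_real pi * \<i>) * g 0" unfolding sg
      by (rule DERIV_imp_deriv) (auto intro!: derivative_eq_intros g' X' simp: X_def)
    moreover have "f q \<noteq> 0"
    proof
      assume "f q = 0"
      then obtain n where "q ^ Suc n = 1" unfolding f_zero by (auto simp: mult.commute)
      then have "norm q ^ Suc n = 1" by (metis norm_power norm_one)
      moreover have "norm q ^ Suc n < 1"
        using q by (intro power_Suc_less_one) auto
      ultimately show False by simp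
    qed
    ultimately show ?thesis by (simp add: g_def E_def X_def)
  qed
  have simple: "deriv s l \<noteq> 0" if l: "s l = 0" for l
  proof -
    obtain e where e: "e holomorphic_on UNIV" "\<And>z. e z \<noteq> 0" "\<And>z. s (z + l) = e z * s z"
      using multiplier_exists[OF holo s1 s_i] l zero by blast
    have e': "(e has_field_derivative deriv e 0) (at 0)" and s': "(s has_field_derivative deriv s 0) (at 0)"
      using e(1) holo by (auto intro: holomorphic_derivI)
    have "s 0 = 0" by (simp add: zero gaussian_ints_iff)
    then have "((\<lambda>z. e z * s z) has_field_derivative e 0 * deriv s 0) (at 0)"
      by (auto intro!: derivative_eq_intros e' s')
    moreover have "((\<lambda>z. s (z + l)) has_field_derivative deriv s l) (at 0)"
      using holo DERIV_shift[of s "deriv s l" 0 l] by (auto intro: holomorphic_derivI)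
    ultimately have "deriv s l = e 0 * deriv s 0" unfolding e(3) by (rule DERIV_unique[rotated])
    then show ?thesis using e(2) deriv0 by simp
  qed
  define k where "k = csqrt (\<i> * exp (of_real pi / 2)) / s ((1 + \<i>) / 2)"
  have "(1 + \<i>) / 2 \<notin> gaussian_ints"
    by (rule half_not_gaussian)
  then have half: "s ((1 + \<i>) / 2) \<noteq> 0" using zero by blast
  then have k0: "k \<noteq> 0" by (simp add: k_def)
  have "gaussian_sigma (\<lambda>z. k * s z)"
  proof
    show "(\<lambda>z. k * s z) holomorphic_on UNIV" by (intro holomorphic_intros holo)
    show "deriv (\<lambda>z. k * s z) z \<noteq> 0" if "k * s z = 0" for z
      using that k0 simple[of z] holo by (subst deriv_cmult) (auto simp: holomorphic_on_imp_differentiable_at)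
    show "(k * s ((1 + \<i>) / 2))\<^sup>2 = \<i> * exp (of_real pi / 2)" using half by (simp add: k_def)
  qed (use k0 zero odd s1 s_i in auto)
  then show ?thesis by blast
qed

section \<open>Addition theorem for the Gaussian elliptic function\<close>
abbreviation half_period :: complex ("\<omega>") where "\<omega> \<equiv> (1 + \<i>) / 2"

lemma gaussian_ints_closed:
  "0 \<in> gaussian_ints" "1 \<in> gaussian_ints" "\<i> \<in> gaussian_ints"
  "z \<in> gaussian_ints \<Longrightarrow> - z \<in> gaussian_ints" "z \<in> gaussian_ints \<Longrightarrow> \<i> * z \<in> gaussian_ints"
  "z \<in> gaussian_ints \<Longrightarrow> w \<in> gaussian_ints \<Longrightarrow> z + w \<in> gaussian_ints"
  "z \<in> gaussian_ints \<Longrightarrow> w \<in> gaussian_ints \<Longrightarrow> z - w \<in> gaussian_ints"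
  "z \<in> gaussian_ints \<Longrightarrow> w \<in> gaussian_ints \<Longrightarrow> z * w \<in> gaussian_ints"
  by (auto simp: gaussian_ints_iff)

lemma zero_set_periodic:
  fixes F :: "complex \<Rightarrow> complex"
  assumes "\<And>z. F (z + 1) = e1 z * F z" "\<And>z. e1 z \<noteq> 0" "\<And>z. F (z + \<i>) = e2 z * F z" "\<And>z. e2 z \<noteq> 0"
    and l: "l \<in> gaussian_ints"
  shows "F (z + l) = 0 \<longleftrightarrow> F z = 0"
  using l
proof (induction l arbitrary: z rule: gaussian_ints_induct)
  case (minus l)
  from minus[of "z - l"] show ?case by simp
next
  case (add l m)
  from add(1)[of z] add(2)[of "z + l"] show ?case by (simp add: add.assoc)
qed (use assms in auto)

lemma i_times_i_times: "\<i> * a * (\<i> * b) = - (a * b)"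
proof -
  have "\<i> * a * (\<i> * b) = \<i> * \<i> * (a * b)" by (simp only: mult_ac)
  then show ?thesis by simp
qed

lemma exp_half_pi_i: "exp (of_real pi * \<i> / 2) = \<i>"
  using cis_conv_exp[of "pi / 2"] by (simp add: mult.commute)

context gaussian_sigma
begin

lemma entire_sigma: "g holomorphic_on UNIV \<Longrightarrow> (\<lambda>z. s (g z)) holomorphic_on UNIV"
  by (rule entire_compose[OF holo])

lemma sigma_zero [simp]: "s 0 = 0"
  by (simp add: zero_iff gaussian_ints_closed)

lemma sigma_half_ne: "s \<omega> \<noteq> 0"
  using zero_iff half_not_gaussian by blast

lemma shift_minus_1: "s (z - 1) = - exp (of_real pi * (1 / 2 - z)) * s z"
proof -
  have "s z = - exp (of_real pi * (z - 1 / 2)) * s (z - 1)"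
    using shift_1[of "z - 1"] by simp
  moreover have "exp (of_real pi * (1 / 2 - z)) = inverse (exp (of_real pi * (z - 1 / 2)))"
    unfolding exp_minus[symmetric] by (simp add: algebra_simps)
  ultimately show ?thesis by simp
qed

text \<open>
  Both sides have the same zeros and the same multipliers, hence are proportional. The derivatives
  at the origin give the factor.
\<close>

lemma sigma_times_i: "s (\<i> * z) = \<i> * s z"
proof -
  obtain H where H: "H holomorphic_on UNIV" "\<And>z. s (\<i> * z) = H z * s z"
  proof (rule entire_quotient_simple_zeros[where F = "\<lambda>z. s (\<i> * z)" and G = s])
    show "s (\<i> * z) = 0" if "s z = 0" for z
      using that gaussian_ints_closed by (simp add: zero_iff)
  qed (auto intro!: entire_sigma holomorphic_intros holo simple)
  obtain c where c: "\<And>z. s (\<i> * z) = c * s z"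
  proof (rule same_multipliers_const[OF H(1) holo sigma_half_ne H(2)])
    show "s (z + 1) = - exp (of_real pi * (z + 1 / 2)) * s z" for z by (rule shift_1)
    show "s (z + \<i>) = - exp (of_real pi * (1 / 2 - \<i> * z)) * s z" for z by (rule shift_i)
    show "s (\<i> * (z + 1)) = - exp (of_real pi * (z + 1 / 2)) * s (\<i> * z)" for z
      using shift_i[of "\<i> * z"] by (simp add: algebra_simps)
    show "s (\<i> * (z + \<i>)) = - exp (of_real pi * (1 / 2 - \<i> * z)) * s (\<i> * z)" for z
      using shift_minus_1[of "\<i> * z"] by (simp add: algebra_simps)
  qed auto
  have s': "(s has_field_derivative deriv s z) (at z)" for z
    using holo by (auto intro: holomorphic_derivI)
  have "((\<lambda>z. s (\<i> * z)) has_field_derivative deriv s 0 * \<i>) (at 0)"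
  proof (rule DERIV_chain2[where g = "\<lambda>z. \<i> * z"])
    show "(s has_field_derivative deriv s 0) (at (\<i> * 0))" using s'[of "\<i> * 0"] by (simp only: mult_zero_right)
    show "((*) \<i> has_field_derivative \<i>) (at 0)" by (auto intro!: derivative_eq_intros)
  qed
  moreover have "((\<lambda>z. s (\<i> * z)) has_field_derivative c * deriv s 0) (at 0)"
    unfolding c by (rule DERIV_cmult[OF s'])
  ultimately have "deriv s 0 * \<i> = c * deriv s 0" by (rule DERIV_unique)
  then have "c = \<i>" using simple[of 0] by simp
  then show ?thesis using c by simp
qed

text \<open>
  The two homogeneous coordinates of an elliptic function \<open>u = u1 / u0\<close> with a double pole at the
  lattice points and a double zero at \<open>\<omega>\<close>, that is, of a multiple of the Weierstrass function.
\<close>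

definition u0 where "u0 z = (s z)\<^sup>2"
definition u1 where "u1 z = - (s (z + \<omega>) * s (z - \<omega>)) / (s \<omega>)\<^sup>2"

lemma entire_u: "u0 holomorphic_on UNIV" "u1 holomorphic_on UNIV"
  unfolding u0_def[abs_def] u1_def[abs_def]
  by (intro holomorphic_intros entire_sigma; simp add: sigma_half_ne)+

lemma u_at_0 [simp]: "u0 0 = 0" "u1 0 = 1"
  using sigma_half_ne minus[of \<omega>] by (simp_all add: u0_def u1_def power2_eq_square)

lemma u_minus: "u0 (- z) = u0 z" "u1 (- z) = u1 z"
proof -
  have "s (- z + \<omega>) = - s (z - \<omega>)" "s (- z - \<omega>) = - s (z + \<omega>)"
    using minus[of "z - \<omega>"] minus[of "z + \<omega>"] by simp_all
  then show "u0 (- z) = u0 z" "u1 (- z) = u1 z"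
    by (simp_all only: u0_def u1_def minus power2_minus minus_mult_minus mult.commute)
qed

text \<open>
  The multipliers of \<open>z \<mapsto> s (z + w) * s (z - w)\<close> do not depend on \<open>w\<close>. For this reason the products
  for different \<open>w\<close>, in particular \<open>u0\<close> (with \<open>w = 0\<close>) and \<open>u1\<close> (with \<open>w = \<omega>\<close>), are comparable.
\<close>

lemma sigma_pair_shift:
  "s (z + 1 + w) * s (z + 1 - w) = exp (2 * of_real pi * (z + 1 / 2)) * (s (z + w) * s (z - w))"
  "s (z + \<i> + w) * s (z + \<i> - w) = exp (2 * of_real pi * (1 / 2 - \<i> * z)) * (s (z + w) * s (z - w))"
proof -
  have "s (z + 1 + w) * s (z + 1 - w) =
      exp (of_real pi * (z + w + 1 / 2)) * exp (of_real pi * (z - w + 1 / 2)) * (s (z + w) * s (z - w))"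
    using shift_1[of "z + w"] shift_1[of "z - w"] by (simp add: algebra_simps)
  then show "s (z + 1 + w) * s (z + 1 - w) = exp (2 * of_real pi * (z + 1 / 2)) * (s (z + w) * s (z - w))"
    by (simp add: exp_add[symmetric] algebra_simps)
  have "s (z + \<i> + w) * s (z + \<i> - w) =
      exp (of_real pi * (1 / 2 - \<i> * (z + w))) * exp (of_real pi * (1 / 2 - \<i> * (z - w))) * (s (z + w) * s (z - w))"
    using shift_i[of "z + w"] shift_i[of "z - w"] by (simp add: algebra_simps)
  then show "s (z + \<i> + w) * s (z + \<i> - w) = exp (2 * of_real pi * (1 / 2 - \<i> * z)) * (s (z + w) * s (z - w))"
    by (simp add: exp_add[symmetric] algebra_simps)
qed

lemma u_shift:
  "u0 (z + 1) = exp (2 * of_real pi * (z + 1 / 2)) * u0 z"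
  "u1 (z + 1) = exp (2 * of_real pi * (z + 1 / 2)) * u1 z"
  "u0 (z + \<i>) = exp (2 * of_real pi * (1 / 2 - \<i> * z)) * u0 z"
  "u1 (z + \<i>) = exp (2 * of_real pi * (1 / 2 - \<i> * z)) * u1 z"
  using sigma_pair_shift[of z 0] sigma_pair_shift[of z \<omega>]
  by (simp_all add: u0_def u1_def power2_eq_square)

text \<open>
  The classical formula for the difference \<open>\<wp> z - \<wp> w\<close>. As functions of \<open>z\<close> both sides have the same
  multipliers, and the right-hand side vanishes at \<open>\<plusminus> w\<close>. If \<open>2 * w\<close> is not a period, then these are
  all the zeros of the left-hand side and they are simple, so the quotient is constant; its value is
  found at \<open>z = 0\<close>. The other \<open>w\<close> follow by analytic continuation.
  
  This identity is the source of everything that is needed about \<open>u0\<close> and \<open>u1\<close>: the zeros of its left-hand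
  side describe the fibres of \<open>u1 / u0\<close>, and its translates are the addition theorem.
\<close>

lemma sigma_addition: "s (z + w) * s (z - w) = u0 z * u1 w - u1 z * u0 w"
proof -
  have *: "s (z + w) * s (z - w) = u0 z * u1 w - u1 z * u0 w" if w: "2 * w \<notin> gaussian_ints" for z w
  proof -
    define F where "F = (\<lambda>z. u0 z * u1 w - u1 z * u0 w)"
    have F_shift: "F (z + 1) = exp (2 * of_real pi * (z + 1 / 2)) * F z"
      "F (z + \<i>) = exp (2 * of_real pi * (1 / 2 - \<i> * z)) * F z" for z
      unfolding F_def u_shift right_diff_distrib by (simp_all only: mult_ac)
    have F_per: "F (z + l) = 0 \<longleftrightarrow> F z = 0" if "l \<in> gaussian_ints" for z l
      by (rule zero_set_periodic[OF F_shift(1) _ F_shift(2) _ that]) auto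
    have F_zero: "F z = 0" if "z - w \<in> gaussian_ints \<or> z + w \<in> gaussian_ints" for z
      using that F_per[of "z - w" w] F_per[of "z + w" "- w"] by (auto simp: F_def u_minus)
    have s_shift': "deriv (\<lambda>z. s (z + a)) z = deriv s (z + a)" for a z
      using holo DERIV_shift[of s "deriv s (z + a)" z a] by (intro DERIV_imp_deriv) (auto intro: holomorphic_derivI)
    have F: "F holomorphic_on UNIV"
      unfolding F_def by (intro holomorphic_intros entire_u)
    obtain H1 where H1: "H1 holomorphic_on UNIV" "\<And>z. F z = H1 z * s (z + - w)"
    proof (rule entire_quotient_simple_zeros[OF F, where G = "\<lambda>z. s (z + - w)"])
      show "(\<lambda>z. s (z + - w)) holomorphic_on UNIV" by (intro entire_sigma holomorphic_intros)
      show "deriv (\<lambda>z. s (z + - w)) z \<noteq> 0" if "s (z + - w) = 0" for z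
        unfolding s_shift' using that by (rule simple)
      show "F z = 0" if "s (z + - w) = 0" for z using that F_zero by (simp add: zero_iff)
    qed blast
    obtain H2 where H2: "H2 holomorphic_on UNIV" "\<And>z. H1 z = H2 z * s (z + w)"
    proof (rule entire_quotient_simple_zeros[OF H1(1), where G = "\<lambda>z. s (z + w)"])
      show "(\<lambda>z. s (z + w)) holomorphic_on UNIV" by (intro entire_sigma holomorphic_intros)
      show "deriv (\<lambda>z. s (z + w)) z \<noteq> 0" if "s (z + w) = 0" for z
        unfolding s_shift' using that by (rule simple)
      show "H1 z = 0" if z: "s (z + w) = 0" for z
      proof -
        have "s (z + - w) \<noteq> 0"
          using z w gaussian_ints_closed(7)[of "z + w" "z - w"] by (auto simp: zero_iff)
        moreover have "F z = 0" using z F_zero by (simp add: zero_iff)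
        ultimately show ?thesis using H1(2)[of z] by simp
      qed
    qed blast
    have w': "w \<notin> gaussian_ints" using w gaussian_ints_closed(6)[of w w] by auto
    obtain c where c: "\<And>z. F z = c * (s (z + w) * s (z - w))"
    proof (rule same_multipliers_const[OF H2(1), where G = "\<lambda>z. s (z + w) * s (z - w)"])
      show "(\<lambda>z. s (z + w) * s (z - w)) holomorphic_on UNIV" by (intro holomorphic_intros entire_sigma)
      show "s (0 + w) * s (0 - w) \<noteq> 0" using w' by (simp add: minus zero_iff)
      show "F z = H2 z * (s (z + w) * s (z - w))" for z using H1(2)[of z] H2(2)[of z] by simp
    qed (rule F_shift sigma_pair_shift exp_not_eq_zero | blast)+
    have "- u0 w = c * - u0 w" using c[of 0] by (simp add: F_def minus u0_def power2_eq_square)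
    moreover have "u0 w \<noteq> 0" using w' by (simp add: u0_def zero_iff)
    ultimately have "c = 1" by simp
    then show ?thesis using c[of z] by (simp add: F_def)
  qed
  show ?thesis
  proof (rule analytic_continuation_open[where f = "\<lambda>w. s (z + w) * s (z - w)"
        and g = "\<lambda>w. u0 z * u1 w - u1 z * u0 w" and s = "{w. s (2 * w) \<noteq> 0}" and s' = UNIV])
    show "open {w. s (2 * w) \<noteq> 0}"
      by (intro open_Collect_neq holomorphic_on_imp_continuous_on entire_sigma holomorphic_intros)
    have "s (2 * (1 / 4)) \<noteq> 0" using half_not_Ints by (simp add: zero_iff gaussian_ints_iff)
    then show "{w. s (2 * w) \<noteq> 0} \<noteq> {}" by blast
  qed (auto simp: * zero_iff intro!: holomorphic_intros entire_sigma entire_u)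
qed

lemma u0_zero_iff: "u0 z = 0 \<longleftrightarrow> z \<in> gaussian_ints"
  by (simp add: u0_def zero_iff)

lemma u_wedge_zero_iff: "u0 z * u1 w = u1 z * u0 w \<longleftrightarrow> z + w \<in> gaussian_ints \<or> z - w \<in> gaussian_ints"
  using sigma_addition[of z w] by (auto simp: zero_iff[symmetric])

text \<open>
  At a common zero \<open>z\<close>, the preceding equivalence would make every point congruent to \<open>\<plusminus> z\<close>.
\<close>

lemma u_nonzero: "u0 z \<noteq> 0 \<or> u1 z \<noteq> 0"
proof (rule ccontr)
  assume "\<not> ?thesis"
  then have "u0 z * u1 w = u1 z * u0 w" for w by simp
  then have *: "z + w \<in> gaussian_ints \<or> z - w \<in> gaussian_ints" for w by (simp add: u_wedge_zero_iff)
  have "z \<in> gaussian_ints" using *[of 0] by simp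
  then have "\<omega> \<in> gaussian_ints"
    using *[of \<omega>] gaussian_ints_closed(7)[of "z + \<omega>" z] gaussian_ints_closed(7)[of z "z - \<omega>"] by auto
  then show False using half_not_gaussian by blast
qed

lemma u0_times_i: "u0 (\<i> * z) = - u0 z"
  by (simp add: u0_def sigma_times_i power_mult_distrib)

lemma u1_times_i: "u1 (\<i> * z) = u1 z"
proof -
  have "s (\<i> * z + \<omega>) = \<i> * s (z - \<omega> + 1)" "s (\<i> * z - \<omega>) = \<i> * s (z + \<omega> - 1)"
    unfolding sigma_times_i[symmetric] by (rule arg_cong[where f = s]; simp add: field_simps)+
  then have "s (\<i> * z + \<omega>) * s (\<i> * z - \<omega>) = - (s (z - \<omega> + 1) * s (z + \<omega> - 1))"
    by (simp only: i_times_i_times)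
  also have "\<dots> = - (exp (of_real pi * (z - \<omega> + 1 / 2)) * exp (of_real pi * (1 / 2 - (z + \<omega>)))) * (s (z - \<omega>) * s (z + \<omega>))"
    unfolding shift_1 shift_minus_1 by simp
  also have "exp (of_real pi * (z - \<omega> + 1 / 2)) * exp (of_real pi * (1 / 2 - (z + \<omega>))) = exp (- (of_real pi * \<i>))"
    unfolding exp_add[symmetric] by (rule arg_cong[where f = exp]) (simp add: field_simps)
  also have "\<dots> = - 1" by (simp add: exp_minus)
  finally show ?thesis by (simp add: u1_def mult.commute)
qed

text \<open>
  The multiplier that occurs when \<open>(u0, u1)\<close> is translated by \<open>\<omega>\<close>.
\<close>

definition E where "E z = \<i> * exp (of_real pi * (1 / 2 + (1 - \<i>) * z))"

lemma E_split: "E z = \<i> * exp (of_real pi / 2) * exp (of_real pi * ((1 - \<i>) * z))"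
  by (simp add: E_def distrib_left exp_add)

lemma E_nonzero: "E z \<noteq> 0" by (simp add: E_def)

lemma E_add: "E (z + w) * E (z - w) = (E z)\<^sup>2"
proof -
  have "exp (of_real pi * (1 / 2 + (1 - \<i>) * (z + w))) * exp (of_real pi * (1 / 2 + (1 - \<i>) * (z - w))) =
    (exp (of_real pi * (1 / 2 + (1 - \<i>) * z)))\<^sup>2"
    unfolding power2_eq_square exp_add[symmetric] by (rule arg_cong[where f = exp]) (simp add: field_simps)
  then show ?thesis by (simp only: E_def power_mult_distrib i_times_i_times) simp
qed

lemma sigma_shift_1_i: "s (z + (1 + \<i>)) = - exp (of_real pi * (1 + (1 - \<i>) * z)) * s z"
proof -
  have "s (z + (1 + \<i>)) = exp (of_real pi * (z + \<i> + 1 / 2)) * exp (of_real pi * (1 / 2 - \<i> * z)) * s z"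
    using shift_1[of "z + \<i>"] shift_i[of z] by (simp add: algebra_simps)
  also have "exp (of_real pi * (z + \<i> + 1 / 2)) * exp (of_real pi * (1 / 2 - \<i> * z)) =
      exp (of_real pi * (1 + (1 - \<i>) * z) + of_real pi * \<i>)"
    unfolding exp_add[symmetric] by (rule arg_cong[where f = exp]) (simp add: field_simps)
  finally show ?thesis by (simp add: exp_add)
qed

text \<open>
  The double zero and the double pole of \<open>u1 / u0\<close> differ by \<open>\<omega>\<close>, so that translation by \<open>\<omega>\<close> exchanges
  \<open>u0\<close> and \<open>u1\<close> up to factors. The normalisation of \<open>s\<close> makes these factors opposite.
\<close>

lemma u_half: "u0 (z + \<omega>) = E z * u1 z" "u1 (z + \<omega>) = - (E z * u0 z)"
proof -
  have eh: "exp (of_real pi / 2) \<noteq> (0 :: complex)" by simp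
  have "s (z + \<omega>) = - exp (of_real pi * (1 + (1 - \<i>) * (z - \<omega>))) * s (z - \<omega>)"
    using sigma_shift_1_i[of "z - \<omega>"] by (simp add: field_simps)
  also have "of_real pi * (1 + (1 - \<i>) * (z - \<omega>)) = of_real pi * ((1 - \<i>) * z)"
    by (simp add: field_simps)
  finally have "(s (z + \<omega>))\<^sup>2 = - exp (of_real pi * ((1 - \<i>) * z)) * (s (z + \<omega>) * s (z - \<omega>))"
    by (simp add: power2_eq_square)
  then show "u0 (z + \<omega>) = E z * u1 z"
    by (simp add: u0_def u1_def norm_half E_split)
  have "s (z + \<omega> + \<omega>) = - exp (of_real pi * (1 + (1 - \<i>) * z)) * s z"
    using sigma_shift_1_i[of z] by (simp add: add.assoc)
  then have "u1 (z + \<omega>) = exp (of_real pi * (1 + (1 - \<i>) * z)) * u0 z / (\<i> * exp (of_real pi / 2))"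
    by (simp add: u1_def u0_def norm_half) (simp add: power2_eq_square)
  also have "exp (of_real pi * (1 + (1 - \<i>) * z)) = exp (of_real pi / 2) * exp (of_real pi * (1 / 2 + (1 - \<i>) * z))"
    unfolding exp_add[symmetric] by (rule arg_cong[where f = exp]) (simp add: field_simps)
  finally show "u1 (z + \<omega>) = - (E z * u0 z)"
    by (simp add: E_def field_simps)
qed

text \<open>
  By the identity for \<open>s (z + w) * s (z - w)\<close>, translation by \<open>1 / 2\<close> acts on the pair \<open>(u0, u1)\<close> by a constant
  matrix, up to a common multiplier. Evaluating the identity at the half periods \<open>1 / 2\<close> and \<open>\<omega>\<close>
  determines the matrix: \<open>u (z + 1 / 2) = (u z + 1) / (u z - 1)\<close>. The value of \<open>u0 (1 / 2)\<close> comes out because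
  \<open>u1 / u0\<close> has its pole at \<open>0 = - 1 / 2 + 1 / 2\<close>.
\<close>

lemma u_shift_half:
  "u0 (z + 1 / 2) = u0 (1 / 2) * exp (of_real pi * z) * (u1 z - u0 z)"
  "u1 (z + 1 / 2) = u0 (1 / 2) * exp (of_real pi * z) * (u0 z + u1 z)"
  and u0_half_sq: "2 * (u0 (1 / 2))\<^sup>2 = exp (of_real pi / 2)"
proof -
  define p where "p = u0 (1 / 2)"
  define r where "r = u1 (1 / 2)"
  define e where "e = (\<lambda>z :: complex. exp (of_real pi * z))"
  define c :: complex where "c = exp (of_real pi / 2)"
  have e: "e z \<noteq> 0" "c \<noteq> 0" for z by (simp_all add: e_def c_def)
  have p: "p \<noteq> 0" using half_not_Ints by (simp add: p_def u0_zero_iff gaussian_ints_iff)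
  have ui: "u0 (\<i> / 2) = - p" "u1 (\<i> / 2) = r"
    using u0_times_i[of "1 / 2"] u1_times_i[of "1 / 2"] by (simp_all add: p_def r_def)
  have uw: "u0 \<omega> = \<i> * c" "u1 \<omega> = 0"
    using u_half[of 0] by (simp_all add: E_def c_def)
  have A: "u0 (z + 1 / 2) * r - u1 (z + 1 / 2) * p = - (c * e z * u0 z)" for z
  proof -
    have "u0 (z + 1 / 2) * r - u1 (z + 1 / 2) * p = s (z + 1) * s z"
      using sigma_addition[of "z + 1 / 2" "1 / 2"] by (simp add: r_def p_def add.commute)
    also have "\<dots> = - exp (of_real pi * (z + 1 / 2)) * u0 z"
      by (simp add: shift_1 u0_def power2_eq_square)
    finally show ?thesis by (simp add: c_def e_def distrib_left exp_add)
  qed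
  have B: "u1 (z + 1 / 2) = e z * (u0 z * r + u1 z * p)" for z
  proof -
    have "- (u1 (z + 1 / 2) * (\<i> * c)) = s (z + 1 / 2 + \<omega>) * s (z + 1 / 2 - \<omega>)"
      by (simp add: sigma_addition uw)
    also have "z + 1 / 2 + \<omega> = z + \<i> / 2 + 1" by (simp add: field_simps)
    also have "z + 1 / 2 - \<omega> = z - \<i> / 2" by (simp add: field_simps)
    also have "s (z + \<i> / 2 + 1) * s (z - \<i> / 2) =
        - exp (of_real pi * (z + \<i> / 2 + 1 / 2)) * (s (z + \<i> / 2) * s (z - \<i> / 2))"
      by (simp add: shift_1)
    also have "s (z + \<i> / 2) * s (z - \<i> / 2) = u0 z * r + u1 z * p"
      by (simp add: sigma_addition ui)
    also have "exp (of_real pi * (z + \<i> / 2 + 1 / 2)) = e z * (\<i> * c)"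
      by (simp add: e_def c_def distrib_left exp_add exp_half_pi_i)
    finally show ?thesis using e by simp
  qed
  have r: "r = p" using B[of 0] by (simp add: e_def r_def)
  have "u1 (- 1 / 2) = p" "u0 (- 1 / 2) = p" using u_minus[of "1 / 2"] r by (simp_all add: p_def r_def)
  then have "- p = - (c * e (- 1 / 2) * p)" "1 = e (- 1 / 2) * (2 * p\<^sup>2)"
    using A[of "- 1 / 2"] B[of "- 1 / 2"] by (simp_all add: r power2_eq_square)
  then have "e (- 1 / 2) * (2 * p\<^sup>2) = e (- 1 / 2) * c" using p by (simp add: mult.commute)
  then show c: "2 * (u0 (1 / 2))\<^sup>2 = exp (of_real pi / 2)"
    unfolding mult_cancel_left using e by (simp add: c_def p_def)
  show "u1 (z + 1 / 2) = u0 (1 / 2) * exp (of_real pi * z) * (u0 z + u1 z)"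
    using B[of z] by (simp add: r p_def e_def algebra_simps)
  have "p * u0 (z + 1 / 2) = p * u1 (z + 1 / 2) - 2 * p\<^sup>2 * e z * u0 z"
    using A[of z] c by (simp add: r c_def[symmetric] p_def[symmetric] algebra_simps)
  also have "\<dots> = p * (p * e z * (u1 z - u0 z))"
    by (simp add: B r algebra_simps power2_eq_square)
  finally show "u0 (z + 1 / 2) = u0 (1 / 2) * exp (of_real pi * z) * (u1 z - u0 z)"
    using p by (simp add: p_def e_def)
qed

lemma u0_addition: "u0 (z + w) * u0 (z - w) = (u0 z * u1 w - u1 z * u0 w)\<^sup>2"
  using sigma_addition[of z w] by (metis power_mult_distrib u0_def)

text \<open>
  The formula for \<open>u0\<close>, transported by the translation by \<open>\<omega>\<close>, which exchanges \<open>u0\<close> and \<open>u1\<close> up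
  to factors.
\<close>

lemma u1_addition: "u1 (z + w) * u1 (z - w) = (u0 z * u0 w + u1 z * u1 w)\<^sup>2"
proof -
  have "u0 (z + \<omega> + w) * u0 (z + \<omega> - w) = (E z * (u0 z * u0 w + u1 z * u1 w))\<^sup>2"
    unfolding u0_addition u_half by (simp add: algebra_simps)
  moreover have "z + \<omega> + w = (z + w) + \<omega>" "z + \<omega> - w = (z - w) + \<omega>" by simp_all
  ultimately have "E (z + w) * u1 (z + w) * (E (z - w) * u1 (z - w)) = (E z)\<^sup>2 * (u0 z * u0 w + u1 z * u1 w)\<^sup>2"
    by (simp only: u_half power_mult_distrib)
  then have "(E (z + w) * E (z - w)) * (u1 (z + w) * u1 (z - w)) = (E z)\<^sup>2 * (u0 z * u0 w + u1 z * u1 w)\<^sup>2"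
    by (simp only: mult_ac)
  then show ?thesis by (simp add: E_add E_nonzero)
qed

text \<open>
  The formula for \<open>u0\<close>, transported by the translation by \<open>1 / 2\<close>, which turns \<open>u0\<close> into a multiple of
  \<open>u1 - u0\<close>.
\<close>

lemma u_diff_addition:
  "(u1 (z + w) - u0 (z + w)) * (u1 (z - w) - u0 (z - w)) = (u1 z * u1 w - u0 z * u0 w - (u0 z * u1 w + u1 z * u0 w))\<^sup>2"
proof -
  define p where "p = u0 (1 / 2)"
  define e where "e = (\<lambda>z :: complex. exp (of_real pi * z))"
  have ne: "p * e z \<noteq> 0" for z using half_not_Ints by (simp add: p_def u0_zero_iff gaussian_ints_iff e_def)
  have "u0 (z + 1 / 2 + w) * u0 (z + 1 / 2 - w) = (p * e z * (u1 z * u1 w - u0 z * u0 w - (u0 z * u1 w + u1 z * u0 w)))\<^sup>2"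
    unfolding u0_addition u_shift_half p_def e_def by (simp add: algebra_simps)
  moreover have "z + 1 / 2 + w = (z + w) + 1 / 2" "z + 1 / 2 - w = (z - w) + 1 / 2" by simp_all
  ultimately have "p * e (z + w) * (u1 (z + w) - u0 (z + w)) * (p * e (z - w) * (u1 (z - w) - u0 (z - w)))
    = (p * e z)\<^sup>2 * (u1 z * u1 w - u0 z * u0 w - (u0 z * u1 w + u1 z * u0 w))\<^sup>2"
    by (simp only: u_shift_half power_mult_distrib p_def e_def)
  then have "p * e (z + w) * (p * e (z - w)) * ((u1 (z + w) - u0 (z + w)) * (u1 (z - w) - u0 (z - w)))
    = (p * e z)\<^sup>2 * (u1 z * u1 w - u0 z * u0 w - (u0 z * u1 w + u1 z * u0 w))\<^sup>2"
    by (simp only: mult_ac)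
  moreover have "e (z + w) * e (z - w) = (e z)\<^sup>2"
    unfolding e_def power2_eq_square exp_add[symmetric] by (rule arg_cong[where f = exp]) (simp add: field_simps)
  then have "p * e (z + w) * (p * e (z - w)) = (p * e z)\<^sup>2"
    by (simp add: power2_eq_square mult_ac)
  ultimately show ?thesis using ne[of z] by simp
qed

text \<open>
  Multiplication by \<open>\<i>\<close> changes the sign of \<open>u0\<close> only.
\<close>

lemma u_sum_addition:
  "(u1 (z + w) + u0 (z + w)) * (u1 (z - w) + u0 (z - w)) = (u1 z * u1 w - u0 z * u0 w + (u0 z * u1 w + u1 z * u0 w))\<^sup>2"
  using u_diff_addition[of "\<i> * z" "\<i> * w"]
  by (simp add: u0_times_i u1_times_i diff_diff_eq2 add_ac flip: distrib_left right_diff_distrib)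

text \<open>
  Complex multiplication: the first formula is the case \<open>w = \<i> * z\<close> of the addition formula, and the
  second one follows from it by a translation, since \<open>(1 + \<i>) * (1 / 2) = \<omega>\<close>.
\<close>

lemma u_times_1_i:
  "u0 ((1 + \<i>) * z) = 2 * \<i> * u0 z * u1 z" "u1 ((1 + \<i>) * z) = (u1 z)\<^sup>2 - (u0 z)\<^sup>2"
proof -
  have 0: "u0 ((1 + \<i>) * z) = 2 * \<i> * u0 z * u1 z" for z
  proof -
    have "z - \<i> * z = \<i> * - ((1 + \<i>) * z)" by (simp add: algebra_simps)
    then have "s (z - \<i> * z) = - (\<i> * s ((1 + \<i>) * z))"
      by (simp only: sigma_times_i minus mult_minus_right)
    moreover have "s (z + \<i> * z) = s ((1 + \<i>) * z)" by (simp add: algebra_simps)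
    ultimately have "- \<i> * u0 ((1 + \<i>) * z) = s (z + \<i> * z) * s (z - \<i> * z)"
      by (simp add: u0_def power2_eq_square)
    also have "\<dots> = 2 * u0 z * u1 z"
      unfolding sigma_addition u0_times_i u1_times_i by simp
    finally have "\<i> * (- \<i> * u0 ((1 + \<i>) * z)) = \<i> * (2 * u0 z * u1 z)" by (rule arg_cong)
    then show ?thesis by simp
  qed
  then show "u0 ((1 + \<i>) * z) = 2 * \<i> * u0 z * u1 z" .
  have "(1 + \<i>) * (z + 1 / 2) = (1 + \<i>) * z + \<omega>" by (simp add: field_simps)
  then have "E ((1 + \<i>) * z) * u1 ((1 + \<i>) * z) = 2 * \<i> * u0 (z + 1 / 2) * u1 (z + 1 / 2)"
    by (metis 0 u_half(1))
  also have "\<dots> = \<i> * (2 * (u0 (1 / 2))\<^sup>2) * (exp (of_real pi * z) * exp (of_real pi * z)) * ((u1 z)\<^sup>2 - (u0 z)\<^sup>2)"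
    unfolding u_shift_half by (simp add: power2_eq_square algebra_simps)
  also have "\<i> * (2 * (u0 (1 / 2))\<^sup>2) * (exp (of_real pi * z) * exp (of_real pi * z)) = E ((1 + \<i>) * z)"
  proof -
    have "of_real pi * ((1 - \<i>) * ((1 + \<i>) * z)) = of_real pi * z + of_real pi * z"
      by (simp add: algebra_simps)
    then show ?thesis by (simp only: u0_half_sq E_split exp_add)
  qed
  finally show "u1 ((1 + \<i>) * z) = (u1 z)\<^sup>2 - (u0 z)\<^sup>2"
    using E_nonzero by simp
qed

end

section \<open>The quotient of the torus in homogeneous coordinates\<close>
lemma vector_2_3_nth [simp]:
  "(vector [a, b] :: complex ^ 2) $ 1 = a" "(vector [a, b] :: complex ^ 2) $ 2 = b"
  "(vector [a, b, c] :: complex ^ 3) $ 1 = a" "(vector [a, b, c] :: complex ^ 3) $ 2 = b" "(vector [a, b, c] :: complex ^ 3) $ 3 = c"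
  by simp_all

lemma proj_pt_eq_iff:
  assumes "v \<noteq> 0" "w \<noteq> 0"
  shows "proj_pt v = proj_pt w \<longleftrightarrow> (\<exists>c. c \<noteq> 0 \<and> w = c *s v)"
proof -
  have refl: "proj_rel v v" "proj_rel w w"
    using assms by (auto simp: proj_rel_def intro!: exI[of _ 1])
  have "proj_rel v w \<longleftrightarrow> proj_pt v = proj_pt w"
    using Quotient_rel[OF Quotient_proj, of v w] refl by simp
  then show ?thesis using assms by (simp add: proj_rel_def)
qed

lemma proj_pt_cases: obtains v where "v \<noteq> 0" "p = proj_pt v"
  using Quotient_abs_rep[OF Quotient_proj, of p] Quotient_rep_reflp[OF Quotient_proj, of p]
  by (metis proj_rel_def)

text \<open>
  In terms of \<open>u = p1 / p0\<close> and \<open>v = q1 / q0\<close> this is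
  \<open>[(1 + u v)\<^sup>2 : (1 - u\<^sup>2) (1 - v\<^sup>2) : (1 - u v)\<^sup>2]\<close>, the quotient map of the product of two projective lines by
  the exchange of \<open>u\<close> and \<open>v\<close> together with \<open>(u, v) \<mapsto> (- u, - v)\<close> and \<open>(u, v) \<mapsto> (- 1 / u, - 1 / v)\<close>. The first
  and third coordinates, and the difference of the first two, are the squares of \<open>1 + u v\<close>, \<open>1 - u v\<close>
  and \<open>u + v\<close>. These are coordinates on the space of unordered pairs, on which the two other
  symmetries act by changes of signs.
\<close>

definition invariant_map :: "complex \<Rightarrow> complex \<Rightarrow> complex \<Rightarrow> complex \<Rightarrow> complex ^ 3" where
  "invariant_map p0 p1 q0 q1 =
     vector [(p0 * q0 + p1 * q1)\<^sup>2, (p1\<^sup>2 - p0\<^sup>2) * (q1\<^sup>2 - q0\<^sup>2), (p1 * q1 - p0 * q0)\<^sup>2]"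

lemma invariant_map_scale:
  "invariant_map (k * p0) (k * p1) (l * q0) (l * q1) = (k * l)\<^sup>2 *s invariant_map p0 p1 q0 q1"
  unfolding invariant_map_def smult_vector3 by (simp add: power2_eq_square algebra_simps)

lemma invariant_map_swap: "invariant_map q0 q1 p0 p1 = invariant_map p0 p1 q0 q1"
  unfolding invariant_map_def by (simp add: mult.commute)

lemma invariant_map_symmetries:
  "invariant_map (- p0) p1 (- q0) q1 = invariant_map p0 p1 q0 q1"
  "invariant_map p1 (- p0) q1 (- q0) = invariant_map p0 p1 q0 q1"
  unfolding invariant_map_def by (simp_all add: power2_eq_square algebra_simps)

lemma invariant_map_nonzero:
  assumes "p0 \<noteq> 0 \<or> p1 \<noteq> 0" "q0 \<noteq> 0 \<or> q1 \<noteq> 0"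
  shows "invariant_map p0 p1 q0 q1 \<noteq> 0"
proof
  assume "invariant_map p0 p1 q0 q1 = 0"
  then have 1: "p0 * q0 + p1 * q1 = 0" "p1 * q1 - p0 * q0 = 0" and 2: "(p1\<^sup>2 - p0\<^sup>2) * (q1\<^sup>2 - q0\<^sup>2) = 0"
    unfolding invariant_map_def vector3_eq_0_iff by auto
  have "2 * (p1 * q1) = 0" "2 * (p0 * q0) = 0"
    using arg_cong2[OF 1, of "(+)"] arg_cong2[OF 1, of "(-)"] by simp_all
  then have "p1 = 0 \<or> q1 = 0" "p0 = 0 \<or> q0 = 0" by simp_all
  then show False using 2 assms by auto
qed

lemma proportional_pairs:
  fixes a b c d :: complex
  assumes "a * d = b * c" "a \<noteq> 0 \<or> b \<noteq> 0" "c \<noteq> 0 \<or> d \<noteq> 0"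
  obtains k where "k \<noteq> 0" "a = k * c" "b = k * d"
proof (cases "c = 0")
  case True
  then show ?thesis using assms that[of "b / d"] by auto
next
  case False
  with assms have "a \<noteq> 0" by auto
  with False show ?thesis using assms(1) that[of "a / c"] by (simp add: field_simps)
qed

text \<open>
  Unique factorisation of binary quadratic forms: the two products of linear forms are proportional,
  hence vanish at the same points.
\<close>

lemma binary_quadratic_factors:
  fixes p0 p1 q0 q1 :: complex
  assumes k: "k \<noteq> 0" and 0: "p0' * q0' = k * (p0 * q0)" and 1: "p1' * q1' = k * (p1 * q1)"
    and 01: "p0' * q1' + p1' * q0' = k * (p0 * q1 + p1 * q0)"
  shows "p0' * p1 = p1' * p0 \<and> q0' * q1 = q1' * q0 \<or> p0' * q1 = p1' * q0 \<and> q0' * p1 = q1' * p0"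
proof -
  have eval: "(p0' * y - p1' * x) * (q0' * y - q1' * x) = k * ((p0 * y - p1 * x) * (q0 * y - q1 * x))" for x y
  proof -
    have "(p0' * y - p1' * x) * (q0' * y - q1' * x) =
        (p0' * q0') * y\<^sup>2 - (p0' * q1' + p1' * q0') * (x * y) + (p1' * q1') * x\<^sup>2"
      by (simp add: power2_eq_square algebra_simps)
    then show ?thesis unfolding 0 1 01 by (simp add: power2_eq_square algebra_simps)
  qed
  have "p0' * p1 = p1' * p0 \<or> q0' * p1 = q1' * p0" using eval[of p1 p0] by simp
  moreover have "p0' * q1 = p1' * q0 \<or> q0' * q1 = q1' * q0" using eval[of q1 q0] by simp
  moreover have "p0' * p1 = p1' * p0 \<or> p0' * q1 = p1' * q0"
    using eval[of p1' p0'] k by (auto simp: mult.commute)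
  moreover have "q0' * p1 = q1' * p0 \<or> q0' * q1 = q1' * q0"
    using eval[of q1' q0'] k by (auto simp: mult.commute)
  ultimately show ?thesis by blast
qed

text \<open>
  After a rescaling that makes \<open>1 + u v\<close> agree, \<open>1 - u v\<close> and \<open>u + v\<close> agree up to signs. Each of the four
  combinations of signs is the effect of one of the four listed substitutions on the pair \<open>(u, v)\<close>;
  undoing it leaves proportional quadratic forms.
\<close>

lemma invariant_map_fibre:
  assumes k: "k \<noteq> 0" and eq: "invariant_map p0' p1' q0' q1' = k *s invariant_map p0 p1 q0 q1"
  obtains r0 r1 t0 t1 where
    "(r0, r1, t0, t1) \<in> {(p0, p1, q0, q1), (- p0, p1, - q0, q1), (p1, - p0, q1, - q0), (p1, p0, q1, q0)}"
    "p0' * r1 = p1' * r0 \<and> q0' * t1 = q1' * t0 \<or> p0' * t1 = p1' * t0 \<and> q0' * r1 = q1' * r0"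
proof -
  have E: "(p0' * q0' + p1' * q1')\<^sup>2 = k * (p0 * q0 + p1 * q1)\<^sup>2"
    "(p1' * q1' - p0' * q0')\<^sup>2 = k * (p1 * q1 - p0 * q0)\<^sup>2"
    "(p1'\<^sup>2 - p0'\<^sup>2) * (q1'\<^sup>2 - q0'\<^sup>2) = k * ((p1\<^sup>2 - p0\<^sup>2) * (q1\<^sup>2 - q0\<^sup>2))"
    using arg_cong[OF eq, of "\<lambda>v. v $ 1"] arg_cong[OF eq, of "\<lambda>v. v $ 2"] arg_cong[OF eq, of "\<lambda>v. v $ 3"]
    by (simp_all add: invariant_map_def)
  have "(p0' * q1' + p1' * q0')\<^sup>2 = (p0' * q0' + p1' * q1')\<^sup>2 - (p1'\<^sup>2 - p0'\<^sup>2) * (q1'\<^sup>2 - q0'\<^sup>2)"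
    by (simp add: power2_eq_square algebra_simps)
  also have "\<dots> = k * (p0 * q1 + p1 * q0)\<^sup>2"
    unfolding E by (simp add: power2_eq_square algebra_simps)
  finally have E4: "(p0' * q1' + p1' * q0')\<^sup>2 = k * (p0 * q1 + p1 * q0)\<^sup>2" .
  have sq: "x = csqrt k * y \<or> x = - (csqrt k * y)" if "x\<^sup>2 = k * y\<^sup>2" for x y
    using that by (metis power2_csqrt power2_eq_iff power_mult_distrib)
  \<comment> \<open>The sign of the square root of \<open>k\<close> is chosen such that the first coordinates agree.\<close>
  obtain c where c: "c\<^sup>2 = k" "p0' * q0' + p1' * q1' = c * (p0 * q0 + p1 * q1)"
    using sq[OF E(1)] by (metis mult_minus_left power2_csqrt power2_minus)
  have c0: "c \<noteq> 0" using c k by auto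
  have sq': "x = c * y \<or> x = c * (- y)" if "x\<^sup>2 = k * y\<^sup>2" for x y
    using that c(1) by (metis mult_minus_right power2_eq_iff power_mult_distrib)
  note F = binary_quadratic_factors[OF c0]
  have prod: "p0' * q0' = c * A \<and> p1' * q1' = c * B"
    if "c * (p0 * q0 + p1 * q1) = c * (A + B)" "p1' * q1' - p0' * q0' = c * (B - A)" for A B
  proof -
    have "2 * (p0' * q0') = 2 * (c * A)" "2 * (p1' * q1') = 2 * (c * B)"
      using arg_cong2[OF c(2)[unfolded that(1)] that(2), of "(+)"] arg_cong2[OF c(2)[unfolded that(1)] that(2), of "(-)"]
      by (simp_all add: algebra_simps)
    then show ?thesis by simp
  qed
  from sq'[OF E(2)] sq'[OF E4] consider
      "p1' * q1' - p0' * q0' = c * (p1 * q1 - p0 * q0)" "p0' * q1' + p1' * q0' = c * (p0 * q1 + p1 * q0)"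
    | "p1' * q1' - p0' * q0' = c * (p1 * q1 - p0 * q0)" "p0' * q1' + p1' * q0' = c * - (p0 * q1 + p1 * q0)"
    | "p1' * q1' - p0' * q0' = c * - (p1 * q1 - p0 * q0)" "p0' * q1' + p1' * q0' = c * - (p0 * q1 + p1 * q0)"
    | "p1' * q1' - p0' * q0' = c * - (p1 * q1 - p0 * q0)" "p0' * q1' + p1' * q0' = c * (p0 * q1 + p1 * q0)"
    by blast
  then show ?thesis
  proof cases
    case 1
    with prod[of "p0 * q0" "p1 * q1"] F[of p0' q0' p0 q0 p1' q1' p1 q1] that[of p0 p1 q0 q1]
    show ?thesis by simp
  next
    case 2
    with prod[of "p0 * q0" "p1 * q1"] F[of p0' q0' "- p0" "- q0" p1' q1' p1 q1] that[of "- p0" p1 "- q0" q1]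
    show ?thesis by (simp add: algebra_simps)
  next
    case 3
    with prod[of "p1 * q1" "p0 * q0"] F[of p0' q0' p1 q1 p1' q1' "- p0" "- q0"] that[of p1 "- p0" q1 "- q0"]
    show ?thesis by (simp add: algebra_simps)
  next
    case 4
    with prod[of "p1 * q1" "p0 * q0"] F[of p0' q0' p1 q1 p1' q1' p0 q0] that[of p1 p0 q1 q0]
    show ?thesis by (simp add: algebra_simps)
  qed
qed

lemma binary_quadratic_split:
  fixes a b c :: complex
  assumes "a \<noteq> 0 \<or> b \<noteq> 0 \<or> c \<noteq> 0"
  obtains p0 p1 q0 q1 where "p0 * q0 = a" "p0 * q1 + p1 * q0 = b" "p1 * q1 = c"
    "p0 \<noteq> 0 \<or> p1 \<noteq> 0" "q0 \<noteq> 0 \<or> q1 \<noteq> 0"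
proof (cases "a = 0")
  case True
  then show ?thesis using that[of 0 b c 1] assms by simp
next
  case False
  define d where "d = csqrt (b\<^sup>2 - 4 * a * c)"
  have "d\<^sup>2 = b\<^sup>2 - 4 * a * c" by (simp add: d_def)
  then have "(b + d) / 2 * ((b - d) / (2 * a)) = c"
    using False by (simp add: field_simps power2_eq_square)
  then show ?thesis
    using that[of a 1 "(b - d) / (2 * a)" "(b + d) / 2"] False by (simp add: field_simps)
qed

text \<open>
  Extract square roots to find \<open>1 + u v\<close>, \<open>1 - u v\<close> and \<open>u + v\<close>, and factor the quadratic form with these
  coefficients.
\<close>

lemma invariant_map_surj:
  assumes "v \<noteq> 0"
  obtains p0 p1 q0 q1 where "invariant_map p0 p1 q0 q1 = v" "p0 \<noteq> 0 \<or> p1 \<noteq> 0" "q0 \<noteq> 0 \<or> q1 \<noteq> 0"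
proof -
  define x where "x = csqrt (v $ 1)"
  define y where "y = csqrt (v $ 1 - v $ 2)"
  define z where "z = csqrt (v $ 3)"
  have sq: "x\<^sup>2 = v $ 1" "y\<^sup>2 = v $ 1 - v $ 2" "z\<^sup>2 = v $ 3" by (simp_all add: x_def y_def z_def)
  have "(x - z) / 2 \<noteq> 0 \<or> y \<noteq> 0 \<or> (x + z) / 2 \<noteq> 0"
  proof (rule ccontr)
    assume "\<not> ?thesis"
    then have "x = 0 \<and> y = 0 \<and> z = 0" by auto
    then have "v = 0" using sq by (simp add: vec_eq_iff forall_3)
    then show False using assms by simp
  qed
  then obtain p0 p1 q0 q1 where pq: "p0 * q0 = (x - z) / 2" "p0 * q1 + p1 * q0 = y" "p1 * q1 = (x + z) / 2"
    "p0 \<noteq> 0 \<or> p1 \<noteq> 0" "q0 \<noteq> 0 \<or> q1 \<noteq> 0" by (rule binary_quadratic_split)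
  have "p0 * q0 + p1 * q1 = x" "p1 * q1 - p0 * q0 = z"
    unfolding pq by (simp_all add: field_simps)
  moreover have "(p1\<^sup>2 - p0\<^sup>2) * (q1\<^sup>2 - q0\<^sup>2) = (p0 * q0 + p1 * q1)\<^sup>2 - (p0 * q1 + p1 * q0)\<^sup>2"
    by (simp add: power2_eq_square algebra_simps)
  ultimately have "invariant_map p0 p1 q0 q1 = vector [x\<^sup>2, x\<^sup>2 - y\<^sup>2, z\<^sup>2]"
    by (simp add: invariant_map_def pq)
  also have "\<dots> = v" unfolding sq by (simp add: vec_eq_iff forall_3)
  finally show ?thesis using that pq by blast
qed

context gaussian_sigma
begin

text \<open>
  If some combination \<open>u1 - c * u0\<close> had no zeros, then \<open>u0\<close> would be a multiple of it, by the uniqueness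
  principle. The value at \<open>0\<close> excludes this.
\<close>

lemma u_surj:
  assumes "a \<noteq> 0 \<or> b \<noteq> 0"
  obtains z k where "k \<noteq> 0" "u0 z = k * a" "u1 z = k * b"
proof (cases "a = 0")
  case True
  then show ?thesis using assms that[of "1 / b" 0] by simp
next
  case False
  define G where "G = (\<lambda>z. u1 z - b / a * u0 z)"
  have G: "G holomorphic_on UNIV" unfolding G_def by (intro holomorphic_intros entire_u)
  have "\<exists>z. G z = 0"
  proof (rule ccontr)
    assume ne: "\<nexists>z. G z = 0"
    obtain H where H: "H holomorphic_on UNIV" "\<And>z. u0 z = H z * G z"
      by (rule entire_quotient_simple_zeros[OF entire_u(1) G]) (use ne in auto)
    have G_shift: "G (z + 1) = exp (2 * of_real pi * (z + 1 / 2)) * G z"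
      "G (z + \<i>) = exp (2 * of_real pi * (1 / 2 - \<i> * z)) * G z" for z
      unfolding G_def u_shift right_diff_distrib by (simp_all only: mult_ac)
    have "G 0 \<noteq> 0" using ne by blast
    then obtain c where c: "\<And>z. u0 z = c * G z"
      by (rule same_multipliers_const[OF H(1) G _ H(2) u_shift(1) G_shift(1) _ u_shift(3) G_shift(2)]) auto
    have "c = 0" using c[of 0] ne by auto
    then have "u0 \<omega> = 0" using c by simp
    then show False using half_not_gaussian by (simp add: u0_zero_iff)
  qed
  then obtain z where "u1 z = b / a * u0 z" by (auto simp: G_def)
  moreover from this have "u0 z \<noteq> 0" using u_nonzero[of z] by auto
  ultimately show ?thesis using that[of "u0 z / a" z] False by simp
qed

definition theta_map :: "complex ^ 2 \<Rightarrow> complex ^ 3" where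
  "theta_map z = invariant_map (u0 (z $ 1)) (u1 (z $ 1)) (u0 (z $ 2)) (u1 (z $ 2))"

lemma theta_map_nonzero: "theta_map z \<noteq> 0"
  unfolding theta_map_def using u_nonzero by (intro invariant_map_nonzero)

lemma theta_map_surj:
  assumes "v \<noteq> 0"
  obtains z k where "k \<noteq> 0" "theta_map z = k *s v"
proof -
  obtain p0 p1 q0 q1 where pq: "invariant_map p0 p1 q0 q1 = v" "p0 \<noteq> 0 \<or> p1 \<noteq> 0" "q0 \<noteq> 0 \<or> q1 \<noteq> 0"
    using invariant_map_surj[OF assms] .
  obtain z k where z: "k \<noteq> 0" "u0 z = k * p0" "u1 z = k * p1" using u_surj[OF pq(2)] .
  obtain w l where w: "l \<noteq> 0" "u0 w = l * q0" "u1 w = l * q1" using u_surj[OF pq(3)] .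
  have "theta_map (vector [z, w]) = (k * l)\<^sup>2 *s v"
    by (simp add: theta_map_def z w invariant_map_scale pq)
  then show ?thesis using that[of "(k * l)\<^sup>2"] z w by simp
qed

lemma u_proportional:
  assumes "z + w \<in> gaussian_ints \<or> z - w \<in> gaussian_ints"
  obtains k where "k \<noteq> 0" "u0 z = k * u0 w" "u1 z = k * u1 w"
  using assms u_wedge_zero_iff u_nonzero by (metis proportional_pairs)

lemma theta_map_congruent:
  assumes "z $ 1 + w $ 1 \<in> gaussian_ints \<or> z $ 1 - w $ 1 \<in> gaussian_ints"
    "z $ 2 + w $ 2 \<in> gaussian_ints \<or> z $ 2 - w $ 2 \<in> gaussian_ints"
  obtains k where "k \<noteq> 0" "theta_map z = k *s theta_map w"
proof -
  obtain k where k: "k \<noteq> 0" "u0 (z $ 1) = k * u0 (w $ 1)" "u1 (z $ 1) = k * u1 (w $ 1)"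
    using u_proportional[OF assms(1)] .
  obtain l where l: "l \<noteq> 0" "u0 (z $ 2) = l * u0 (w $ 2)" "u1 (z $ 2) = l * u1 (w $ 2)"
    using u_proportional[OF assms(2)] .
  show ?thesis using that[of "(k * l)\<^sup>2"] k l by (simp add: theta_map_def invariant_map_scale)
qed

lemma theta_map_symmetries:
  "theta_map (vector [z $ 2, z $ 1]) = theta_map z"
  "theta_map (\<i> *s z) = theta_map z"
  "theta_map (z + vector [\<omega>, \<omega>]) = (E (z $ 1) * E (z $ 2))\<^sup>2 *s theta_map z"
proof -
  show "theta_map (vector [z $ 2, z $ 1]) = theta_map z"
    by (simp add: theta_map_def invariant_map_swap)
  show "theta_map (\<i> *s z) = theta_map z"
    by (simp add: theta_map_def u0_times_i u1_times_i invariant_map_symmetries)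
  have "theta_map (z + vector [\<omega>, \<omega>]) =
      invariant_map (E (z $ 1) * u1 (z $ 1)) (E (z $ 1) * - u0 (z $ 1)) (E (z $ 2) * u1 (z $ 2)) (E (z $ 2) * - u0 (z $ 2))"
    by (simp add: theta_map_def u_half)
  then show "theta_map (z + vector [\<omega>, \<omega>]) = (E (z $ 1) * E (z $ 2))\<^sup>2 *s theta_map z"
    unfolding invariant_map_scale theta_map_def by (simp add: invariant_map_symmetries)
qed

text \<open>
  The four substitutions of the pair of values of \<open>u\<close> are realised on \<open>complex ^ 2\<close> by the identity, by
  \<open>z \<mapsto> \<i> z\<close>, by the translation by \<open>(\<omega>, \<omega>)\<close>, and by both together. Once they are taken into account, the
  values of \<open>u\<close> determine the coordinates up to order, sign and periods.
\<close>

lemma theta_map_fibre: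
  assumes "k \<noteq> 0" "theta_map z' = k *s theta_map z"
  obtains r where "r \<in> {z, \<i> *s z, z + vector [\<omega>, \<omega>], \<i> *s z + vector [\<omega>, \<omega>]}"
    "(z' $ 1 + r $ 1 \<in> gaussian_ints \<or> z' $ 1 - r $ 1 \<in> gaussian_ints) \<and>
     (z' $ 2 + r $ 2 \<in> gaussian_ints \<or> z' $ 2 - r $ 2 \<in> gaussian_ints) \<or>
     (z' $ 1 + r $ 2 \<in> gaussian_ints \<or> z' $ 1 - r $ 2 \<in> gaussian_ints) \<and>
     (z' $ 2 + r $ 1 \<in> gaussian_ints \<or> z' $ 2 - r $ 1 \<in> gaussian_ints)"
proof -
  define P where "P = (\<lambda>r. r \<in> {z, \<i> *s z, z + vector [\<omega>, \<omega>], \<i> *s z + vector [\<omega>, \<omega>]})"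
  obtain r0 r1 t0 t1 where
    r: "(r0, r1, t0, t1) \<in> {(u0 (z $ 1), u1 (z $ 1), u0 (z $ 2), u1 (z $ 2)),
       (- u0 (z $ 1), u1 (z $ 1), - u0 (z $ 2), u1 (z $ 2)),
       (u1 (z $ 1), - u0 (z $ 1), u1 (z $ 2), - u0 (z $ 2)),
       (u1 (z $ 1), u0 (z $ 1), u1 (z $ 2), u0 (z $ 2))}"
    and eq: "u0 (z' $ 1) * r1 = u1 (z' $ 1) * r0 \<and> u0 (z' $ 2) * t1 = u1 (z' $ 2) * t0 \<or>
      u0 (z' $ 1) * t1 = u1 (z' $ 1) * t0 \<and> u0 (z' $ 2) * r1 = u1 (z' $ 2) * r0"
    by (rule invariant_map_fibre[OF assms(1) assms(2)[unfolded theta_map_def]])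
  have "\<exists>r k l. P r \<and> k \<noteq> 0 \<and> l \<noteq> 0 \<and> u0 (r $ 1) = k * r0 \<and> u1 (r $ 1) = k * r1 \<and> u0 (r $ 2) = l * t0 \<and> u1 (r $ 2) = l * t1"
  proof -
    have wit: ?thesis if "P r" "k \<noteq> 0" "l \<noteq> 0" "u0 (r $ 1) = k * r0" "u1 (r $ 1) = k * r1" "u0 (r $ 2) = l * t0" "u1 (r $ 2) = l * t1" for r k l
      using that by blast
    from r show ?thesis
    proof (elim insertE, goal_cases)
      case 1 then show ?case by (intro wit[of z 1 1]) (auto simp: P_def)
    next
      case 2 then show ?case by (intro wit[of "\<i> *s z" 1 1]) (auto simp: P_def u0_times_i u1_times_i)
    next
      case 3 then show ?case by (intro wit[of "z + vector [\<omega>, \<omega>]" "E (z $ 1)" "E (z $ 2)"]) (auto simp: P_def u_half E_nonzero)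
    next
      case 4 then show ?case by (intro wit[of "\<i> *s z + vector [\<omega>, \<omega>]" "E (\<i> * z $ 1)" "E (\<i> * z $ 2)"])
        (auto simp: P_def u_half E_nonzero u0_times_i u1_times_i)
    qed simp
  qed
  then obtain r k l where r: "P r" and kl: "k \<noteq> 0" "l \<noteq> 0" "u0 (r $ 1) = k * r0" "u1 (r $ 1) = k * r1" "u0 (r $ 2) = l * t0" "u1 (r $ 2) = l * t1"
    by blast
  have wk: "a * u1 (r $ 1) = b * u0 (r $ 1)" if "a * r1 = b * r0" for a b
    using arg_cong[OF that, of "\<lambda>x. k * x"] by (simp add: kl mult_ac)
  have wl: "a * u1 (r $ 2) = b * u0 (r $ 2)" if "a * t1 = b * t0" for a b
    using arg_cong[OF that, of "\<lambda>x. l * x"] by (simp add: kl mult_ac)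
  show ?thesis
  proof (rule that)
    show "r \<in> {z, \<i> *s z, z + vector [\<omega>, \<omega>], \<i> *s z + vector [\<omega>, \<omega>]}" using r by (simp only: P_def)
  qed (use eq wk wl in \<open>unfold u_wedge_zero_iff[symmetric], blast\<close>)
qed

text \<open>
  Semi-conjugacy with \<open>D2\<close> and \<open>D3\<close>. The three coordinates at \<open>(z + w, z - w)\<close> are polynomials in the
  products of \<open>u0\<close>, \<open>u1\<close>, \<open>u1 - u0\<close> and \<open>u1 + u0\<close> at the two points, and these products are the squares given
  by the addition theorem.
\<close>

lemma theta_map_sum_diff:
  "theta_map (vector [z $ 1 + z $ 2, z $ 1 - z $ 2]) =
     (let v = theta_map z in vector [(v$1 - v$2 + v$3)\<^sup>2, (- v$1 + v$2 + v$3)\<^sup>2, (v$1 + v$2 - v$3)\<^sup>2])"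
  "theta_map (vector [z $ 1 + z $ 2, \<i> * (z $ 1 - z $ 2)]) =
     (let v = theta_map z in vector [(v$1 + v$2 - v$3)\<^sup>2, (- v$1 + v$2 + v$3)\<^sup>2, (v$1 - v$2 + v$3)\<^sup>2])"
proof -
  define p0 p1 q0 q1 where "p0 = u0 (z $ 1)" "p1 = u1 (z $ 1)" "q0 = u0 (z $ 2)" "q1 = u1 (z $ 2)"
  note pq = this[symmetric]
  define U0 U1 V0 V1 where "U0 = u0 (z $ 1 + z $ 2)" "U1 = u1 (z $ 1 + z $ 2)" "V0 = u0 (z $ 1 - z $ 2)" "V1 = u1 (z $ 1 - z $ 2)"
  note UV = this[symmetric]
  define v where "v = invariant_map p0 p1 q0 q1"
  have 0: "U0 * V0 = v$3 - v$2" and 1: "U1 * V1 = v$1"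
    using u0_addition[of "z $ 1" "z $ 2"] u1_addition[of "z $ 1" "z $ 2"]
    by (simp_all add: UV pq v_def invariant_map_def power2_eq_square algebra_simps)
  have "(U1\<^sup>2 - U0\<^sup>2) * (V1\<^sup>2 - V0\<^sup>2) = ((U1 - U0) * (V1 - V0)) * ((U1 + U0) * (V1 + V0))"
    by (simp add: power2_eq_square algebra_simps)
  also have "\<dots> = ((p1 * q1 - p0 * q0 - (p0 * q1 + p1 * q0)) * (p1 * q1 - p0 * q0 + (p0 * q1 + p1 * q0)))\<^sup>2"
    using u_diff_addition[of "z $ 1" "z $ 2"] u_sum_addition[of "z $ 1" "z $ 2"]
    by (simp add: UV pq power_mult_distrib)
  also have "(p1 * q1 - p0 * q0 - (p0 * q1 + p1 * q0)) * (p1 * q1 - p0 * q0 + (p0 * q1 + p1 * q0)) = - v$1 + v$2 + v$3"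
    by (simp add: v_def invariant_map_def power2_eq_square algebra_simps)
  finally have 2: "(U1\<^sup>2 - U0\<^sup>2) * (V1\<^sup>2 - V0\<^sup>2) = (- v$1 + v$2 + v$3)\<^sup>2" .
  have v: "theta_map z = v" by (simp add: theta_map_def v_def pq)
  show "theta_map (vector [z $ 1 + z $ 2, z $ 1 - z $ 2]) =
     (let v = theta_map z in vector [(v$1 - v$2 + v$3)\<^sup>2, (- v$1 + v$2 + v$3)\<^sup>2, (v$1 + v$2 - v$3)\<^sup>2])"
  proof -
    have "theta_map (vector [z $ 1 + z $ 2, z $ 1 - z $ 2]) =
        vector [(U0 * V0 + U1 * V1)\<^sup>2, (U1\<^sup>2 - U0\<^sup>2) * (V1\<^sup>2 - V0\<^sup>2), (U1 * V1 - U0 * V0)\<^sup>2]"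
      by (simp add: theta_map_def invariant_map_def UV)
    then show ?thesis unfolding v Let_def 0 1 2 by (simp add: algebra_simps)
  qed
  show "theta_map (vector [z $ 1 + z $ 2, \<i> * (z $ 1 - z $ 2)]) =
     (let v = theta_map z in vector [(v$1 + v$2 - v$3)\<^sup>2, (- v$1 + v$2 + v$3)\<^sup>2, (v$1 - v$2 + v$3)\<^sup>2])"
  proof -
    have "theta_map (vector [z $ 1 + z $ 2, \<i> * (z $ 1 - z $ 2)]) =
        vector [(U1 * V1 - U0 * V0)\<^sup>2, (U1\<^sup>2 - U0\<^sup>2) * (V1\<^sup>2 - V0\<^sup>2), (U0 * V0 + U1 * V1)\<^sup>2]"
      by (simp only: theta_map_def vector_2_3_nth u0_times_i u1_times_i UV invariant_map_def) (simp add: add.commute)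
    then show ?thesis unfolding v Let_def 0 1 2 by (simp add: algebra_simps)
  qed
qed

text \<open>
  Semi-conjugacy with \<open>D1\<close>, which is the multiplication by \<open>1 + \<i>\<close>.
\<close>

lemma theta_map_times_1_i:
  "theta_map ((1 + \<i>) *s z) =
     (let v = theta_map z in vector [(- v$1 + v$2 + v$3)\<^sup>2, (v$1 - v$2 + v$3)\<^sup>2, (v$1 + v$2 - v$3)\<^sup>2])"
proof -
  define p0 p1 q0 q1 where "p0 = u0 (z $ 1)" "p1 = u1 (z $ 1)" "q0 = u0 (z $ 2)" "q1 = u1 (z $ 2)"
  note pq = this[symmetric]
  have "2 * \<i> * p0 * p1 * (2 * \<i> * q0 * q1) = (2 * p0 * p1) * (2 * q0 * q1) * (\<i> * \<i>)" by (simp only: mult_ac)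
  then have i: "2 * \<i> * p0 * p1 * (2 * \<i> * q0 * q1) = - (4 * p0 * p1 * q0 * q1)" by simp
  have i2: "(2 * \<i> * x * y)\<^sup>2 = - (4 * x\<^sup>2 * y\<^sup>2)" for x y by (simp add: power_mult_distrib)
  show ?thesis
    unfolding theta_map_def invariant_map_def Let_def
    by (simp only: vector_smult_component u_times_1_i pq vector_2_3_nth i i2) (simp add: power2_eq_square algebra_simps)
qed

end

section \<open>Holomorphic maps from the torus\<close>
text \<open>
  Complex differentiability in several variables, expressed as in the notion of holomorphic maps by a
  real derivative that happens to be complex linear.
\<close>

definition scalar_holomorphic_at :: "(complex ^ 'n \<Rightarrow> complex) \<Rightarrow> complex ^ 'n::finite \<Rightarrow> bool" where
  "scalar_holomorphic_at g z \<longleftrightarrow> (\<exists>D. (g has_derivative D) (at z) \<and> (\<forall>c h. D (c *s h) = c * D h))"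

lemma scalar_holomorphic_at_const: "scalar_holomorphic_at (\<lambda>_. c) z"
  unfolding scalar_holomorphic_at_def by (rule exI[of _ "\<lambda>_. 0"]) simp

lemma scalar_holomorphic_at_coordinate: "scalar_holomorphic_at (\<lambda>z. z $ i) z"
  unfolding scalar_holomorphic_at_def
  by (rule exI[of _ "\<lambda>h. h $ i"]) (auto intro: bounded_linear_imp_has_derivative bounded_linear_vec_nth)

lemma scalar_holomorphic_at_add:
  assumes "scalar_holomorphic_at f z" "scalar_holomorphic_at g z"
  shows "scalar_holomorphic_at (\<lambda>z. f z + g z) z"
proof -
  obtain A B where "(f has_derivative A) (at z)" "\<And>c h. A (c *s h) = c * A h"
    "(g has_derivative B) (at z)" "\<And>c h. B (c *s h) = c * B h"
    using assms unfolding scalar_holomorphic_at_def by blast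
  then show ?thesis unfolding scalar_holomorphic_at_def
    by (intro exI[of _ "\<lambda>h. A h + B h"]) (auto intro!: derivative_eq_intros simp: algebra_simps)
qed

lemma scalar_holomorphic_at_diff:
  assumes "scalar_holomorphic_at f z" "scalar_holomorphic_at g z"
  shows "scalar_holomorphic_at (\<lambda>z. f z - g z) z"
proof -
  obtain A B where "(f has_derivative A) (at z)" "\<And>c h. A (c *s h) = c * A h"
    "(g has_derivative B) (at z)" "\<And>c h. B (c *s h) = c * B h"
    using assms unfolding scalar_holomorphic_at_def by blast
  then show ?thesis unfolding scalar_holomorphic_at_def
    by (intro exI[of _ "\<lambda>h. A h - B h"]) (auto intro!: derivative_eq_intros simp: algebra_simps)
qed

lemma scalar_holomorphic_at_mult:
  assumes "scalar_holomorphic_at f z" "scalar_holomorphic_at g z"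
  shows "scalar_holomorphic_at (\<lambda>z. f z * g z) z"
proof -
  obtain A B where "(f has_derivative A) (at z)" "\<And>c h. A (c *s h) = c * A h"
    "(g has_derivative B) (at z)" "\<And>c h. B (c *s h) = c * B h"
    using assms unfolding scalar_holomorphic_at_def by blast
  then show ?thesis unfolding scalar_holomorphic_at_def
    by (intro exI[of _ "\<lambda>h. f z * B h + A h * g z"]) (auto intro!: derivative_eq_intros simp: algebra_simps)
qed

lemma scalar_holomorphic_at_compose:
  assumes "scalar_holomorphic_at g z" "(f has_field_derivative f') (at (g z))"
  shows "scalar_holomorphic_at (\<lambda>z. f (g z)) z"
proof -
  obtain A where "(g has_derivative A) (at z)" "\<And>c h. A (c *s h) = c * A h"
    using assms unfolding scalar_holomorphic_at_def by blast
  then show ?thesis unfolding scalar_holomorphic_at_def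
    using has_derivative_compose[of g A z UNIV f "(*) f'"] assms(2)
    by (intro exI[of _ "\<lambda>h. f' * A h"]) (auto simp: has_field_derivative_def)
qed

lemma scalar_holomorphic_at_divide:
  assumes "scalar_holomorphic_at f z" "scalar_holomorphic_at g z" "g z \<noteq> 0"
  shows "scalar_holomorphic_at (\<lambda>z. f z / g z) z"
proof -
  have "(inverse has_field_derivative - (inverse (g z) ^ Suc (Suc 0))) (at (g z))"
    using assms(3) by (rule DERIV_inverse)
  from scalar_holomorphic_at_mult[OF assms(1) scalar_holomorphic_at_compose[OF assms(2) this]]
  show ?thesis by (simp add: field_class.field_divide_inverse)
qed

lemmas scalar_holomorphic_intros = scalar_holomorphic_at_const scalar_holomorphic_at_coordinate
  scalar_holomorphic_at_add scalar_holomorphic_at_diff scalar_holomorphic_at_mult scalar_holomorphic_at_divide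

lemma scalar_holomorphic_at_imp_isCont: "scalar_holomorphic_at f z \<Longrightarrow> isCont f z"
  unfolding scalar_holomorphic_at_def using has_derivative_continuous by blast

lemma has_derivative_vec:
  fixes F :: "complex ^ 'n::finite \<Rightarrow> complex ^ 'm::finite"
  assumes "\<And>j. ((\<lambda>z. F z $ j) has_derivative (\<lambda>h. D h $ j)) (at z)"
  shows "(F has_derivative D) (at z)"
proof (subst has_derivative_componentwise_within, intro ballI)
  fix b :: "complex ^ 'm" assume "b \<in> Basis"
  then obtain j c where b: "b = axis j c" by (auto simp: Basis_vec_def)
  have "((\<lambda>x. F x $ j \<bullet> c) has_derivative (\<lambda>x. D x $ j \<bullet> c)) (at z)"
    by (rule has_derivative_inner_left[OF assms])
  then show "((\<lambda>x. F x \<bullet> b) has_derivative (\<lambda>x. D x \<bullet> b)) (at z)"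
    by (simp add: b inner_axis)
qed

lemma vec_has_matrix_derivative:
  fixes F :: "complex ^ 'n::finite \<Rightarrow> complex ^ 'm::finite"
  assumes "\<And>j. scalar_holomorphic_at (\<lambda>z. F z $ j) z"
  shows "\<exists>J :: complex ^ 'n ^ 'm. (F has_derivative (*v) J) (at z)"
proof -
  have "\<exists>D. \<forall>j. ((\<lambda>z. F z $ j) has_derivative D j) (at z) \<and> (\<forall>c h. D j (c *s h) = c * D j h)"
    using assms unfolding scalar_holomorphic_at_def by (intro choice) blast
  then obtain D where D: "\<And>j. ((\<lambda>z. F z $ j) has_derivative D j) (at z)" "\<And>j c h. D j (c *s h) = c * D j h"
    by blast
  define J :: "complex ^ 'n ^ 'm" where "J = (\<chi> j k. D j (axis k 1))"
  have "D j h = (J *v h) $ j" for j h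
  proof -
    have "D j h = D j (\<Sum>k\<in>UNIV. (h $ k) *s axis k 1)" by (simp add: basis_expansion)
    also have "\<dots> = (\<Sum>k\<in>UNIV. D j ((h $ k) *s axis k 1))"
      using has_derivative_linear[OF D(1)] by (rule linear_sum)
    finally show ?thesis by (simp add: J_def matrix_vector_mult_def D(2) mult.commute)
  qed
  then have "((\<lambda>z. F z $ j) has_derivative (\<lambda>h. (J *v h) $ j)) (at z)" for j
    using D(1)[of j] by (metis (no_types, lifting) ext)
  then show ?thesis by (intro exI[of _ J] has_derivative_vec)
qed

lemma gaussian_lattice_iff: "z \<in> gaussian_lattice \<longleftrightarrow> z $ 1 \<in> gaussian_ints \<and> z $ 2 \<in> gaussian_ints"
  by (auto simp: gaussian_lattice_def gaussian_ints_def forall_2)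

lemma gaussian_lattice_closed:
  "0 \<in> gaussian_lattice"
  "x \<in> gaussian_lattice \<Longrightarrow> y \<in> gaussian_lattice \<Longrightarrow> x + y \<in> gaussian_lattice"
  "x \<in> gaussian_lattice \<Longrightarrow> y \<in> gaussian_lattice \<Longrightarrow> x - y \<in> gaussian_lattice"
  "x \<in> gaussian_lattice \<Longrightarrow> - x \<in> gaussian_lattice"
  by (simp_all add: gaussian_lattice_iff gaussian_ints_closed)

text \<open>
  The standard real basis of \<open>complex ^ 2\<close> is a basis of the lattice.
\<close>

lemma is_lattice_gaussian: "is_lattice gaussian_lattice"
  unfolding is_lattice_def
proof (intro exI conjI)
  show "independent (Basis :: (complex ^ 2) set)" by (rule independent_Basis)
  show "span (Basis :: (complex ^ 2) set) = UNIV" by (rule span_Basis)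
  have comp: "(\<Sum>b\<in>Basis. of_int (c b) *\<^sub>R b) $ j = of_int (c (axis j 1)) + of_int (c (axis j \<i>)) * \<i>"
    for c :: "complex ^ 2 \<Rightarrow> int" and j :: 2
  proof -
    have "(\<Sum>b\<in>Basis. of_int (c b) *\<^sub>R b) = (\<Sum>k\<in>UNIV. \<Sum>u\<in>{1, \<i>}. of_int (c (axis k u)) *\<^sub>R axis k u)"
      unfolding Basis_vec_def Basis_complex_def
      by (subst sum.UNION_disjoint) (auto simp: axis_eq_axis sum.UNION_disjoint intro!: sum.cong)
    then show ?thesis
      by (simp add: axis_def sum.distrib if_distrib[of "\<lambda>x. _ *\<^sub>R x"] sum.delta complex_eq_iff cong: if_cong)
  qed
  show "gaussian_lattice = range (\<lambda>c :: complex ^ 2 \<Rightarrow> int. \<Sum>b\<in>Basis. of_int (c b) *\<^sub>R b)"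
  proof (intro equalityI subsetI)
    fix z assume "z \<in> gaussian_lattice"
    then obtain a b where ab: "\<And>j. z $ j = of_int (a j) + of_int (b j) * \<i>"
      unfolding gaussian_lattice_def by (simp, metis)
    define c :: "complex ^ 2 \<Rightarrow> int" where "c = (\<lambda>v. \<Sum>j\<in>UNIV. if v = axis j 1 then a j else if v = axis j \<i> then b j else 0)"
    have "c (axis j 1) = a j" "c (axis j \<i>) = b j" for j
      by (simp_all add: c_def axis_eq_axis sum.delta cong: if_cong)
    then have "z = (\<Sum>b\<in>Basis. of_int (c b) *\<^sub>R b)"
      unfolding vec_eq_iff comp by (simp add: ab)
    then show "z \<in> range (\<lambda>c :: complex ^ 2 \<Rightarrow> int. \<Sum>b\<in>Basis. of_int (c b) *\<^sub>R b)" by blast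
  next
    fix z assume "z \<in> range (\<lambda>c :: complex ^ 2 \<Rightarrow> int. \<Sum>b\<in>Basis. of_int (c b) *\<^sub>R b)"
    then obtain c :: "complex ^ 2 \<Rightarrow> int" where "z = (\<Sum>b\<in>Basis. of_int (c b) *\<^sub>R b)" by blast
    then have "z $ j = of_int (c (axis j 1)) + of_int (c (axis j \<i>)) * \<i>" for j
      unfolding comp[symmetric] by simp
    then show "z \<in> gaussian_lattice" unfolding gaussian_lattice_def by blast
  qed
qed

abbreviation torus_pt :: "complex ^ 2 \<Rightarrow> (complex ^ 2) set" where
  "torus_pt \<equiv> torus_proj gaussian_lattice"

lemma torus_pt_eq_iff: "torus_pt z = torus_pt w \<longleftrightarrow> z - w \<in> gaussian_lattice"
proof
  assume "torus_pt z = torus_pt w"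
  moreover have "z \<in> torus_pt z" using gaussian_lattice_closed(1) by (force simp: torus_proj_def)
  ultimately have "z \<in> torus_pt w" by simp
  then show "z - w \<in> gaussian_lattice" by (auto simp: torus_proj_def)
next
  assume *: "z - w \<in> gaussian_lattice"
  have sub: "torus_pt z \<subseteq> torus_pt w" if "z - w \<in> gaussian_lattice" for z w
  proof
    fix x assume "x \<in> torus_pt z"
    then obtain l where "l \<in> gaussian_lattice" "x = z + l" by (auto simp: torus_proj_def)
    then have "x = w + (z - w + l)" "z - w + l \<in> gaussian_lattice"
      using that gaussian_lattice_closed by auto
    then show "x \<in> torus_pt w" unfolding torus_proj_def by blast
  qed
  show "torus_pt z = torus_pt w"
    using sub[OF *] sub[of w z] gaussian_lattice_closed(4)[OF *] by auto
qed

lemma mem_torus_pt_iff: "w \<in> torus_pt z \<longleftrightarrow> torus_pt w = torus_pt z"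
proof -
  have "w \<in> torus_pt z \<longleftrightarrow> w - z \<in> gaussian_lattice"
    by (auto simp: torus_proj_def image_iff intro!: bexI[of _ "w - z"])
  then show ?thesis by (simp add: torus_pt_eq_iff)
qed

lemma points_torus: "points (torus \<Lambda>) = range (torus_proj \<Lambda>)"
  by (simp add: torus_def)

text \<open>
  The charts of the torus are local inverses of the projection, so that coordinate expressions of a
  map are those of its lift.
\<close>

lemma holomorphic_map_from_torus:
  fixes N :: "('b, 'd::finite) complex_manifold" and \<Lambda> :: "(complex ^ 'k::finite) set"
  assumes F: "\<And>z. f (torus_proj \<Lambda> z) = F z" and range: "range F \<subseteq> points N"
    and charts: "\<And>V \<psi>. (V, \<psi>) \<in> charts N \<Longrightarrow> open (F -` V) \<and> holomorphic_vec_on (\<psi> \<circ> F) (F -` V)"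
  shows "holomorphic_map (torus \<Lambda>) N f"
  unfolding holomorphic_map_def
proof (intro conjI ballI, goal_cases)
  case 1
  show ?case using range F by (auto simp: torus_def)
next
  case (2 c)
  then obtain W where c: "c = (torus_proj \<Lambda> ` W, inv_into W (torus_proj \<Lambda>))" and W: "open W" "inj_on (torus_proj \<Lambda>) W"
    by (auto simp: torus_def)
  let ?\<phi> = "inv_into W (torus_proj \<Lambda>)"
  have inv: "?\<phi> (torus_proj \<Lambda> w) = w" if "w \<in> W" for w using W that by simp
  have inv2: "inv_into (torus_proj \<Lambda> ` W) ?\<phi> w = torus_proj \<Lambda> w" if "w \<in> W" for w
  proof -
    have "inj_on ?\<phi> (torus_proj \<Lambda> ` W)" by (rule inj_on_inv_into) simp
    from inv_into_f_f[OF this, of "torus_proj \<Lambda> w"] show ?thesis using inv that by simp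
  qed
  show ?case unfolding c prod.case
  proof (intro ballI, clarify)
    fix V \<psi> assume V: "(V, \<psi>) \<in> charts N"
    have dom: "?\<phi> ` (torus_proj \<Lambda> ` W \<inter> f -` V) = W \<inter> F -` V"
      using inv by (force simp: F image_iff)
    have op: "open (W \<inter> F -` V)" using charts[OF V] W by auto
    have "holomorphic_vec_on (\<psi> \<circ> f \<circ> inv_into (torus_proj \<Lambda> ` W) ?\<phi>) (W \<inter> F -` V)"
      unfolding holomorphic_vec_on_def
    proof
      fix z assume z: "z \<in> W \<inter> F -` V"
      then obtain J where "(\<psi> \<circ> F has_derivative (*v) J) (at z)"
        using charts[OF V] by (auto simp: holomorphic_vec_on_def)
      then have "(\<psi> \<circ> f \<circ> inv_into (torus_proj \<Lambda> ` W) ?\<phi> has_derivative (*v) J) (at z)"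
        by (rule has_derivative_transform_within_open[OF _ op z]) (simp add: inv2 F)
      then show "\<exists>J. (\<psi> \<circ> f \<circ> inv_into (torus_proj \<Lambda> ` W) ?\<phi> has_derivative (*v) J) (at z)" ..
    qed
    then show "open (?\<phi> ` (torus_proj \<Lambda> ` W \<inter> f -` V)) \<and>
        holomorphic_vec_on (\<psi> \<circ> f \<circ> inv_into (torus_proj \<Lambda> ` W) ?\<phi>) (?\<phi> ` (torus_proj \<Lambda> ` W \<inter> f -` V))"
      using op unfolding dom by blast
  qed
qed

text \<open>
  The condition for \<open>h\<close> to descend to the torus.
\<close>

definition lattice_compatible :: "(complex ^ 2 \<Rightarrow> complex ^ 2) \<Rightarrow> bool" where
  "lattice_compatible h \<longleftrightarrow> (\<forall>z w. z - w \<in> gaussian_lattice \<longrightarrow> h z - h w \<in> gaussian_lattice)"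

lemma torus_induced_pt:
  assumes "lattice_compatible h"
  shows "torus_induced gaussian_lattice h (torus_pt z) = torus_pt (h z)"
proof -
  have "torus_pt (h w) = torus_pt (h z)" if "w \<in> torus_pt z" for w
    using that assms by (auto simp: mem_torus_pt_iff torus_pt_eq_iff lattice_compatible_def)
  moreover have "z \<in> torus_pt z" by (simp add: mem_torus_pt_iff)
  ultimately have "(\<Union>w\<in>torus_pt z. torus_pt (h w)) = torus_pt (h z)" by blast
  then show ?thesis by (simp add: torus_induced_def points_torus)
qed

text \<open>
  Where \<open>h\<close> takes values in a given translate of a chart domain, the coordinate expression differs from
  \<open>h\<close> by a constant lattice vector.
\<close>

lemma holomorphic_torus_induced:
  assumes h: "lattice_compatible h" "\<And>z. (h has_derivative (*v) M) (at z)"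
  shows "holomorphic_map (torus gaussian_lattice) (torus gaussian_lattice) (torus_induced gaussian_lattice h)"
proof (rule holomorphic_map_from_torus[where F = "\<lambda>z. torus_pt (h z)"])
  show "torus_induced gaussian_lattice h (torus_pt z) = torus_pt (h z)" for z
    by (rule torus_induced_pt[OF h(1)])
  show "range (\<lambda>z. torus_pt (h z)) \<subseteq> points (torus gaussian_lattice)" by (auto simp: points_torus)
  fix V \<psi> assume "(V, \<psi>) \<in> charts (torus gaussian_lattice)"
  then obtain W where V: "V = torus_pt ` W" "\<psi> = inv_into W torus_pt" and W: "open W" "inj_on torus_pt W"
    by (auto simp: torus_def)
  have cont: "continuous_on UNIV h"
    using h(2) by (meson continuous_at_imp_continuous_on has_derivative_continuous)
  have pre: "(\<lambda>z. torus_pt (h z)) -` V = (\<Union>l\<in>gaussian_lattice. h -` ((+) l ` W))"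
    by (force simp: V torus_pt_eq_iff image_iff)
  have "open ((\<lambda>z. torus_pt (h z)) -` V)"
    unfolding pre using cont W by (intro open_UN ballI open_vimage open_translation) auto
  moreover have "holomorphic_vec_on (\<psi> \<circ> (\<lambda>z. torus_pt (h z))) ((\<lambda>z. torus_pt (h z)) -` V)"
    unfolding holomorphic_vec_on_def
  proof
    fix z assume "z \<in> (\<lambda>z. torus_pt (h z)) -` V"
    then obtain l where l: "l \<in> gaussian_lattice" "z \<in> h -` ((+) l ` W)" unfolding pre by blast
    have "((\<lambda>z. h z - l) has_derivative (*v) M) (at z)"
      using h(2) by (auto intro!: derivative_eq_intros)
    moreover have "open (h -` ((+) l ` W))" using cont W by (intro open_vimage open_translation) auto
    moreover note l(2)
    moreover have "h y - l = (\<psi> \<circ> (\<lambda>z. torus_pt (h z))) y" if "y \<in> h -` ((+) l ` W)" for y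
    proof -
      from that obtain w where w: "w \<in> W" "h y = l + w" by auto
      then have "torus_pt (h y) = torus_pt w" using l by (simp add: torus_pt_eq_iff)
      then show ?thesis using w W by (simp add: V)
    qed
    ultimately have "(\<psi> \<circ> (\<lambda>z. torus_pt (h z)) has_derivative (*v) M) (at z)"
      by (rule has_derivative_transform_within_open)
    then show "\<exists>J. (\<psi> \<circ> (\<lambda>z. torus_pt (h z)) has_derivative (*v) J) (at z)" ..
  qed
  ultimately show "open ((\<lambda>z. torus_pt (h z)) -` V) \<and>
      holomorphic_vec_on (\<psi> \<circ> (\<lambda>z. torus_pt (h z))) ((\<lambda>z. torus_pt (h z)) -` V)" ..
qed

section \<open>Holomorphic maps of projective space and homogeneous polynomials\<close>

lemma proj_rel_refl: "v \<noteq> 0 \<Longrightarrow> proj_rel v v"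
  by (auto simp: proj_rel_def intro!: exI[of _ 1])

lemma coord_nonzero_pt: "v \<noteq> 0 \<Longrightarrow> coord_nonzero i (proj_pt v) \<longleftrightarrow> v $ i \<noteq> 0"
  by (rule coord_nonzero.abs_eq[OF proj_rel_refl])

lemma affine_chart_pt: "v \<noteq> 0 \<Longrightarrow> affine_chart i e (proj_pt v) = (\<chi> j. v $ e j / v $ i)"
  by (rule affine_chart.abs_eq[OF proj_rel_refl])

lemma holomorphic_torus_to_projective:
  fixes S :: "complex ^ 'l::finite \<Rightarrow> complex ^ 'n::finite"
  assumes f: "\<And>z. f (torus_proj \<Lambda> z) = proj_pt (S z)" and S: "\<And>z. S z \<noteq> 0"
    "\<And>z j. scalar_holomorphic_at (\<lambda>z. S z $ j) z"
  shows "holomorphic_map (torus \<Lambda>) (projective_space :: ('n proj, 'k::finite) complex_manifold) f"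
proof (rule holomorphic_map_from_torus[where F = "\<lambda>z. proj_pt (S z)"])
  show "f (torus_proj \<Lambda> z) = proj_pt (S z)" for z by (rule f)
  show "range (\<lambda>z. proj_pt (S z)) \<subseteq> points (projective_space :: ('n proj, 'k) complex_manifold)"
    by (simp add: projective_space_def)
  fix V :: "'n proj set" and \<psi> :: "'n proj \<Rightarrow> complex ^ 'k"
  assume "(V, \<psi>) \<in> charts projective_space"
  then obtain i and e :: "'k \<Rightarrow> 'n" where V: "V = {p. coord_nonzero i p}" "\<psi> = affine_chart i e"
    by (auto simp: projective_space_def)
  have pre: "(\<lambda>z. proj_pt (S z)) -` V = {z. S z $ i \<noteq> 0}"
    using S by (auto simp: V coord_nonzero_pt)
  have "continuous_on UNIV (\<lambda>z. S z $ i)"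
    using scalar_holomorphic_at_imp_isCont[OF S(2)] by (simp add: continuous_at_imp_continuous_on)
  then have "open {z. S z $ i \<noteq> 0}" by (intro open_Collect_neq continuous_on_const)
  moreover have "holomorphic_vec_on (\<psi> \<circ> (\<lambda>z. proj_pt (S z))) {z. S z $ i \<noteq> 0}"
    unfolding holomorphic_vec_on_def
  proof
    fix z assume z: "z \<in> {z. S z $ i \<noteq> 0}"
    have "\<psi> \<circ> (\<lambda>z. proj_pt (S z)) = (\<lambda>z. \<chi> j. S z $ e j / S z $ i)"
      using S by (simp add: V fun_eq_iff affine_chart_pt)
    then show "\<exists>J. (\<psi> \<circ> (\<lambda>z. proj_pt (S z)) has_derivative (*v) J) (at z)"
      using z S(2) by (auto intro!: vec_has_matrix_derivative scalar_holomorphic_intros)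
  qed
  ultimately show "open ((\<lambda>z. proj_pt (S z)) -` V) \<and>
      holomorphic_vec_on (\<psi> \<circ> (\<lambda>z. proj_pt (S z))) ((\<lambda>z. proj_pt (S z)) -` V)"
    unfolding pre ..
qed

definition chart_index :: "'n::finite \<Rightarrow> ('k::finite \<Rightarrow> 'n) \<Rightarrow> bool" where
  "chart_index i e \<longleftrightarrow> bij_betw e UNIV (UNIV - {i})"

text \<open>\<open>c = 1\<close> gives the inverse of the affine chart, \<open>c = 0\<close> its linear part.\<close>

definition affine_section :: "complex \<Rightarrow> 'n::finite \<Rightarrow> ('k::finite \<Rightarrow> 'n) \<Rightarrow> complex ^ 'k \<Rightarrow> complex ^ 'n" where
  "affine_section c i e w = (\<chi> m. if m = i then c else w $ inv_into UNIV e m)"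

lemma affine_section_nth:
  assumes "chart_index i e"
  shows "affine_section c i e w $ i = c" "affine_section c i e w $ e j = w $ j"
  using assms by (auto simp: affine_section_def chart_index_def bij_betw_def)

lemma chart_index_cases:
  assumes "chart_index i e"
  obtains "m = i" | j where "m = e j"
  using assms unfolding chart_index_def bij_betw_def by blast

lemma affine_section_eqI:
  assumes "chart_index i e" "v $ i = c" "\<And>j. v $ e j = w $ j"
  shows "affine_section c i e w = v"
  unfolding vec_eq_iff
proof
  fix m show "affine_section c i e w $ m = v $ m"
    by (rule chart_index_cases[OF assms(1), of m]) (use assms in \<open>auto simp: affine_section_nth\<close>)
qed

lemma affine_section_nonzero: "chart_index i e \<Longrightarrow> affine_section 1 i e w \<noteq> 0"
  using affine_section_nth(1)[of i e 1 w] by auto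

lemma affine_section_add: "affine_section c i e w + affine_section 0 i e h = affine_section c i e (w + h)"
  by (simp add: affine_section_def vec_eq_iff)

lemma affine_chart_section: "chart_index i e \<Longrightarrow> affine_chart i e (proj_pt (affine_section 1 i e w)) = w"
  using affine_section_nth[of i e 1 w] affine_section_nonzero[of i e w]
  by (simp add: affine_chart_pt vec_lambda_eta)

lemma affine_section_chart:
  assumes "chart_index i e" "coord_nonzero i p"
  shows "proj_pt (affine_section 1 i e (affine_chart i e p)) = p"
proof -
  obtain v where v: "v \<noteq> 0" "p = proj_pt v" by (rule proj_pt_cases)
  then have vi: "v $ i \<noteq> 0" using assms by (simp add: coord_nonzero_pt)
  have "affine_section 1 i e (affine_chart i e p) = (1 / v $ i) *s v"
    using assms(1) v vi by (intro affine_section_eqI) (auto simp: affine_chart_pt)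
  then show ?thesis
    using v vi affine_section_nonzero[OF assms(1)] by (auto simp: proj_pt_eq_iff intro!: exI[of _ "v $ i"])
qed

lemma inv_affine_chart:
  assumes e: "chart_index i e"
  shows "inv_into {p. coord_nonzero i p} (affine_chart i e) w = proj_pt (affine_section 1 i e w)"
proof -
  have "inj_on (affine_chart i e) {p. coord_nonzero i p}"
    by (rule inj_on_inverseI[where g = "\<lambda>w. proj_pt (affine_section 1 i e w)"])
      (simp add: affine_section_chart[OF e])
  moreover have "coord_nonzero i (proj_pt (affine_section 1 i e w))"
    using e by (simp add: coord_nonzero_pt affine_section_nonzero affine_section_nth)
  ultimately show ?thesis
    using inv_into_f_f[of "affine_chart i e" "{p. coord_nonzero i p}" "proj_pt (affine_section 1 i e w)"]
    by (simp add: affine_chart_section[OF e])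
qed

lemma charts_projective_space:
  "charts projective_space = {({p. coord_nonzero i p}, affine_chart i e) | i e. chart_index i e}"
  by (simp add: projective_space_def chart_index_def)

lemma chart_index_exists:
  fixes i :: "'n::finite"
  assumes "CARD('n) = CARD('k) + 1"
  shows "\<exists>e :: 'k::finite \<Rightarrow> 'n. chart_index i e"
proof -
  have "card (UNIV :: 'k set) = card (UNIV - {i})" using assms by simp
  then show ?thesis unfolding chart_index_def by (intro finite_same_card_bij) auto
qed

definition lifts_to :: "('n::finite proj \<Rightarrow> 'n proj) \<Rightarrow> (complex ^ 'n \<Rightarrow> complex ^ 'n) \<Rightarrow> bool" where
  "lifts_to f F \<longleftrightarrow> (\<forall>v. v \<noteq> 0 \<longrightarrow> F v \<noteq> 0 \<and> f (proj_pt v) = proj_pt (F v))"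

lemma lifts_toD:
  assumes "lifts_to f F" "v \<noteq> 0"
  shows "F v \<noteq> 0" "f (proj_pt v) = proj_pt (F v)"
  using assms by (auto simp: lifts_to_def)

lemma chart_expression:
  fixes F :: "complex ^ 'n::finite \<Rightarrow> complex ^ 'n"
  assumes f: "lifts_to f F" and e: "chart_index i e"
  shows "affine_chart i' e' \<circ> f \<circ> inv_into {p. coord_nonzero i p} (affine_chart i e) =
    (\<lambda>w. \<chi> j. F (affine_section 1 i e w) $ e' j / F (affine_section 1 i e w) $ i')"
  using lifts_toD[OF f affine_section_nonzero[OF e]]
  by (simp add: fun_eq_iff inv_affine_chart[OF e] affine_chart_pt)

lemma scalar_holomorphic_at_section:
  assumes e: "chart_index i e" and g: "scalar_holomorphic_at g (affine_section c i e w)"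
  shows "scalar_holomorphic_at (\<lambda>w. g (affine_section c i e w)) w"
proof -
  have "scalar_holomorphic_at (\<lambda>w. affine_section c i e w $ m) w" for m
    by (cases "m = i") (simp_all add: affine_section_def scalar_holomorphic_intros)
  then obtain J where J: "(affine_section c i e has_derivative (*v) J) (at w)"
    using vec_has_matrix_derivative by blast
  obtain A where A: "(g has_derivative A) (at (affine_section c i e w))" "\<And>c h. A (c *s h) = c * A h"
    using g unfolding scalar_holomorphic_at_def by blast
  show ?thesis unfolding scalar_holomorphic_at_def
    by (rule exI[of _ "\<lambda>h. A (J *v h)"])
      (use has_derivative_compose[OF J A(1)] in \<open>auto simp: vector_scalar_commute A(2)\<close>)
qed

lemma holomorphic_projective_self_map:
  fixes F :: "complex ^ 'n::finite \<Rightarrow> complex ^ 'n"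
  assumes f: "lifts_to f F" and F: "\<And>v j. scalar_holomorphic_at (\<lambda>v. F v $ j) v"
  defines "P \<equiv> (projective_space :: ('n proj, 'k::finite) complex_manifold)"
  shows "holomorphic_map P P f"
  unfolding holomorphic_map_def
proof (intro conjI ballI, goal_cases)
  case 1 then show ?case by (simp add: P_def projective_space_def)
next
  case (2 c)
  then obtain i e where c: "c = ({p. coord_nonzero i p}, affine_chart i e)" and e: "chart_index i e"
    by (auto simp: P_def charts_projective_space)
  let ?U = "{p. coord_nonzero i p}" and ?s = "affine_section 1 i e"
  show ?case unfolding c prod.case
  proof (intro ballI, clarify)
    fix V \<psi> assume "(V, \<psi>) \<in> charts P"
    then obtain i' e' where V: "V = {p. coord_nonzero i' p}" "\<psi> = affine_chart i' e'"
      by (auto simp: P_def charts_projective_space)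
    have dom: "affine_chart i e ` (?U \<inter> f -` V) = {w. F (?s w) $ i' \<noteq> 0}"
    proof (intro equalityI subsetI)
      fix w assume "w \<in> affine_chart i e ` (?U \<inter> f -` V)"
      then obtain p where p: "w = affine_chart i e p" "coord_nonzero i p" "coord_nonzero i' (f p)"
        by (auto simp: V)
      then have "p = proj_pt (?s w)" using affine_section_chart[OF e] by simp
      then show "w \<in> {w. F (?s w) $ i' \<noteq> 0}"
        using p(3) lifts_toD[OF f affine_section_nonzero[OF e, of w]] by (simp add: coord_nonzero_pt)
    next
      fix w assume "w \<in> {w. F (?s w) $ i' \<noteq> 0}"
      then have "proj_pt (?s w) \<in> ?U \<inter> f -` V"
        using lifts_toD[OF f affine_section_nonzero[OF e, of w]] e
        by (simp add: V coord_nonzero_pt affine_section_nonzero affine_section_nth)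
      then show "w \<in> affine_chart i e ` (?U \<inter> f -` V)"
        by (rule rev_image_eqI) (simp add: affine_chart_section[OF e])
    qed
    note hol = scalar_holomorphic_at_section[OF e F]
    have "continuous_on UNIV (\<lambda>w. F (?s w) $ i')"
      using scalar_holomorphic_at_imp_isCont[OF hol] by (simp add: continuous_at_imp_continuous_on)
    then have "open {w. F (?s w) $ i' \<noteq> 0}" by (intro open_Collect_neq continuous_on_const)
    moreover have "holomorphic_vec_on (\<psi> \<circ> f \<circ> inv_into ?U (affine_chart i e)) {w. F (?s w) $ i' \<noteq> 0}"
      unfolding holomorphic_vec_on_def V chart_expression[OF f e]
      by (auto intro!: vec_has_matrix_derivative scalar_holomorphic_at_divide hol)
    ultimately show "open (affine_chart i e ` (?U \<inter> f -` V)) \<and>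
        holomorphic_vec_on (\<psi> \<circ> f \<circ> inv_into ?U (affine_chart i e)) (affine_chart i e ` (?U \<inter> f -` V))"
      unfolding dom ..
  qed
qed

lemma finite_multidegrees: "finite {m :: 'n::finite \<Rightarrow> nat. (\<Sum>i\<in>UNIV. m i) = d}"
proof (rule finite_subset)
  show "{m :: 'n \<Rightarrow> nat. (\<Sum>i\<in>UNIV. m i) = d} \<subseteq> PiE UNIV (\<lambda>_. {..d})"
    by (auto intro: member_le_sum)
  show "finite (PiE (UNIV :: 'n set) (\<lambda>_. {..d}))" by (rule finite_PiE) auto
qed

lemma homogeneous_poly_mult:
  fixes P Q :: "complex ^ 'n::finite \<Rightarrow> complex"
  assumes "homogeneous_poly d P" "homogeneous_poly e Q"
  shows "homogeneous_poly (d + e) (\<lambda>z. P z * Q z)"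
proof -
  define S where "S = (\<lambda>d. {m :: 'n \<Rightarrow> nat. (\<Sum>i\<in>UNIV. m i) = d})"
  define X where "X = (\<lambda>(m :: 'n \<Rightarrow> nat) (z :: complex ^ 'n). \<Prod>i\<in>UNIV. z $ i ^ m i)"
  obtain a b where P: "P = (\<lambda>z. \<Sum>m\<in>S d. a m * X m z)" and Q: "Q = (\<lambda>z. \<Sum>m\<in>S e. b m * X m z)"
    using assms unfolding homogeneous_poly_def S_def X_def by blast
  define add where "add = (\<lambda>(m, m'). (\<lambda>i :: 'n. m i + m' i :: nat))"
  define c where "c = (\<lambda>M. \<Sum>p\<in>{p \<in> S d \<times> S e. add p = M}. a (fst p) * b (snd p))"
  have fin: "finite (S d)" for d unfolding S_def by (rule finite_multidegrees)
  have "P z * Q z = (\<Sum>M\<in>S (d + e). c M * X M z)" for z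
  proof -
    have "P z * Q z = (\<Sum>p\<in>S d \<times> S e. a (fst p) * b (snd p) * X (add p) z)"
      unfolding P Q sum_product sum.cartesian_product
      by (rule sum.cong) (auto simp: X_def add_def power_add prod.distrib)
    also have "\<dots> = (\<Sum>M\<in>S (d + e). \<Sum>p\<in>{p \<in> S d \<times> S e. add p = M}. a (fst p) * b (snd p) * X (add p) z)"
      by (rule sum.group[symmetric]) (use fin in \<open>auto simp: S_def add_def sum.distrib\<close>)
    also have "\<dots> = (\<Sum>M\<in>S (d + e). c M * X M z)"
      unfolding c_def sum_distrib_right by (intro sum.cong) auto
    finally show ?thesis .
  qed
  then show ?thesis unfolding homogeneous_poly_def S_def X_def by blast
qed

lemma homogeneous_poly_add:
  assumes "homogeneous_poly d P" "homogeneous_poly d Q"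
  shows "homogeneous_poly d (\<lambda>z. P z + Q z)"
proof -
  obtain a b where "P = (\<lambda>z. \<Sum>m | (\<Sum>i\<in>UNIV. m i) = d. a m * (\<Prod>i\<in>UNIV. z $ i ^ m i))"
    "Q = (\<lambda>z. \<Sum>m | (\<Sum>i\<in>UNIV. m i) = d. b m * (\<Prod>i\<in>UNIV. z $ i ^ m i))"
    using assms unfolding homogeneous_poly_def by blast
  then show ?thesis unfolding homogeneous_poly_def
    by (intro exI[of _ "\<lambda>m. a m + b m"]) (simp add: sum.distrib distrib_right)
qed

lemma homogeneous_poly_minus:
  assumes "homogeneous_poly d P"
  shows "homogeneous_poly d (\<lambda>z. - P z)"
proof -
  obtain a where "P = (\<lambda>z. \<Sum>m | (\<Sum>i\<in>UNIV. m i) = d. a m * (\<Prod>i\<in>UNIV. z $ i ^ m i))"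
    using assms unfolding homogeneous_poly_def by blast
  then show ?thesis unfolding homogeneous_poly_def
    by (intro exI[of _ "\<lambda>m. - a m"]) (simp add: sum_negf)
qed

lemma homogeneous_poly_diff:
  "homogeneous_poly d P \<Longrightarrow> homogeneous_poly d Q \<Longrightarrow> homogeneous_poly d (\<lambda>z. P z - Q z)"
  using homogeneous_poly_add[OF _ homogeneous_poly_minus, of d P Q] by simp

lemma homogeneous_poly_coordinate: "homogeneous_poly 1 (\<lambda>z :: complex ^ 'n::finite. z $ i)"
proof -
  define \<delta> where "\<delta> = (\<lambda>j :: 'n. if j = i then 1 else 0 :: nat)"
  have 1: "(\<Sum>j\<in>UNIV. \<delta> j) = 1" by (simp add: \<delta>_def)
  have 2: "(\<Prod>j\<in>UNIV. z $ j ^ \<delta> j) = z $ i" for z :: "complex ^ 'n"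
    by (simp add: \<delta>_def if_distrib[of "\<lambda>n. _ ^ n"] prod.delta cong: if_cong)
  have "(\<Sum>m | (\<Sum>j\<in>UNIV. m j) = 1. (if m = \<delta> then 1 else 0) * (\<Prod>j\<in>UNIV. z $ j ^ m j)) = z $ i"
    for z :: "complex ^ 'n"
    using finite_multidegrees[of 1]
    by (subst sum.mono_neutral_right[of _ "{\<delta>}"]) (auto simp: 1 2)
  then show ?thesis unfolding homogeneous_poly_def
    by (intro exI[of _ "\<lambda>m. if m = \<delta> then 1 else 0"]) simp
qed

section \<open>Squares of linear forms and their critical set\<close>

definition forms :: "complex ^ 3 \<Rightarrow> complex ^ 3" where
  "forms v = vector [- v$1 + v$2 + v$3, v$1 - v$2 + v$3, v$1 + v$2 - v$3]"

definition forms_inv :: "complex ^ 3 \<Rightarrow> complex ^ 3" where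
  "forms_inv x = vector [(x$2 + x$3) / 2, (x$1 + x$3) / 2, (x$1 + x$2) / 2]"

lemma forms_inverse: "forms (forms_inv x) = x" "forms_inv (forms v) = v"
  by (simp_all add: forms_def forms_inv_def vec_eq_iff forall_3 field_simps)

lemma forms_linear:
  "forms (v + w) = forms v + forms w" "forms (v - w) = forms v - forms w" "forms (c *s v) = c *s forms v"
  by (simp_all add: forms_def vec_eq_iff forall_3 algebra_simps)

lemma forms_eq_0_iff: "forms v = 0 \<longleftrightarrow> v = 0"
proof
  assume "forms v = 0"
  then have "v = forms_inv 0" using forms_inverse(2) by metis
  then show "v = 0" by (simp add: forms_inv_def vec_eq_iff forall_3)
qed (simp add: forms_def vec_eq_iff forall_3)

text \<open>
  The permutation \<open>p\<close> is the only difference between the three maps.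
\<close>

definition squared_forms :: "(3 \<Rightarrow> 3) \<Rightarrow> complex ^ 3 \<Rightarrow> complex ^ 3" where
  "squared_forms p v = (\<chi> k. (forms v $ p k)\<^sup>2)"

lemma squared_forms_nth [simp]: "squared_forms p v $ k = (forms v $ p k)\<^sup>2"
  by (simp add: squared_forms_def)

lemma squared_forms_nonzero:
  assumes "bij p" "v \<noteq> 0"
  shows "squared_forms p v \<noteq> 0"
proof
  assume "squared_forms p v = 0"
  then have "forms v $ p k = 0" for k
    using squared_forms_nth[of p v k] by simp
  then have "forms v $ m = 0" for m using assms(1) by (metis bij_pointE)
  then have "forms v = 0" by (simp add: vec_eq_iff)
  then show False using assms(2) forms_eq_0_iff by blast
qed

lemma lifts_to_f1: "lifts_to f1 (squared_forms id)"
  unfolding lifts_to_def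
proof (intro allI impI conjI)
  fix v :: "complex ^ 3" assume v: "v \<noteq> 0"
  show "squared_forms id v \<noteq> 0" using v by (intro squared_forms_nonzero) auto
  have "squared_forms id v = vector [(- v$1 + v$2 + v$3)\<^sup>2, (v$1 - v$2 + v$3)\<^sup>2, (v$1 + v$2 - v$3)\<^sup>2]"
    by (simp add: vec_eq_iff forall_3 forms_def)
  then show "f1 (proj_pt v) = proj_pt (squared_forms id v)"
    using f1.abs_eq[OF proj_rel_refl[OF v]] by simp
qed

definition swap12 :: "3 \<Rightarrow> 3" where "swap12 = id(1 := 2, 2 := 1)"
definition cycle312 :: "3 \<Rightarrow> 3" where "cycle312 = id(1 := 3, 2 := 1, 3 := 2)"

lemma swap12_simps [simp]: "swap12 1 = 2" "swap12 2 = 1" "swap12 3 = 3"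
  by (simp_all add: swap12_def)

lemma cycle312_simps [simp]: "cycle312 1 = 3" "cycle312 2 = 1" "cycle312 3 = 2"
  by (simp_all add: cycle312_def)

lemma bij_on_3: "bij p" if "p 1 \<noteq> p 2" "p 1 \<noteq> p 3" "p 2 \<noteq> p 3" for p :: "3 \<Rightarrow> 3"
proof -
  have "inj p" unfolding inj_def forall_3 using that by auto
  then show ?thesis by (simp add: bij_def finite_UNIV_inj_surj)
qed

lemma bij_swap12: "bij swap12" and bij_cycle312: "bij cycle312"
  by (rule bij_on_3; simp)+

lemma lifts_to_f2: "lifts_to f2 (squared_forms swap12)"
  unfolding lifts_to_def
proof (intro allI impI conjI)
  fix v :: "complex ^ 3" assume v: "v \<noteq> 0"
  show "squared_forms swap12 v \<noteq> 0" using v by (intro squared_forms_nonzero bij_swap12)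
  have "squared_forms swap12 v = vector [(v$1 - v$2 + v$3)\<^sup>2, (- v$1 + v$2 + v$3)\<^sup>2, (v$1 + v$2 - v$3)\<^sup>2]"
    by (simp add: vec_eq_iff forall_3 forms_def)
  then show "f2 (proj_pt v) = proj_pt (squared_forms swap12 v)"
    using f2.abs_eq[OF proj_rel_refl[OF v]] by simp
qed

lemma lifts_to_f3: "lifts_to f3 (squared_forms cycle312)"
  unfolding lifts_to_def
proof (intro allI impI conjI)
  fix v :: "complex ^ 3" assume v: "v \<noteq> 0"
  show "squared_forms cycle312 v \<noteq> 0" using v by (intro squared_forms_nonzero bij_cycle312)
  have "squared_forms cycle312 v = vector [(v$1 + v$2 - v$3)\<^sup>2, (- v$1 + v$2 + v$3)\<^sup>2, (v$1 - v$2 + v$3)\<^sup>2]"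
    by (simp add: vec_eq_iff forall_3 forms_def)
  then show "f3 (proj_pt v) = proj_pt (squared_forms cycle312 v)"
    using f3.abs_eq[OF proj_rel_refl[OF v]] by simp
qed

lemma scalar_holomorphic_forms: "scalar_holomorphic_at (\<lambda>v. forms v $ k) v"
proof -
  have "\<forall>k. scalar_holomorphic_at (\<lambda>v. forms v $ k) v"
    unfolding forall_3 forms_def vector_3
    by (intro conjI scalar_holomorphic_intros
        scalar_holomorphic_at_diff[OF scalar_holomorphic_at_const[of 0], simplified])
  then show ?thesis by blast
qed

lemma scalar_holomorphic_squared_forms: "scalar_holomorphic_at (\<lambda>v. squared_forms p v $ k) v"
  unfolding squared_forms_nth power2_eq_square
  by (intro scalar_holomorphic_at_mult scalar_holomorphic_forms)

lemma homogeneous_forms: "homogeneous_poly 1 (\<lambda>v. forms v $ k)"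
proof -
  have "\<forall>k. homogeneous_poly 1 (\<lambda>v. forms v $ k)"
    unfolding forall_3 forms_def vector_3
    by (intro conjI homogeneous_poly_add homogeneous_poly_diff homogeneous_poly_minus homogeneous_poly_coordinate)
  then show ?thesis by blast
qed

lemma has_degree_squared_forms:
  assumes "lifts_to f (squared_forms p)"
  shows "has_degree f 2"
  unfolding has_degree_def
proof (intro exI conjI allI)
  show "homogeneous_poly 2 (\<lambda>z. squared_forms p z $ i)" for i
    using homogeneous_poly_mult[OF homogeneous_forms homogeneous_forms, of "p i" "p i"]
    by (simp add: power2_eq_square numeral_2_eq_2)
qed (use assms in \<open>simp add: lifts_to_def\<close>)

lemma det_eq_0_iff_kernel:
  fixes J :: "complex ^ 'n ^ 'n::finite"
  shows "det J = 0 \<longleftrightarrow> (\<exists>x. x \<noteq> 0 \<and> J *v x = 0)"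
  using invertible_det_nz[of J] invertible_left_inverse[of J] matrix_left_invertible_ker[of J] by auto

lemma has_derivative_forms_section:
  assumes e: "chart_index i e"
  shows "((\<lambda>w. forms (affine_section 1 i e w) $ m) has_derivative
    (\<lambda>h. forms (affine_section 0 i e h) $ m)) (at w)"
proof -
  have "linear (\<lambda>h. forms (affine_section 0 i e h) $ m)"
  proof
    show "forms (affine_section 0 i e (x + y)) $ m = forms (affine_section 0 i e x) $ m + forms (affine_section 0 i e y) $ m" for x y
      by (simp flip: affine_section_add add: forms_linear)
    have "affine_section 0 i e (r *\<^sub>R x) = of_real r *s affine_section 0 i e x" for r x
      by (simp add: affine_section_def vec_eq_iff scaleR_conv_of_real[where 'a = complex])
    then show "forms (affine_section 0 i e (r *\<^sub>R x)) $ m = r *\<^sub>R forms (affine_section 0 i e x) $ m" for r x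
      by (simp add: forms_linear scaleR_conv_of_real)
  qed
  then have "bounded_linear (\<lambda>h. forms (affine_section 0 i e h) $ m)" by (simp add: linear_conv_bounded_linear)
  then have "((\<lambda>h. forms (affine_section 0 i e h) $ m) has_derivative (\<lambda>h. forms (affine_section 0 i e h) $ m)) (at w)"
    by (rule bounded_linear_imp_has_derivative)
  then have "((\<lambda>h. forms (affine_section 1 i e 0) $ m + forms (affine_section 0 i e h) $ m) has_derivative
      (\<lambda>h. forms (affine_section 0 i e h) $ m)) (at w)"
    by (auto intro!: derivative_eq_intros)
  moreover have "forms (affine_section 1 i e 0) $ m + forms (affine_section 0 i e h) $ m = forms (affine_section 1 i e h) $ m" for h
    using affine_section_add[of 1 i e 0 h] forms_linear(1)[of "affine_section 1 i e 0" "affine_section 0 i e h"] by simp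
  ultimately show ?thesis by simp
qed

text \<open>
  In homogeneous terms: a direction \<open>d\<close> at \<open>v\<close> is in the kernel if and only if there is a factor \<open>c\<close> such that
  every linear form \<open>l\<close> of the three satisfies \<open>l v = 0\<close> or \<open>l d = c * l v\<close>. If no form vanishes at \<open>v\<close>, then
  \<open>d = c *s v\<close>, because the forms are independent, and such a direction is zero in the chart. If one
  form vanishes at \<open>v\<close>, then the direction in which only this form varies is in the kernel.
\<close>

lemma jacobian_squared_forms:
  assumes p: "bij p" and e: "chart_index i e" and e': "chart_index i' e'"
    and nz: "forms (affine_section 1 i e w) $ p i' \<noteq> 0"
    and J: "((\<lambda>w. \<chi> j. squared_forms p (affine_section 1 i e w) $ e' j / squared_forms p (affine_section 1 i e w) $ i')
      has_derivative (*v) J) (at w)"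
  shows "det (J :: complex ^ 2 ^ 2) = 0 \<longleftrightarrow> (\<exists>k. forms (affine_section 1 i e w) $ k = 0)"
proof -
  define l where "l = forms (affine_section 1 i e w)"
  define d where "d = (\<lambda>h. forms (affine_section 0 i e h))"
  define b where "b = p i'"
  have b: "l $ b \<noteq> 0" using nz by (simp add: l_def b_def)
  have Jh: "(J *v h) $ j = 2 * l $ p (e' j) * (d h $ p (e' j) * l $ b - l $ p (e' j) * d h $ b) / (l $ b) ^ 3" for h j
  proof -
    have "((\<lambda>w. (forms (affine_section 1 i e w) $ p (e' j))\<^sup>2 / (forms (affine_section 1 i e w) $ b)\<^sup>2) has_derivative
       (\<lambda>h. 2 * l $ p (e' j) * (d h $ p (e' j) * l $ b - l $ p (e' j) * d h $ b) / (l $ b) ^ 3)) (at w)"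
      unfolding power2_eq_square
      by (rule derivative_eq_intros has_derivative_forms_section[OF e] refl)+
        (use b in \<open>auto simp: l_def[symmetric] d_def fun_eq_iff field_simps power2_eq_square power3_eq_cube\<close>)
    moreover have "((\<lambda>w. (forms (affine_section 1 i e w) $ p (e' j))\<^sup>2 / (forms (affine_section 1 i e w) $ b)\<^sup>2) has_derivative
       (\<lambda>h. (J *v h) $ j)) (at w)"
      using bounded_linear.has_derivative[OF bounded_linear_vec_nth J, of j] by (simp add: b_def)
    ultimately have "(\<lambda>h. 2 * l $ p (e' j) * (d h $ p (e' j) * l $ b - l $ p (e' j) * d h $ b) / (l $ b) ^ 3) = (\<lambda>h. (J *v h) $ j)"
      by (rule has_derivative_unique)
    from fun_cong[OF this, of h] show ?thesis by (rule sym)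
  qed
  have J0: "J *v h = 0 \<longleftrightarrow> (\<forall>m. l $ m * (d h $ m * l $ b - l $ m * d h $ b) = 0)" for h
  proof
    assume *: "J *v h = 0"
    show "\<forall>m. l $ m * (d h $ m * l $ b - l $ m * d h $ b) = 0"
    proof
      fix m
      obtain n where n: "m = p n" using p by (metis bij_pointE)
      show "l $ m * (d h $ m * l $ b - l $ m * d h $ b) = 0"
      proof (rule chart_index_cases[OF e', of n])
        assume "n = i'" then show ?thesis by (simp add: n b_def mult.commute)
      next
        fix j assume "n = e' j"
        then show ?thesis using Jh[of h j] * b by (simp add: n)
      qed
    qed
  qed (simp add: vec_eq_iff Jh)
  show ?thesis unfolding det_eq_0_iff_kernel l_def[symmetric]
  proof
    assume "\<exists>h. h \<noteq> 0 \<and> J *v h = 0"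
    then obtain h where h: "h \<noteq> 0" "\<And>m. l $ m * (d h $ m * l $ b - l $ m * d h $ b) = 0"
      using J0 by blast
    show "\<exists>k. l $ k = 0"
    proof (rule ccontr)
      assume "\<nexists>k. l $ k = 0"
      then have nz: "l $ m \<noteq> 0" for m by blast
      define c where "c = d h $ b / l $ b"
      have "d h $ m = c * l $ m" for m
        using h(2)[of m] nz[of m] b unfolding c_def by (simp add: field_simps)
      then have "d h = c *s l" by (simp add: vec_eq_iff)
      then have "forms (affine_section 0 i e h - c *s affine_section 1 i e w) = 0"
        by (simp add: forms_linear d_def l_def)
      then have *: "affine_section 0 i e h = c *s affine_section 1 i e w"
        by (simp add: forms_eq_0_iff)
      have "c = 0"
        using arg_cong[OF *, of "\<lambda>v. v $ i"] affine_section_nth(1)[OF e] by simp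
      then have "affine_section 0 i e h = 0" using * by simp
      then have "h $ j = 0" for j using affine_section_nth(2)[OF e, of 0 h j] by simp
      then show False using h(1) by (simp add: vec_eq_iff)
    qed
  next
    assume "\<exists>k. l $ k = 0"
    then obtain k where k: "l $ k = 0" by blast
    \<comment> \<open>Subtracting a multiple of the base point makes the vector tangent to the chart.\<close>
    define \<zeta> where "\<zeta> = forms_inv (axis k 1)"
    define \<eta> where "\<eta> = \<zeta> - \<zeta> $ i *s affine_section 1 i e w"
    define h where "h = (\<chi> j. \<eta> $ e j)"
    have h: "affine_section 0 i e h = \<eta>"
      by (rule affine_section_eqI[OF e]) (simp_all add: h_def \<eta>_def affine_section_nth[OF e])
    then have dh: "d h = axis k 1 - \<zeta> $ i *s l"
      by (simp add: d_def \<eta>_def forms_linear \<zeta>_def forms_inverse l_def)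
    have "h \<noteq> 0"
    proof
      assume "h = 0"
      then have "\<eta> = 0" using h affine_section_eqI[OF e, of 0 0 0] by simp
      then have "d h = 0" using h by (simp add: d_def forms_eq_0_iff)
      then show False using arg_cong[OF dh, of "\<lambda>v. v $ k"] k by simp
    qed
    moreover have "J *v h = 0"
    proof (subst J0, intro allI)
      fix m
      have "k \<noteq> b" using k b by auto
      then show "l $ m * (d h $ m * l $ b - l $ m * d h $ b) = 0"
        by (cases "m = k") (auto simp: dh k axis_def)
    qed
    ultimately show "\<exists>h. h \<noteq> 0 \<and> J *v h = 0" by blast
  qed
qed

lemma critical_set_squared_forms:
  assumes p: "bij p" and f: "lifts_to f (squared_forms p)"
  shows "critical_set (projective_space :: (3 proj, 2) complex_manifold) f =
    {proj_pt v | v. v \<noteq> 0 \<and> (\<exists>k. forms v $ k = 0)}"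
proof (intro equalityI subsetI)
  fix x assume "x \<in> critical_set (projective_space :: (3 proj, 2) complex_manifold) f"
  then obtain i e i' e' J where e: "chart_index i (e :: 2 \<Rightarrow> 3)" and e': "chart_index i' (e' :: 2 \<Rightarrow> 3)"
    and x: "coord_nonzero i x" "coord_nonzero i' (f x)"
    and J: "((affine_chart i' e' \<circ> f \<circ> inv_into {p. coord_nonzero i p} (affine_chart i e)) has_derivative (*v) J) (at (affine_chart i e x))"
    and det: "det (J :: complex ^ 2 ^ 2) = 0"
    unfolding critical_set_def charts_projective_space by auto
  let ?v = "affine_section 1 i e (affine_chart i e x)"
  have v: "?v \<noteq> 0" "x = proj_pt ?v" using affine_section_nonzero[OF e] affine_section_chart[OF e x(1)] by auto
  have "squared_forms p ?v $ i' \<noteq> 0"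
    using x(2) v lifts_toD[OF f v(1)] coord_nonzero_pt by metis
  then have "\<exists>k. forms ?v $ k = 0"
    using jacobian_squared_forms[OF p e e' _ J[unfolded chart_expression[OF f e]]] det by simp
  then show "x \<in> {proj_pt v | v. v \<noteq> 0 \<and> (\<exists>k. forms v $ k = 0)}" using v by blast
next
  fix x assume "x \<in> {proj_pt v | v. v \<noteq> 0 \<and> (\<exists>k. forms v $ k = 0)}"
  then obtain v k where v: "v \<noteq> 0" "x = proj_pt v" "forms v $ k = 0" by blast
  have fv: "squared_forms p v \<noteq> 0" "f x = proj_pt (squared_forms p v)" using lifts_toD[OF f v(1)] v by auto
  obtain i where i: "v $ i \<noteq> 0" using v(1) by (auto simp: vec_eq_iff)
  obtain i' where i': "squared_forms p v $ i' \<noteq> 0" using fv(1) by (auto simp: vec_eq_iff simp del: squared_forms_nth)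
  obtain e :: "2 \<Rightarrow> 3" where e: "chart_index i e" using chart_index_exists[where ?'k = 2, of i] by auto
  obtain e' :: "2 \<Rightarrow> 3" where e': "chart_index i' e'" using chart_index_exists[where ?'k = 2, of i'] by auto
  have x: "coord_nonzero i x" "coord_nonzero i' (f x)"
    using v fv i i' by (auto simp: coord_nonzero_pt simp del: squared_forms_nth)
  let ?w = "affine_chart i e x"
  let ?v = "affine_section 1 i e ?w"
  have "proj_pt ?v = proj_pt v" using affine_section_chart[OF e x(1)] v(2) by simp
  then obtain c where c: "c \<noteq> 0" "v = c *s ?v"
    using v(1) affine_section_nonzero[OF e] by (auto simp: proj_pt_eq_iff)
  have k: "forms ?v $ k = 0" using v(3) c arg_cong[OF c(2), of forms] by (simp add: forms_linear)
  have "forms v = c *s forms ?v" using arg_cong[OF c(2), of forms] by (simp add: forms_linear)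
  then have nz: "forms ?v $ p i' \<noteq> 0" using i' by auto
  have "\<exists>J :: complex ^ 2 ^ 2. ((\<lambda>w. \<chi> j. squared_forms p (affine_section 1 i e w) $ e' j / squared_forms p (affine_section 1 i e w) $ i')
      has_derivative (*v) J) (at ?w)"
    using nz by (intro vec_has_matrix_derivative)
      (auto simp del: squared_forms_nth simp: squared_forms_nth[of p ?v i'] intro!: scalar_holomorphic_at_divide scalar_holomorphic_at_section[OF e] scalar_holomorphic_squared_forms)
  then obtain J :: "complex ^ 2 ^ 2" where J: "((\<lambda>w. \<chi> j. squared_forms p (affine_section 1 i e w) $ e' j / squared_forms p (affine_section 1 i e w) $ i')
      has_derivative (*v) J) (at ?w)" by blast
  have "det J = 0" using jacobian_squared_forms[OF p e e' nz J] k by blast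
  then show "x \<in> critical_set (projective_space :: (3 proj, 2) complex_manifold) f"
    unfolding critical_set_def
  proof (intro CollectI conjI)
    show "x \<in> points projective_space" by (simp add: projective_space_def)
    show "\<exists>(U, \<phi>)\<in>charts projective_space. \<exists>(V, \<psi>)\<in>charts projective_space. x \<in> U \<and> f x \<in> V \<and>
        (\<exists>J :: complex ^ 2 ^ 2. (\<psi> \<circ> f \<circ> inv_into U \<phi> has_derivative (*v) J) (at (\<phi> x)) \<and> det J = 0)"
    proof (rule bexI[of _ "({p. coord_nonzero i p}, affine_chart i e)"], unfold prod.case,
        rule bexI[of _ "({p. coord_nonzero i' p}, affine_chart i' e')"], unfold prod.case)
      show "x \<in> {p. coord_nonzero i p} \<and> f x \<in> {p. coord_nonzero i' p} \<and>
        (\<exists>J :: complex ^ 2 ^ 2. (affine_chart i' e' \<circ> f \<circ> inv_into {p. coord_nonzero i p} (affine_chart i e)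
          has_derivative (*v) J) (at ?w) \<and> det J = 0)"
        using x J[folded chart_expression[OF f e, of i' e']] \<open>det J = 0\<close> by blast
    qed (use e e' in \<open>auto simp: charts_projective_space\<close>)
  qed
qed

section \<open>Post-critical sets\<close>
lemma exists_3: "(\<exists>i :: 3. P i) \<longleftrightarrow> P 1 \<or> P 2 \<or> P 3"
  using forall_3[of "\<lambda>i. \<not> P i"] by blast

definition coordinate_lines :: "3 proj set" where
  "coordinate_lines = {proj_pt v | v. v \<noteq> 0 \<and> (\<exists>k. v $ k = 0)}"

definition diagonal_lines :: "3 proj set" where
  "diagonal_lines = {proj_pt v | v. v \<noteq> 0 \<and> (\<exists>j k. j \<noteq> k \<and> v $ j = v $ k)}"

text \<open>
  Each coordinate of \<open>forms_inv x\<close> is half the sum of two coordinates of \<open>x\<close>.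
\<close>

lemma forms_inv_sum_zero:
  assumes "a \<noteq> b" "x $ a + x $ b = 0"
  shows "\<exists>m. forms_inv x $ m = 0"
proof -
  have "\<forall>a b. a \<noteq> b \<longrightarrow> x $ a + x $ b = 0 \<longrightarrow> (\<exists>m. forms_inv x $ m = 0)"
    unfolding forall_3 exists_3 by (simp add: forms_inv_def add.commute)
  then show ?thesis using assms by blast
qed

lemma forms_diff: "forms v $ a - forms v $ b = 2 * (v $ b - v $ a)"
proof -
  have "\<forall>a b. forms v $ a - forms v $ b = 2 * (v $ b - v $ a)"
    unfolding forall_3 by (simp add: forms_def)
  then show ?thesis by blast
qed

lemma forms_coordinate_zero:
  assumes "v $ k = 0"
  shows "\<exists>a b. a \<noteq> b \<and> (forms v $ a)\<^sup>2 = (forms v $ b)\<^sup>2"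
proof -
  have "\<forall>k. v $ k = 0 \<longrightarrow> (\<exists>a b. a \<noteq> b \<and> (forms v $ a)\<^sup>2 = (forms v $ b)\<^sup>2)"
    unfolding forall_3 exists_3 by (auto simp: forms_def power2_eq_square algebra_simps)
  then show ?thesis using assms by blast
qed

context
  fixes p :: "3 \<Rightarrow> 3" and f :: "3 proj \<Rightarrow> 3 proj"
  assumes p: "bij p" and f: "lifts_to f (squared_forms p)"
begin

text \<open>
  Every choice \<open>x\<close> of square roots of the coordinates gives a preimage. Suitable signs place it on a
  prescribed line.
\<close>

lemma squared_forms_preimage:
  assumes "\<And>k. (x $ p k)\<^sup>2 = v $ k" "v \<noteq> 0"
  shows "forms_inv x \<noteq> 0" "f (proj_pt (forms_inv x)) = proj_pt v"
proof -
  have v: "squared_forms p (forms_inv x) = v" using assms(1) by (simp add: vec_eq_iff forms_inverse)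
  show "forms_inv x \<noteq> 0"
  proof
    assume "forms_inv x = 0"
    then have "x = 0" using forms_inverse(1)[of x] forms_eq_0_iff[of 0] by simp
    then have "v = 0" using assms(1) by (simp add: vec_eq_iff)
    then show False using assms(2) by simp
  qed
  then show "f (proj_pt (forms_inv x)) = proj_pt v" using lifts_toD[OF f] v by metis
qed

lemma square_roots: "\<exists>x :: complex ^ 3. \<forall>k. x $ p k = sg k * csqrt (v $ k)"
proof (intro exI allI)
  show "(\<chi> m. sg (inv_into UNIV p m) * csqrt (v $ inv_into UNIV p m)) $ p k = sg k * csqrt (v $ k)" for k
    using p by (simp add: bij_is_inj)
qed

lemma image_critical_lines: "f ` {proj_pt v | v. v \<noteq> 0 \<and> (\<exists>k. forms v $ k = 0)} = coordinate_lines"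
proof (intro equalityI subsetI)
  fix y assume "y \<in> f ` {proj_pt v | v. v \<noteq> 0 \<and> (\<exists>k. forms v $ k = 0)}"
  then obtain v k where v: "v \<noteq> 0" "forms v $ k = 0" "y = f (proj_pt v)" by blast
  obtain n where "k = p n" using p by (metis bij_pointE)
  then have "squared_forms p v $ n = 0" using v by simp
  then show "y \<in> coordinate_lines" unfolding coordinate_lines_def using lifts_toD[OF f v(1)] v(3) by blast
next
  fix y assume "y \<in> coordinate_lines"
  then obtain v k where v: "v \<noteq> 0" "v $ k = 0" "y = proj_pt v" by (auto simp: coordinate_lines_def)
  obtain x where x: "\<And>k. x $ p k = csqrt (v $ k)" using square_roots[of "\<lambda>_. 1" v] by auto
  have "forms (forms_inv x) $ p k = 0" using v x by (simp add: forms_inverse)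
  then show "y \<in> f ` {proj_pt v | v. v \<noteq> 0 \<and> (\<exists>k. forms v $ k = 0)}"
    using squared_forms_preimage[of x v] v x by (intro image_eqI[of _ _ "proj_pt (forms_inv x)"]) auto
qed

lemma squared_forms_eq_in_diagonal:
  assumes "v \<noteq> 0" "a \<noteq> b" "(forms v $ a)\<^sup>2 = (forms v $ b)\<^sup>2"
  shows "f (proj_pt v) \<in> diagonal_lines"
proof -
  obtain m n where mn: "a = p m" "b = p n" using p by (metis bij_pointE)
  then have "squared_forms p v $ m = squared_forms p v $ n" "m \<noteq> n" using assms by auto
  then show ?thesis unfolding diagonal_lines_def using lifts_toD[OF f assms(1)] by blast
qed

text \<open>
  On a coordinate line two of the three linear forms are opposite, so their squares agree; conversely,
  opposite square roots of two equal coordinates give a preimage on a coordinate line.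
\<close>

lemma image_coordinate_lines: "f ` coordinate_lines = diagonal_lines"
proof (intro equalityI subsetI)
  fix y assume "y \<in> f ` coordinate_lines"
  then obtain v k where v: "v \<noteq> 0" "v $ k = 0" "y = f (proj_pt v)" by (auto simp: coordinate_lines_def)
  then show "y \<in> diagonal_lines"
    using forms_coordinate_zero[of v k] squared_forms_eq_in_diagonal[of v] by blast
next
  fix y assume "y \<in> diagonal_lines"
  then obtain v j k where v: "v \<noteq> 0" "j \<noteq> k" "v $ j = v $ k" "y = proj_pt v" by (auto simp: diagonal_lines_def)
  obtain x where x: "\<And>m. x $ p m = (if m = k then - 1 else 1) * csqrt (v $ m)"
    using square_roots[of "\<lambda>m. if m = k then - 1 else 1" v] by blast
  have "p j \<noteq> p k" using p v(2) by (metis bij_pointE)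
  moreover have "x $ p j + x $ p k = 0" using v x by simp
  ultimately have "\<exists>m. forms_inv x $ m = 0" by (rule forms_inv_sum_zero)
  moreover have "(x $ p m)\<^sup>2 = v $ m" for m by (simp add: x)
  ultimately show "y \<in> f ` coordinate_lines"
    using squared_forms_preimage[of x v] v unfolding coordinate_lines_def
    by (intro image_eqI[of _ _ "proj_pt (forms_inv x)"]) auto
qed

text \<open>
  Where two coordinates agree, the corresponding forms agree, and conversely.
\<close>

lemma image_diagonal_lines: "f ` diagonal_lines = diagonal_lines"
proof (intro equalityI subsetI)
  fix y assume "y \<in> f ` diagonal_lines"
  then obtain v j k where v: "v \<noteq> 0" "j \<noteq> k" "v $ j = v $ k" "y = f (proj_pt v)" by (auto simp: diagonal_lines_def)
  then have "forms v $ j = forms v $ k" using forms_diff[of v j k] by simp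
  then show "y \<in> diagonal_lines" using squared_forms_eq_in_diagonal[of v j k] v by simp
next
  fix y assume "y \<in> diagonal_lines"
  then obtain v j k where v: "v \<noteq> 0" "j \<noteq> k" "v $ j = v $ k" "y = proj_pt v" by (auto simp: diagonal_lines_def)
  obtain x where x: "\<And>m. x $ p m = csqrt (v $ m)"
    using square_roots[of "\<lambda>_. 1" v] by auto
  have "p j \<noteq> p k" using p v(2) by (metis bij_pointE)
  moreover have "forms_inv x $ p j = forms_inv x $ p k"
    using forms_diff[of "forms_inv x" "p j" "p k"] v x by (simp add: forms_inverse)
  ultimately show "y \<in> f ` diagonal_lines"
    using squared_forms_preimage[of x v] v x unfolding diagonal_lines_def
    by (intro image_eqI[of _ _ "proj_pt (forms_inv x)"]) auto
qed

text \<open>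
  The critical lines are mapped onto the coordinate lines, these onto the diagonal lines, and the
  latter are invariant.
\<close>

lemma postcritical_set:
  "(\<Union>n\<in>{1..}. (f ^^ n) ` critical_set (projective_space :: (3 proj, 2) complex_manifold) f) =
    coordinate_lines \<union> diagonal_lines"
proof -
  let ?C = "critical_set (projective_space :: (3 proj, 2) complex_manifold) f"
  have 1: "(f ^^ Suc 0) ` ?C = coordinate_lines"
    by (simp add: critical_set_squared_forms[OF p f] image_critical_lines)
  have 2: "(f ^^ Suc (Suc n)) ` ?C = diagonal_lines" for n
  proof (induction n)
    case 0
    have "(f ^^ Suc (Suc 0)) ` ?C = f ` (f ^^ Suc 0) ` ?C" by (simp add: image_comp)
    then show ?case unfolding 1 image_coordinate_lines .
  next
    case (Suc n)
    have "(f ^^ Suc (Suc (Suc n))) ` ?C = f ` (f ^^ Suc (Suc n)) ` ?C" by (simp add: image_comp)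
    then show ?case unfolding Suc image_diagonal_lines .
  qed
  have "{1..} = insert (Suc 0) (range (\<lambda>n. Suc (Suc n)))"
  proof (intro equalityI subsetI)
    fix n :: nat assume "n \<in> {1..}"
    then show "n \<in> insert (Suc 0) (range (\<lambda>n. Suc (Suc n)))"
      by (cases n; cases "n - 1") auto
  qed auto
  then show ?thesis using 1 2 by simp
qed

lemma critically_finite_squared_forms: "critically_finite TYPE(2) f"
proof -
  define P where "P = (\<lambda>v :: complex ^ 3. v$1 * v$2 * v$3 * ((v$1 - v$2) * (v$2 - v$3) * (v$1 - v$3)))"
  have "homogeneous_poly (1 + 1 + 1 + (1 + 1 + 1)) P"
    unfolding P_def
    by (intro homogeneous_poly_mult homogeneous_poly_diff homogeneous_poly_coordinate)
  moreover have "coordinate_lines \<union> diagonal_lines = {proj_pt v | v. v \<noteq> 0 \<and> P v = 0}"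
  proof -
    have "P v = 0 \<longleftrightarrow> (\<exists>k. v $ k = 0) \<or> (\<exists>j k. j \<noteq> k \<and> v $ j = v $ k)" for v
      by (auto simp: P_def exists_3)
    moreover have "{g v | v. N v \<and> A v} \<union> {g v | v. N v \<and> B v} = {g v | v. N v \<and> (A v \<or> B v)}"
      for g :: "complex ^ 3 \<Rightarrow> 3 proj" and N A B by blast
    ultimately show ?thesis unfolding coordinate_lines_def diagonal_lines_def by simp
  qed
  ultimately have "algebraic_set (coordinate_lines \<union> diagonal_lines)"
    unfolding algebraic_set_def by (intro exI[of _ "{P}"]) auto
  then show ?thesis
    unfolding critically_finite_def Let_def postcritical_set
    using holomorphic_projective_self_map[OF f scalar_holomorphic_squared_forms, where 'k = 2] by simp
qed

end

section \<open>The group generated by the monomial matrices and the translation\<close>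

definition diag_mat :: "complex \<Rightarrow> complex \<Rightarrow> complex ^ 2 ^ 2" where
  "diag_mat a b = vector [vector [a, 0], vector [0, b]]"

definition antidiag_mat :: "complex \<Rightarrow> complex \<Rightarrow> complex ^ 2 ^ 2" where
  "antidiag_mat a b = vector [vector [0, a], vector [b, 0]]"

lemma monomial_mat_vec [simp]:
  "(diag_mat a b *v z) $ 1 = a * z $ 1" "(diag_mat a b *v z) $ 2 = b * z $ 2"
  "(antidiag_mat a b *v z) $ 1 = a * z $ 2" "(antidiag_mat a b *v z) $ 2 = b * z $ 1"
  by (simp_all add: diag_mat_def antidiag_mat_def matrix_vector_mult_def sum_2)

lemma monomial_mat_mult:
  "diag_mat a b ** diag_mat c d = diag_mat (a * c) (b * d)"
  "diag_mat a b ** antidiag_mat c d = antidiag_mat (a * c) (b * d)"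
  "antidiag_mat a b ** diag_mat c d = antidiag_mat (a * d) (b * c)"
  "antidiag_mat a b ** antidiag_mat c d = diag_mat (a * d) (b * c)"
  "diag_mat 1 1 = mat 1"
  by (simp_all add: diag_mat_def antidiag_mat_def matrix_matrix_mult_def sum_2 vec_eq_iff forall_2 mat_def)

definition gaussian_units :: "complex set" where "gaussian_units = {1, - 1, \<i>, - \<i>}"

text \<open>
  The sixteen elements of \<open>G(4,2,2)\<close>: the product of the two entries is \<open>1\<close> or \<open>- 1\<close>.
\<close>

definition monomial_mats :: "(complex ^ 2 ^ 2) set" where
  "monomial_mats = {M. \<exists>a\<in>gaussian_units. \<exists>b\<in>gaussian_units. (a * b)\<^sup>2 = 1 \<and> (M = diag_mat a b \<or> M = antidiag_mat a b)}"

lemma gaussian_units_facts: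
  assumes "a \<in> gaussian_units"
  shows "1 / a \<in> gaussian_units" "a \<noteq> 0" "a \<in> gaussian_ints" "a * (1 + \<i>) / 2 - \<omega> \<in> gaussian_ints"
  using assms by (auto simp: gaussian_units_def gaussian_ints_iff)

lemma gaussian_units_mult: "a \<in> gaussian_units \<Longrightarrow> b \<in> gaussian_units \<Longrightarrow> a * b \<in> gaussian_units"
  by (auto simp: gaussian_units_def)

lemma monomial_matsI:
  assumes "a \<in> gaussian_units" "b \<in> gaussian_units" "(a * b)\<^sup>2 = 1"
  shows "diag_mat a b \<in> monomial_mats" "antidiag_mat a b \<in> monomial_mats"
  using assms unfolding monomial_mats_def by blast+

lemma monomial_mats_cases:
  assumes "M \<in> monomial_mats"
  obtains a b where "a \<in> gaussian_units" "b \<in> gaussian_units" "(a * b)\<^sup>2 = 1" "M = diag_mat a b"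
  | a b where "a \<in> gaussian_units" "b \<in> gaussian_units" "(a * b)\<^sup>2 = 1" "M = antidiag_mat a b"
  using assms unfolding monomial_mats_def by blast

lemma finite_monomial_mats: "finite monomial_mats"
proof -
  have "monomial_mats \<subseteq> (\<lambda>(a, b). diag_mat a b) ` (gaussian_units \<times> gaussian_units) \<union>
      (\<lambda>(a, b). antidiag_mat a b) ` (gaussian_units \<times> gaussian_units)"
    unfolding monomial_mats_def by auto
  then show ?thesis by (rule finite_subset) (simp add: gaussian_units_def)
qed

lemma monomial_mats_mult:
  assumes "M \<in> monomial_mats" "N \<in> monomial_mats"
  shows "M ** N \<in> monomial_mats"
proof -
  have sq: "(a * c * (b * d))\<^sup>2 = 1" "(a * d * (b * c))\<^sup>2 = 1" if "(a * b)\<^sup>2 = 1" "(c * d)\<^sup>2 = 1" for a b c d :: complex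
  proof -
    have "(a * c * (b * d))\<^sup>2 = (a * b)\<^sup>2 * (c * d)\<^sup>2" "(a * d * (b * c))\<^sup>2 = (a * b)\<^sup>2 * (c * d)\<^sup>2"
      by (simp_all add: power2_eq_square mult_ac)
    then show "(a * c * (b * d))\<^sup>2 = 1" "(a * d * (b * c))\<^sup>2 = 1" using that by simp_all
  qed
  show ?thesis
    by (rule monomial_mats_cases[OF assms(1)]; rule monomial_mats_cases[OF assms(2)]; simp add: monomial_mat_mult; intro monomial_matsI gaussian_units_mult;
        (assumption | (rule sq(1); assumption) | (rule sq(2); assumption)))
qed

lemma monomial_mats_inverse:
  assumes "M \<in> monomial_mats"
  obtains N where "N \<in> monomial_mats" "N ** M = mat 1" "M ** N = mat 1"
  using assms
proof (cases rule: monomial_mats_cases)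
  case (1 a b)
  then have "(1 / a * (1 / b))\<^sup>2 = 1" by (simp add: power_divide flip: power_mult_distrib)
  with 1 show ?thesis
    using gaussian_units_facts[of a] gaussian_units_facts[of b]
    by (intro that[of "diag_mat (1 / a) (1 / b)"]) (auto simp: monomial_mat_mult intro: monomial_matsI)
next
  case (2 a b)
  then have "(1 / b * (1 / a))\<^sup>2 = 1" by (simp add: power_divide mult.commute flip: power_mult_distrib)
  with 2 show ?thesis
    using gaussian_units_facts[of a] gaussian_units_facts[of b]
    by (intro that[of "antidiag_mat (1 / b) (1 / a)"]) (auto simp: monomial_mat_mult intro: monomial_matsI)
qed

lemma group_GL: "group (GL :: (complex ^ 'n ^ 'n::finite) monoid)"
proof (rule groupI)
  fix x y z :: "complex ^ 'n ^ 'n"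
  show "x \<otimes>\<^bsub>GL\<^esub> y \<in> carrier GL" if "x \<in> carrier GL" "y \<in> carrier GL"
    using that invertible_mult by (simp add: GL_def)
  show "\<one>\<^bsub>GL\<^esub> \<in> carrier (GL :: (complex ^ 'n ^ 'n) monoid)"
    by (auto simp: GL_def invertible_def intro!: exI[of _ "mat 1"])
  assume "x \<in> carrier GL"
  then obtain y where "x ** y = mat 1" "y ** x = mat 1" by (auto simp: GL_def invertible_def)
  then show "\<exists>y\<in>carrier GL. y \<otimes>\<^bsub>GL\<^esub> x = \<one>\<^bsub>GL\<^esub>"
    by (intro bexI[of _ y]) (auto simp: GL_def invertible_def)
qed (simp_all add: GL_def matrix_mul_assoc)

lemma Gmp2_4_2_eq:
  "Gmp2 4 2 = generate GL {antidiag_mat 1 1, antidiag_mat \<i> (- \<i>), diag_mat (- 1) 1}"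
proof -
  have e1: "exp (2 * \<i> * of_real pi / of_nat 4) = \<i>"
    using exp_half_pi_i by (simp add: mult.commute)
  have e2: "exp (- 2 * \<i> * of_real pi / of_nat 4) = - \<i>"
    using exp_half_pi_i exp_minus[of "of_real pi * \<i> / 2"] by (simp add: mult.commute)
  have e3: "exp (2 * \<i> * of_nat 2 * of_real pi / of_nat 4) = (- 1 :: complex)"
    using exp_pi_i by (simp add: mult.commute)
  show ?thesis
    unfolding Gmp2_def e1 e2 e3 by (simp only: diag_mat_def antidiag_mat_def)
qed

lemma Gmp2_4_2_generators_involutive:
  assumes "M \<in> {antidiag_mat 1 1, antidiag_mat \<i> (- \<i>), diag_mat (- 1) 1}"
  shows "M ** M = mat 1"
  using assms by (auto simp: monomial_mat_mult)

lemma Gmp2_4_2_subset: "Gmp2 4 2 \<subseteq> monomial_mats"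
proof
  fix M assume "M \<in> Gmp2 4 2"
  then show "M \<in> monomial_mats"
    unfolding Gmp2_4_2_eq
  proof (induction rule: generate.induct)
    case one
    show ?case using monomial_matsI(1)[of 1 1] by (simp add: GL_def monomial_mat_mult gaussian_units_def)
  next
    case (incl M)
    then show ?case by (auto simp: gaussian_units_def intro!: monomial_matsI)
  next
    case (inv M)
    have "inv\<^bsub>GL\<^esub> M = M"
      using Gmp2_4_2_generators_involutive[OF inv]
      by (intro group.inv_equality[OF group_GL]) (auto simp: GL_def invertible_def)
    with inv show ?case by (auto simp: gaussian_units_def intro!: monomial_matsI)
  next
    case (eng M N)
    then show ?case using monomial_mats_mult by (simp add: GL_def)
  qed
qed

lemma Gmp2_4_2_mem:
  "antidiag_mat 1 1 \<in> Gmp2 4 2" "diag_mat \<i> \<i> \<in> Gmp2 4 2"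
  "a \<in> {1, - 1} \<Longrightarrow> b \<in> {1, - 1} \<Longrightarrow> diag_mat a b \<in> Gmp2 4 2"
proof -
  have mult: "M ** N \<in> Gmp2 4 2" if "M \<in> Gmp2 4 2" "N \<in> Gmp2 4 2" for M N
    using generate.eng[OF that[unfolded Gmp2_4_2_eq]] unfolding Gmp2_4_2_eq by (simp add: GL_def)
  have gens: "antidiag_mat 1 1 \<in> Gmp2 4 2" "antidiag_mat \<i> (- \<i>) \<in> Gmp2 4 2" "diag_mat (- 1) 1 \<in> Gmp2 4 2"
    unfolding Gmp2_4_2_eq by (intro generate.incl; simp)+
  have d2: "diag_mat 1 (- 1) \<in> Gmp2 4 2"
    using mult[OF mult[OF gens(1,3)] gens(1)] by (simp add: monomial_mat_mult)
  have d3: "diag_mat (- 1) (- 1) \<in> Gmp2 4 2"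
    using mult[OF gens(3) d2] by (simp add: monomial_mat_mult)
  have d0: "diag_mat 1 1 \<in> Gmp2 4 2"
    using mult[OF d2 d2] by (simp add: monomial_mat_mult)
  show "antidiag_mat 1 1 \<in> Gmp2 4 2" by (rule gens)
  show "diag_mat \<i> \<i> \<in> Gmp2 4 2"
    using mult[OF mult[OF gens(2,1)] d2] by (simp add: monomial_mat_mult)
  show "diag_mat a b \<in> Gmp2 4 2" if "a \<in> {1, - 1}" "b \<in> {1, - 1}"
    using that d0 d2 d3 gens(3) by auto
qed

abbreviation half_vec :: "complex ^ 2" where "half_vec \<equiv> vector [\<omega>, \<omega>]"

lemma half_vec_double: "half_vec + half_vec \<in> gaussian_lattice"
proof -
  have "\<omega> + \<omega> = 1 + \<i>" by (simp add: complex_eq_iff)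
  then show ?thesis by (simp only: gaussian_lattice_iff vector_add_component vector_2_3_nth) (simp add: gaussian_ints_closed)
qed

lemma lattice_compatible_affine:
  assumes "\<And>z. z \<in> gaussian_lattice \<Longrightarrow> M *v z \<in> gaussian_lattice"
  shows "lattice_compatible (\<lambda>z. M *v z + c)"
  using assms unfolding lattice_compatible_def
  by (simp flip: matrix_vector_mult_diff_distrib)

lemma monomial_mats_lattice:
  assumes "M \<in> monomial_mats"
  shows "z \<in> gaussian_lattice \<Longrightarrow> M *v z \<in> gaussian_lattice" "M *v half_vec - half_vec \<in> gaussian_lattice"
  by (rule monomial_mats_cases[OF assms];
      simp add: gaussian_lattice_iff gaussian_units_facts gaussian_ints_closed)+

lemma monomial_mats_compatible: "M \<in> monomial_mats \<Longrightarrow> lattice_compatible (\<lambda>z. M *v z + c)"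
  by (rule lattice_compatible_affine) (rule monomial_mats_lattice)

lemma monomial_mats_compatible_linear: "M \<in> monomial_mats \<Longrightarrow> lattice_compatible ((*v) M)"
  using monomial_mats_compatible[of M 0] by simp

lemma torus_induced_extensional: "torus_induced gaussian_lattice h \<in> extensional (points (torus gaussian_lattice))"
  by (simp add: torus_induced_def)

lemma torus_induced_eqI:
  assumes "lattice_compatible h" "lattice_compatible h'" "\<And>z. h z - h' z \<in> gaussian_lattice"
  shows "torus_induced gaussian_lattice h = torus_induced gaussian_lattice h'"
proof (rule extensionalityI[OF torus_induced_extensional torus_induced_extensional])
  fix x assume "x \<in> points (torus gaussian_lattice)"
  then obtain z where "x = torus_pt z" by (auto simp: points_torus)
  then show "torus_induced gaussian_lattice h x = torus_induced gaussian_lattice h' x"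
    using assms by (simp add: torus_induced_pt torus_pt_eq_iff)
qed

lemma torus_induced_compose:
  assumes "lattice_compatible h" "lattice_compatible h'"
  shows "compose (points (torus gaussian_lattice)) (torus_induced gaussian_lattice h) (torus_induced gaussian_lattice h')
    = torus_induced gaussian_lattice (\<lambda>z. h (h' z))"
proof (rule extensionalityI[OF compose_extensional torus_induced_extensional])
  have "lattice_compatible (\<lambda>z. h (h' z))" using assms by (simp add: lattice_compatible_def)
  then show "compose (points (torus gaussian_lattice)) (torus_induced gaussian_lattice h) (torus_induced gaussian_lattice h') x
    = torus_induced gaussian_lattice (\<lambda>z. h (h' z)) x" if "x \<in> points (torus gaussian_lattice)" for x
    using that assms by (auto simp: points_torus compose_def torus_induced_pt)
qed

text \<open>
  An explicit finite list of maps that is closed under composition and inversion. Only two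
  translations occur: each matrix of the list fixes the class of \<open>half_vec\<close>, and twice \<open>half_vec\<close> is a
  period.
\<close>

definition affine_covering_maps :: "((complex ^ 2) set \<Rightarrow> (complex ^ 2) set) set" where
  "affine_covering_maps = (\<lambda>(M, c). torus_induced gaussian_lattice (\<lambda>z. M *v z + c)) ` (monomial_mats \<times> {0, half_vec})"

lemma affine_covering_maps_compose:
  assumes "g \<in> affine_covering_maps" "g' \<in> affine_covering_maps"
  shows "compose (points (torus gaussian_lattice)) g g' \<in> affine_covering_maps"
proof -
  obtain M c N d where g: "g = torus_induced gaussian_lattice (\<lambda>z. M *v z + c)" "M \<in> monomial_mats" "c \<in> {0, half_vec}"
    and g': "g' = torus_induced gaussian_lattice (\<lambda>z. N *v z + d)" "N \<in> monomial_mats" "d \<in> {0, half_vec}"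
    using assms unfolding affine_covering_maps_def by auto
  have MN: "M ** N \<in> monomial_mats" using g g' by (intro monomial_mats_mult)
  define b where "b = (if c = d then 0 else half_vec)"
  have "half_vec \<noteq> 0" using half_not_gaussian gaussian_ints_closed(1) by (metis vector_2_3_nth(1) zero_index)
  then have b: "b \<in> {0, half_vec}" "M *v d + c - b \<in> gaussian_lattice"
    using g(3) g'(3) monomial_mats_lattice(2)[OF g(2)]
      gaussian_lattice_closed(2)[OF monomial_mats_lattice(2)[OF g(2)] half_vec_double] gaussian_lattice_closed(1)
    by (auto simp: b_def add.commute)
  have "compose (points (torus gaussian_lattice)) g g' = torus_induced gaussian_lattice (\<lambda>z. M *v (N *v z + d) + c)"
    unfolding g g' by (rule torus_induced_compose[OF monomial_mats_compatible monomial_mats_compatible]) (rule g g')+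
  also have "\<dots> = torus_induced gaussian_lattice (\<lambda>z. (M ** N) *v z + b)"
  proof (rule torus_induced_eqI)
    show "lattice_compatible (\<lambda>z. M *v (N *v z + d) + c)"
      using monomial_mats_compatible[OF g(2), of c] monomial_mats_compatible[OF g'(2), of d]
      by (simp add: lattice_compatible_def)
    show "M *v (N *v z + d) + c - ((M ** N) *v z + b) \<in> gaussian_lattice" for z
      using b(2) by (simp add: matrix_vector_right_distrib matrix_vector_mul_assoc algebra_simps)
  qed (rule monomial_mats_compatible[OF MN])
  finally show ?thesis using MN b(1) unfolding affine_covering_maps_def by auto
qed

lemma affine_covering_maps_inverse:
  assumes "g \<in> affine_covering_maps"
  obtains g' where "g' \<in> affine_covering_maps" "compose (points (torus gaussian_lattice)) g' g = (\<lambda>x\<in>points (torus gaussian_lattice). x)"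
proof -
  obtain M c where g: "g = torus_induced gaussian_lattice (\<lambda>z. M *v z + c)" "M \<in> monomial_mats" "c \<in> {0, half_vec}"
    using assms unfolding affine_covering_maps_def by auto
  obtain N where N: "N \<in> monomial_mats" "N ** M = mat 1" using monomial_mats_inverse[OF g(2)] .
  define g' where "g' = torus_induced gaussian_lattice (\<lambda>z. N *v z + c)"
  have "N *v c + c \<in> gaussian_lattice"
    using g(3) gaussian_lattice_closed(2)[OF monomial_mats_lattice(2)[OF N(1)] half_vec_double] gaussian_lattice_closed(1)
    by (auto simp: algebra_simps)
  then have *: "N *v (M *v z + c) + c - z \<in> gaussian_lattice" for z
    using N(2) by (simp add: matrix_vector_right_distrib matrix_vector_mul_assoc)
  have "compose (points (torus gaussian_lattice)) g' g = torus_induced gaussian_lattice (\<lambda>z. N *v (M *v z + c) + c)"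
    unfolding g g'_def by (rule torus_induced_compose[OF monomial_mats_compatible monomial_mats_compatible]) (rule g N)+
  also have "\<dots> = (\<lambda>x\<in>points (torus gaussian_lattice). x)"
  proof (rule extensionalityI[OF torus_induced_extensional])
    have comp: "lattice_compatible (\<lambda>z. N *v (M *v z + c) + c)"
      using monomial_mats_compatible[OF g(2), of c] monomial_mats_compatible[OF N(1), of c]
      by (simp add: lattice_compatible_def)
    show "torus_induced gaussian_lattice (\<lambda>z. N *v (M *v z + c) + c) x = (\<lambda>x\<in>points (torus gaussian_lattice). x) x"
      if x: "x \<in> points (torus gaussian_lattice)" for x
    proof -
      obtain z where "x = torus_pt z" using x by (auto simp: points_torus)
      then show ?thesis using x * by (simp add: torus_induced_pt[OF comp] torus_pt_eq_iff)
    qed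
  qed simp
  finally have "compose (points (torus gaussian_lattice)) g' g = (\<lambda>x\<in>points (torus gaussian_lattice). x)" .
  moreover have "g' \<in> affine_covering_maps" using N g(3) unfolding g'_def affine_covering_maps_def by auto
  ultimately show ?thesis using that by blast
qed

lemma affine_covering_maps_funcset: "g \<in> affine_covering_maps \<Longrightarrow> x \<in> points (torus gaussian_lattice) \<Longrightarrow> g x \<in> points (torus gaussian_lattice)"
  unfolding affine_covering_maps_def points_torus
  by (auto simp: torus_induced_pt monomial_mats_compatible monomial_mats_compatible_linear)

text \<open>
  An inverse in the list has again a left inverse in the list, so it is two-sided.
\<close>

lemma affine_covering_maps_Bij:
  assumes g: "g \<in> affine_covering_maps"
  shows "g \<in> Bij (points (torus gaussian_lattice))"
proof -
  let ?S = "points (torus gaussian_lattice)"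
  obtain g' where g': "g' \<in> affine_covering_maps" "compose ?S g' g = (\<lambda>x\<in>?S. x)"
    using affine_covering_maps_inverse[OF g] .
  obtain g'' where g'': "g'' \<in> affine_covering_maps" "compose ?S g'' g' = (\<lambda>x\<in>?S. x)"
    using affine_covering_maps_inverse[OF g'(1)] .
  have 1: "g' (g x) = x" and 2: "g'' (g' x) = x" if "x \<in> ?S" for x
    using fun_cong[OF g'(2), of x] fun_cong[OF g''(2), of x] that by (simp_all add: compose_def)
  have 3: "g (g' x) = x" if "x \<in> ?S" for x
    using 1[of "g' x"] 2 that affine_covering_maps_funcset[OF g] affine_covering_maps_funcset[OF g'(1)] by metis
  have "bij_betw g ?S ?S"
    by (rule bij_betw_byWitness[where f' = g'])
      (use 1 3 affine_covering_maps_funcset[OF g] affine_covering_maps_funcset[OF g'(1)] in auto)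
  moreover have "g \<in> extensional ?S"
    using g torus_induced_extensional unfolding affine_covering_maps_def by auto
  ultimately show ?thesis by (simp add: Bij_def)
qed

lemma affine_covering_maps_inv:
  assumes g: "g \<in> affine_covering_maps"
  shows "inv\<^bsub>BijGroup (points (torus gaussian_lattice))\<^esub> g \<in> affine_covering_maps"
proof -
  obtain g' where g': "g' \<in> affine_covering_maps"
    "compose (points (torus gaussian_lattice)) g' g = (\<lambda>x\<in>points (torus gaussian_lattice). x)"
    using affine_covering_maps_inverse[OF g] .
  have "inv\<^bsub>BijGroup (points (torus gaussian_lattice))\<^esub> g = g'"
    using g' g affine_covering_maps_Bij
    by (intro group.inv_equality[OF group_BijGroup]) (auto simp: BijGroup_def)
  then show ?thesis using g' by simp
qed

lemma translation_half_vec: "(\<lambda>z. z + ((1 + \<i>) / 2) *s vector [1, 1]) = (\<lambda>z. mat 1 *v z + half_vec)"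
  by (simp add: fun_eq_iff vec_eq_iff forall_2)

lemma mat_1_monomial: "mat 1 \<in> monomial_mats"
  using monomial_matsI(1)[of 1 1] by (simp add: monomial_mat_mult gaussian_units_def)

lemma covering_generators:
  "(\<lambda>M. torus_induced gaussian_lattice ((*v) M)) ` Gmp2 4 2 \<union>
      {torus_induced gaussian_lattice (\<lambda>z. z + ((1 + \<i>) / 2) *s vector [1, 1])} \<subseteq> affine_covering_maps"
proof -
  have "torus_induced gaussian_lattice ((*v) M) \<in> affine_covering_maps" if "M \<in> Gmp2 4 2" for M
    unfolding affine_covering_maps_def using that Gmp2_4_2_subset by (intro image_eqI[of _ _ "(M, 0)"]) auto
  moreover have "torus_induced gaussian_lattice (\<lambda>z. mat 1 *v z + half_vec) \<in> affine_covering_maps"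
    unfolding affine_covering_maps_def using mat_1_monomial by (intro image_eqI[of _ _ "(mat 1, half_vec)"]) auto
  ultimately show ?thesis unfolding translation_half_vec by blast
qed

lemma covering_group_subset: "covering_group \<subseteq> affine_covering_maps"
proof
  fix g assume "g \<in> covering_group"
  then show "g \<in> affine_covering_maps"
    unfolding covering_group_def
  proof (induction rule: generate.induct)
    case one
    have "(\<lambda>x\<in>points (torus gaussian_lattice). x) = torus_induced gaussian_lattice (\<lambda>z. mat 1 *v z + 0)"
      by (rule extensionalityI[OF _ torus_induced_extensional])
        (auto simp: points_torus torus_induced_pt[OF monomial_mats_compatible[OF mat_1_monomial, of 0, simplified]])
    then show ?case
      using mat_1_monomial by (auto simp: BijGroup_def affine_covering_maps_def intro!: image_eqI[of _ _ "(mat 1, 0)"])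
  next
    case (incl g)
    then show ?case using covering_generators by blast
  next
    case (inv g)
    then show ?case using covering_generators affine_covering_maps_inv by blast
  next
    case (eng g h)
    then show ?case using affine_covering_maps_Bij affine_covering_maps_compose by (simp add: BijGroup_def)
  qed
qed

lemma covering_group_subgroup: "subgroup covering_group (BijGroup (points (torus gaussian_lattice)))"
  unfolding covering_group_def
  using covering_generators affine_covering_maps_Bij
  by (intro group.generate_is_subgroup[OF group_BijGroup]) (auto simp: BijGroup_def)

lemma finite_covering_group: "finite covering_group"
  by (rule finite_subset[OF covering_group_subset]) (simp add: affine_covering_maps_def finite_monomial_mats)

lemma has_derivative_affine:
  fixes M :: "complex ^ 'n::finite ^ 'm::finite"
  shows "((\<lambda>z. M *v z + c) has_derivative (*v) M) (at z)"
proof -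
  have "linear ((*v) M)"
  proof (rule linearI)
    show "M *v (r *\<^sub>R x) = r *\<^sub>R (M *v x)" for r :: real and x
      by (simp add: vec_eq_iff matrix_vector_mult_def scaleR_sum_right)
  qed (rule matrix_vector_right_distrib)
  then have "((*v) M has_derivative (*v) M) (at z)"
    by (intro bounded_linear_imp_has_derivative) (simp add: linear_conv_bounded_linear)
  then show ?thesis by (auto intro!: derivative_eq_intros)
qed

lemma holomorphic_covering_group:
  assumes "g \<in> covering_group"
  shows "holomorphic_map (torus gaussian_lattice) (torus gaussian_lattice) g"
  using assms covering_group_subset unfolding affine_covering_maps_def
  by (auto intro!: holomorphic_torus_induced[OF monomial_mats_compatible has_derivative_affine])

definition same_orbit :: "complex ^ 2 \<Rightarrow> complex ^ 2 \<Rightarrow> bool" where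
  "same_orbit z w \<longleftrightarrow> (\<exists>g\<in>covering_group. torus_pt w = g (torus_pt z))"

lemma same_orbit_trans:
  assumes "same_orbit x y" "same_orbit y z"
  shows "same_orbit x z"
proof -
  let ?S = "points (torus gaussian_lattice)"
  obtain g h where g: "g \<in> covering_group" "torus_pt y = g (torus_pt x)"
    and h: "h \<in> covering_group" "torus_pt z = h (torus_pt y)"
    using assms unfolding same_orbit_def by blast
  have "h \<otimes>\<^bsub>BijGroup ?S\<^esub> g \<in> covering_group"
    by (rule subgroup.m_closed[OF covering_group_subgroup h(1) g(1)])
  moreover have "h \<otimes>\<^bsub>BijGroup ?S\<^esub> g = compose ?S h g"
    using g(1) h(1) subgroup.mem_carrier[OF covering_group_subgroup] by (simp add: BijGroup_def)
  ultimately show ?thesis unfolding same_orbit_def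
    using g(2) h(2) by (intro bexI[of _ "compose ?S h g"]) (auto simp: compose_def points_torus)
qed

lemma same_orbit_congruent:
  assumes "same_orbit x y" "z - y \<in> gaussian_lattice"
  shows "same_orbit x z"
proof -
  have "torus_pt z = torus_pt y" using assms(2) by (simp add: torus_pt_eq_iff)
  then show ?thesis using assms(1) by (simp add: same_orbit_def)
qed

lemma same_orbit_Gmp2:
  assumes "M \<in> Gmp2 4 2"
  shows "same_orbit z (M *v z)"
proof -
  have "torus_induced gaussian_lattice ((*v) M) \<in> covering_group"
    unfolding covering_group_def using assms by (intro generate.incl) auto
  moreover have "lattice_compatible ((*v) M)"
    using monomial_mats_compatible[of M 0] assms Gmp2_4_2_subset by auto
  ultimately show ?thesis
    unfolding same_orbit_def using torus_induced_pt by (intro bexI[of _ "torus_induced gaussian_lattice ((*v) M)"]) auto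
qed

lemma same_orbit_half_vec: "same_orbit z (z + half_vec)"
proof -
  have "torus_induced gaussian_lattice (\<lambda>z. mat 1 *v z + half_vec) \<in> covering_group"
    unfolding covering_group_def translation_half_vec by (intro generate.incl) auto
  then show ?thesis unfolding same_orbit_def
    using torus_induced_pt[OF monomial_mats_compatible[OF mat_1_monomial, of half_vec], of z]
    by (intro bexI) auto
qed

lemma same_orbit_signs:
  assumes "w $ 1 + z $ 1 \<in> gaussian_ints \<or> w $ 1 - z $ 1 \<in> gaussian_ints"
    "w $ 2 + z $ 2 \<in> gaussian_ints \<or> w $ 2 - z $ 2 \<in> gaussian_ints"
  shows "same_orbit z w"
proof -
  have "\<exists>a\<in>{1, - 1}. w $ 1 - a * z $ 1 \<in> gaussian_ints" "\<exists>b\<in>{1, - 1}. w $ 2 - b * z $ 2 \<in> gaussian_ints"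
    using assms by auto
  then obtain a b where a: "a \<in> {1, - 1}" "w $ 1 - a * z $ 1 \<in> gaussian_ints"
    and b: "b \<in> {1, - 1}" "w $ 2 - b * z $ 2 \<in> gaussian_ints" by blast
  show ?thesis
    using same_orbit_Gmp2[OF Gmp2_4_2_mem(3)[OF a(1) b(1)]]
    by (rule same_orbit_congruent) (use a b in \<open>simp add: gaussian_lattice_iff\<close>)
qed

section \<open>The covering and the three dilations\<close>

lemma sqrt2_exp: "complex_of_real (sqrt 2) * exp (\<i> * of_real pi / 4) = 1 + \<i>"
proof -
  have *: "exp (\<i> * of_real pi / 4) = cis (pi / 4)" by (simp add: cis_conv_exp)
  show ?thesis unfolding * by (simp add: complex_eq_iff cos_45 sin_45)
qed

lemma D_mult:
  "D1 *v z = (1 + \<i>) *s z"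
  "D2 *v z = vector [z $ 1 + z $ 2, z $ 1 - z $ 2]"
  "D3 *v z = vector [z $ 1 + z $ 2, \<i> * (z $ 1 - z $ 2)]"
  using sqrt2_exp
  by (simp_all add: D1_def D2_def D3_def vec_eq_iff forall_2 matrix_vector_mult_def sum_2 scaleR_conv_of_real[where 'a = complex] algebra_simps)

lemma D_compatible: "D \<in> {D1, D2, D3} \<Longrightarrow> lattice_compatible (\<lambda>z. D *v z + c)"
  by (rule lattice_compatible_affine)
    (auto simp: D_mult gaussian_lattice_iff intro!: gaussian_ints_closed; simp add: gaussian_ints_iff)

context gaussian_sigma
begin

text \<open>
  The value at a class is computed at an arbitrary representative.
\<close>

definition covering :: "(complex ^ 2) set \<Rightarrow> 3 proj" where
  "covering X = proj_pt (theta_map (SOME z. torus_pt z = X))"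

lemma covering_pt: "covering (torus_pt z) = proj_pt (theta_map z)"
proof -
  define w where "w = (SOME w. torus_pt w = torus_pt z)"
  have "torus_pt w = torus_pt z" unfolding w_def by (rule someI) (rule refl)
  then have "w - z \<in> gaussian_lattice" by (simp add: torus_pt_eq_iff)
  then obtain k where "k \<noteq> 0" "theta_map w = k *s theta_map z"
    using theta_map_congruent[of w z] by (auto simp: gaussian_lattice_iff)
  then show ?thesis
    using theta_map_nonzero unfolding covering_def w_def[symmetric] by (metis proj_pt_eq_iff)
qed

lemma scalar_holomorphic_theta_map: "scalar_holomorphic_at (\<lambda>z. theta_map z $ j) z"
proof -
  have u: "scalar_holomorphic_at (\<lambda>z. u0 (z $ k)) z" "scalar_holomorphic_at (\<lambda>z. u1 (z $ k)) z" for k :: 2 and z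
    by (rule scalar_holomorphic_at_compose[OF scalar_holomorphic_at_coordinate];
        rule holomorphic_derivI[OF _ open_UNIV UNIV_I]; rule entire_u)+
  have "\<forall>j. scalar_holomorphic_at (\<lambda>z. theta_map z $ j) z"
    unfolding forall_3 theta_map_def invariant_map_def vector_3 power2_eq_square
    by (intro conjI scalar_holomorphic_intros u)
  then show ?thesis by blast
qed

text \<open>
  If \<open>(a * b)\<^sup>2 = 1\<close>, then the units \<open>a\<close> and \<open>b\<close> are both real or both imaginary, so that \<open>diag_mat a b\<close> is a
  change of signs or such a change composed with the multiplication by \<open>\<i>\<close>.
\<close>

lemma theta_map_monomial:
  assumes "M \<in> monomial_mats"
  shows "\<exists>k. k \<noteq> 0 \<and> theta_map (M *v z) = k *s theta_map z"
proof -
  have diag: "\<exists>k. k \<noteq> 0 \<and> theta_map (diag_mat a b *v z) = k *s theta_map z"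
    if ab: "a \<in> gaussian_units" "b \<in> gaussian_units" "(a * b)\<^sup>2 = 1" for a b z
  proof -
    have "a \<in> {1, - 1} \<and> b \<in> {1, - 1} \<or> a \<in> {\<i>, - \<i>} \<and> b \<in> {\<i>, - \<i>}"
      using ab unfolding gaussian_units_def
      by (elim insertE emptyE; simp add: power_mult_distrib)
    then show ?thesis
    proof (elim disjE conjE)
      assume "a \<in> {1, - 1}" "b \<in> {1, - 1}"
      then have "(diag_mat a b *v z) $ 1 + z $ 1 \<in> gaussian_ints \<or> (diag_mat a b *v z) $ 1 - z $ 1 \<in> gaussian_ints"
        "(diag_mat a b *v z) $ 2 + z $ 2 \<in> gaussian_ints \<or> (diag_mat a b *v z) $ 2 - z $ 2 \<in> gaussian_ints"
        by (auto simp: gaussian_ints_closed)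
      then show ?thesis by (rule theta_map_congruent) blast
    next
      assume "a \<in> {\<i>, - \<i>}" "b \<in> {\<i>, - \<i>}"
      then have "(diag_mat a b *v z) $ 1 + (\<i> *s z) $ 1 \<in> gaussian_ints \<or> (diag_mat a b *v z) $ 1 - (\<i> *s z) $ 1 \<in> gaussian_ints"
        "(diag_mat a b *v z) $ 2 + (\<i> *s z) $ 2 \<in> gaussian_ints \<or> (diag_mat a b *v z) $ 2 - (\<i> *s z) $ 2 \<in> gaussian_ints"
        by (auto simp: gaussian_ints_closed)
      then obtain k where "k \<noteq> 0" "theta_map (diag_mat a b *v z) = k *s theta_map (\<i> *s z)"
        by (rule theta_map_congruent)
      then show ?thesis unfolding theta_map_symmetries by blast
    qed
  qed
  show ?thesis
    using assms
  proof (cases rule: monomial_mats_cases)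
    case (1 a b)
    then show ?thesis using diag by simp
  next
    case (2 a b)
    have "antidiag_mat a b *v z = diag_mat a b *v vector [z $ 2, z $ 1]"
      by (simp add: vec_eq_iff forall_2)
    then show ?thesis using diag[OF 2(1-3), of "vector [z $ 2, z $ 1]"] 2(4) by (simp add: theta_map_symmetries)
  qed
qed

lemma covering_invariant:
  assumes g: "g \<in> covering_group"
  shows "covering (g (torus_pt z)) = covering (torus_pt z)"
proof -
  obtain M c where M: "g = torus_induced gaussian_lattice (\<lambda>z. M *v z + c)" "M \<in> monomial_mats" "c \<in> {0, half_vec}"
  proof -
    have "g \<in> affine_covering_maps" using g covering_group_subset by blast
    then show ?thesis using that by (auto simp: affine_covering_maps_def)
  qed
  obtain k where k: "k \<noteq> 0" "theta_map (M *v z) = k *s theta_map z" using theta_map_monomial[OF M(2)] by blast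
  have "\<exists>l. l \<noteq> 0 \<and> theta_map (M *v z + c) = l *s theta_map (M *v z)"
  proof (cases "c = 0")
    case True
    then show ?thesis by (intro exI[of _ 1]) simp
  next
    case False
    then have "c = half_vec" using M(3) by simp
    then show ?thesis using theta_map_symmetries(3)[of "M *v z"] E_nonzero by (metis mult_eq_0_iff power_not_zero)
  qed
  then obtain l where l: "l \<noteq> 0" "theta_map (M *v z + c) = l *s theta_map (M *v z)" by blast
  have "theta_map (M *v z + c) = (l * k) *s theta_map z" using k l by simp
  moreover have "l * k \<noteq> 0" using k l by simp
  ultimately have "proj_pt (theta_map z) = proj_pt (theta_map (M *v z + c))"
    using theta_map_nonzero by (subst proj_pt_eq_iff) blast+
  then show ?thesis unfolding M(1) torus_induced_pt[OF monomial_mats_compatible[OF M(2)]] covering_pt by (rule sym)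
qed

text \<open>
  The orbit relation contains changes of signs, the exchange of coordinates, the multiplication by \<open>\<i>\<close>
  and the translation by \<open>half_vec\<close>, and by the description of the fibres nothing else is needed.
\<close>

lemma covering_fibre:
  assumes "covering (torus_pt z) = covering (torus_pt w)"
  shows "same_orbit z w"
proof -
  obtain k where "k \<noteq> 0" "theta_map w = k *s theta_map z"
    using assms theta_map_nonzero by (auto simp: covering_pt proj_pt_eq_iff)
  then obtain r where r: "r \<in> {z, \<i> *s z, z + half_vec, \<i> *s z + half_vec}"
    and w: "(w $ 1 + r $ 1 \<in> gaussian_ints \<or> w $ 1 - r $ 1 \<in> gaussian_ints) \<and>
     (w $ 2 + r $ 2 \<in> gaussian_ints \<or> w $ 2 - r $ 2 \<in> gaussian_ints) \<or>
     (w $ 1 + r $ 2 \<in> gaussian_ints \<or> w $ 1 - r $ 2 \<in> gaussian_ints) \<and>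
     (w $ 2 + r $ 1 \<in> gaussian_ints \<or> w $ 2 - r $ 1 \<in> gaussian_ints)"
    by (rule theta_map_fibre)
  have refl: "same_orbit z z" by (rule same_orbit_signs) (simp_all add: gaussian_ints_closed)
  have i: "same_orbit z (\<i> *s z)"
  proof -
    have "diag_mat \<i> \<i> *v z = \<i> *s z" by (simp add: vec_eq_iff forall_2)
    then show ?thesis using same_orbit_Gmp2[OF Gmp2_4_2_mem(2), of z] by simp
  qed
  have zr: "same_orbit z r"
    using r refl i same_orbit_half_vec same_orbit_trans[OF i same_orbit_half_vec] by auto
  have swap: "same_orbit r (antidiag_mat 1 1 *v r)" by (rule same_orbit_Gmp2[OF Gmp2_4_2_mem(1)])
  from w have "same_orbit r w"
  proof
    assume "(w $ 1 + r $ 2 \<in> gaussian_ints \<or> w $ 1 - r $ 2 \<in> gaussian_ints) \<and>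
     (w $ 2 + r $ 1 \<in> gaussian_ints \<or> w $ 2 - r $ 1 \<in> gaussian_ints)"
    then have "same_orbit (antidiag_mat 1 1 *v r) w" by (intro same_orbit_signs) auto
    with swap show ?thesis by (rule same_orbit_trans)
  qed (auto intro: same_orbit_signs)
  with zr show ?thesis by (rule same_orbit_trans)
qed

lemma galois_covering_covering:
  "galois_covering (torus gaussian_lattice) (projective_space :: (3 proj, 2) complex_manifold) covering_group covering"
  unfolding galois_covering_def
proof (intro conjI ballI)
  show "finite covering_group" by (rule finite_covering_group)
  show "subgroup covering_group (BijGroup (points (torus gaussian_lattice)))" by (rule covering_group_subgroup)
  show "holomorphic_map (torus gaussian_lattice) (torus gaussian_lattice) g" if "g \<in> covering_group" for g
    using that by (rule holomorphic_covering_group)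
  show "holomorphic_map (torus gaussian_lattice) (projective_space :: (3 proj, 2) complex_manifold) covering"
    by (rule holomorphic_torus_to_projective[OF covering_pt theta_map_nonzero scalar_holomorphic_theta_map])
  have "p \<in> range (\<lambda>z. covering (torus_pt z))" for p
  proof -
    obtain v where v: "v \<noteq> 0" "p = proj_pt v" by (rule proj_pt_cases)
    obtain z k where "k \<noteq> 0" "theta_map z = k *s v" using theta_map_surj[OF v(1)] .
    then have "p = covering (torus_pt z)"
      using v theta_map_nonzero[of z] by (auto simp: covering_pt proj_pt_eq_iff)
    then show ?thesis by blast
  qed
  then show "covering ` points (torus gaussian_lattice) = points (projective_space :: (3 proj, 2) complex_manifold)"
    by (auto simp: projective_space_def points_torus image_image)
  fix x y assume "x \<in> points (torus gaussian_lattice)" "y \<in> points (torus gaussian_lattice)"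
  then obtain z w where zw: "x = torus_pt z" "y = torus_pt w" by (auto simp: points_torus)
  show "covering x = covering y \<longleftrightarrow> (\<exists>g\<in>covering_group. y = g x)"
    using covering_fibre[of z w] covering_invariant[of _ z] unfolding zw same_orbit_def by metis
qed

lemma covering_semiconjugacy:
  assumes "(D, f) \<in> {(D1, f1), (D2, f2), (D3, f3)}" "x \<in> points (torus gaussian_lattice)"
  shows "covering (torus_induced gaussian_lattice ((*v) D) x) = f (covering x)"
proof -
  obtain z where z: "x = torus_pt z" using assms(2) by (auto simp: points_torus)
  have "lattice_compatible ((*v) D)" using D_compatible[of D 0] assms(1) by auto
  then have "covering (torus_induced gaussian_lattice ((*v) D) x) = proj_pt (theta_map (D *v z))"
    by (simp add: z torus_induced_pt covering_pt)
  also have "\<dots> = f (proj_pt (theta_map z))"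
    using assms(1)
    by (elim insertE emptyE)
      (simp_all only: prod.inject D_mult theta_map_times_1_i theta_map_sum_diff Let_def
        f1.abs_eq[OF proj_rel_refl[OF theta_map_nonzero]] f2.abs_eq[OF proj_rel_refl[OF theta_map_nonzero]]
        f3.abs_eq[OF proj_rel_refl[OF theta_map_nonzero]])
  finally show ?thesis by (simp add: z covering_pt)
qed

end

theorem proposition1p2:
  shows "(\<forall>f\<in>{f1, f2, f3}. critically_finite TYPE(2) f \<and> lattes_example TYPE(2) f) \<and>
    (\<forall>D\<in>{D1, D2, D3}. holomorphic_map (torus gaussian_lattice) (torus gaussian_lattice)
                        (torus_induced gaussian_lattice ((*v) D))) \<and>
    (\<exists>\<sigma>. galois_covering (torus gaussian_lattice)
            (projective_space :: (3 proj, 2) complex_manifold) covering_group \<sigma> \<and>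
          (\<forall>(D, f)\<in>{(D1, f1), (D2, f2), (D3, f3)}. \<forall>x\<in>points (torus gaussian_lattice).
             \<sigma> (torus_induced gaussian_lattice ((*v) D) x) = f (\<sigma> x)))"
proof -
  obtain s where "gaussian_sigma s" using gaussian_sigma_exists by blast
  then interpret gaussian_sigma s .
  have D: "holomorphic_map (torus gaussian_lattice) (torus gaussian_lattice) (torus_induced gaussian_lattice ((*v) D))"
    if "D \<in> {D1, D2, D3}" for D
    using holomorphic_torus_induced[OF D_compatible[OF that] has_derivative_affine, of 0] by simp
  have main: "critically_finite TYPE(2) f \<and> lattes_example TYPE(2) f"
    if f: "lifts_to f (squared_forms p)" "bij p" and Df: "(D, f) \<in> {(D1, f1), (D2, f2), (D3, f3)}" for f p D
  proof
    show "critically_finite TYPE(2) f" by (rule critically_finite_squared_forms[OF f(2,1)])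
    let ?P = "projective_space :: (3 proj, 2) complex_manifold"
    have "holomorphic_map ?P ?P f"
      by (rule holomorphic_projective_self_map[OF f(1) scalar_holomorphic_squared_forms])
    moreover have "\<exists>d\<ge>2. has_degree f d"
      using has_degree_squared_forms[OF f(1)] by (intro exI[of _ 2]) simp
    moreover have "\<exists>\<Lambda> D G \<sigma>. is_lattice \<Lambda> \<and> holomorphic_map (torus \<Lambda>) (torus \<Lambda>) D \<and>
        galois_covering (torus \<Lambda>) (projective_space :: (3 proj, 2) complex_manifold) G \<sigma> \<and>
        (\<forall>x\<in>points (torus \<Lambda>). \<sigma> (D x) = f (\<sigma> x))"
      using is_lattice_gaussian D[of D] Df galois_covering_covering covering_semiconjugacy[OF Df]
      by (intro exI[of _ gaussian_lattice] exI[of _ "torus_induced gaussian_lattice ((*v) D)"]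
          exI[of _ covering_group] exI[of _ covering]) auto
    ultimately show "lattes_example TYPE(2) f"
      unfolding lattes_example_def Let_def by simp
  qed
  show ?thesis
  proof (intro conjI exI[of _ covering])
    show "\<forall>f\<in>{f1, f2, f3}. critically_finite TYPE(2) f \<and> lattes_example TYPE(2) f"
      using main[OF lifts_to_f1, of D1] main[OF lifts_to_f2 bij_swap12, of D2] main[OF lifts_to_f3 bij_cycle312, of D3]
      by simp
    show "\<forall>D\<in>{D1, D2, D3}. holomorphic_map (torus gaussian_lattice) (torus gaussian_lattice)
        (torus_induced gaussian_lattice ((*v) D))"
      using D by blast
    show "galois_covering (torus gaussian_lattice) (projective_space :: (3 proj, 2) complex_manifold) covering_group covering"
      by (rule galois_covering_covering)
    show "\<forall>(D, f)\<in>{(D1, f1), (D2, f2), (D3, f3)}. \<forall>x\<in>points (torus gaussian_lattice).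
        covering (torus_induced gaussian_lattice ((*v) D) x) = f (covering x)"
      using covering_semiconjugacy by blast
  qed
qed

end
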